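(* For every $\lambda\in kG$, $H_\lambda\cong R[y;\delta]$, the differential operator Ore extension of the commutative ring $R=k[x]\otimes kG$ by the derivation $\delta$ of $R$ defined on generators by $\delta(x)=\lambda$ and $\delta(g)=xg$.
   Context: Let $p$ be an odd prime, $k$ an algebraically closed field of characteristic $p$, and $G=\langle g\rangle$ the cyclic group of order $p$ generated by $g=\begin{pmatrix}1&1\\0&1\end{pmatrix}\in \mathrm{SL}(2,p)$. $G$ acts on the free algebra $k\langle x,y\rangle$ by algebra automorphisms with $g\cdot x=x$, $g\cdot y=x+y$, and $k\langle x,y\rangle\rtimes G$ is the smash product (so $gf=(g\cdot f)g$). For $\lambda\in kG$ set $H_\lambda=(k\langle x,y\rangle\rtimes G)/(xy-yx-\lambda)$. For a commutative $k$-algebra $R$ and a $k$-linear derivation $\delta$ of $R$, $R[y;\delta]$ is the ring which is $R[y]$ as a free right $R$-module, with multiplication determined by $ry=yr+\delta(r)$ for $r\in R$. *)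

theory Defs
  imports "HOL-Algebra.Algebra" "HOL-Number_Theory.Residues"
begin

(* Associative, possibly noncommutative K-algebras are records of the library type
   ('k, 'a) module: a ring together with a scalar multiplication. *)

definition has_characteristic :: "('k, 'c) ring_scheme \<Rightarrow> nat \<Rightarrow> bool"
  where "has_characteristic K p \<longleftrightarrow>
    (\<forall>n::nat. [n] \<cdot>\<^bsub>K\<^esub> \<one>\<^bsub>K\<^esub> = \<zero>\<^bsub>K\<^esub> \<longleftrightarrow> p dvd n)"

definition algebra_iso ::
    "('k, 'c) ring_scheme \<Rightarrow> ('k, 'a, 'd) module_scheme \<Rightarrow> ('k, 'b, 'e) module_scheme
      \<Rightarrow> ('a \<Rightarrow> 'b) set"
  where "algebra_iso K A B = {\<phi> \<in> ring_iso A B.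
    \<forall>c\<in>carrier K. \<forall>a\<in>carrier A. \<phi> (c \<odot>\<^bsub>A\<^esub> a) = c \<odot>\<^bsub>B\<^esub> \<phi> a}"

definition isomorphic_algebras ::
    "('k, 'c) ring_scheme \<Rightarrow> ('k, 'a, 'd) module_scheme \<Rightarrow> ('k, 'b, 'e) module_scheme \<Rightarrow> bool"
  where "isomorphic_algebras K A B \<longleftrightarrow> algebra_iso K A B \<noteq> {}"

definition quotient_algebra :: "('k, 'a, 'd) module_scheme \<Rightarrow> 'a set \<Rightarrow> ('k, 'a set) module"
  where "quotient_algebra A I =
    ring.extend (A Quot I) (module.fields (\<lambda>c C. \<Union>x\<in>C. I +>\<^bsub>A\<^esub> (c \<odot>\<^bsub>A\<^esub> x)))"

(* Extensionality makes a derivation determined by its values on the carrier. *)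
definition derivations ::
    "('k, 'c) ring_scheme \<Rightarrow> ('k, 'a, 'd) module_scheme \<Rightarrow> ('a \<Rightarrow> 'a) set"
  where "derivations K A = {\<delta> \<in> carrier A \<rightarrow>\<^sub>E carrier A.
    (\<forall>a\<in>carrier A. \<forall>b\<in>carrier A. \<delta> (a \<oplus>\<^bsub>A\<^esub> b) = \<delta> a \<oplus>\<^bsub>A\<^esub> \<delta> b) \<and>
    (\<forall>c\<in>carrier K. \<forall>a\<in>carrier A. \<delta> (c \<odot>\<^bsub>A\<^esub> a) = c \<odot>\<^bsub>A\<^esub> \<delta> a) \<and>
    (\<forall>a\<in>carrier A. \<forall>b\<in>carrier A.
      \<delta> (a \<otimes>\<^bsub>A\<^esub> b) = (a \<otimes>\<^bsub>A\<^esub> \<delta> b) \<oplus>\<^bsub>A\<^esub> (\<delta> a \<otimes>\<^bsub>A\<^esub> b))}"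

definition supp :: "('a, 'c) ring_scheme \<Rightarrow> ('m \<Rightarrow> 'a) \<Rightarrow> 'm set"
  where "supp A f = {m. f m \<noteq> \<zero>\<^bsub>A\<^esub>}"

(* f stands for the formal sum of all f(m) m; it vanishes outside the carrier of M. *)
definition finsupp_funs ::
    "('a, 'c) ring_scheme \<Rightarrow> ('m, 'd) monoid_scheme \<Rightarrow> ('m \<Rightarrow> 'a) set"
  where "finsupp_funs A M =
    {f \<in> UNIV \<rightarrow> carrier A. finite (supp A f) \<and> supp A f \<subseteq> carrier M}"

definition single :: "('a, 'c) ring_scheme \<Rightarrow> 'm \<Rightarrow> 'a \<Rightarrow> 'm \<Rightarrow> 'a"
  where "single A m a = (\<lambda>u. if u = m then a else \<zero>\<^bsub>A\<^esub>)"

definition monoid_algebra ::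
    "('k, 'c) ring_scheme \<Rightarrow> ('m, 'd) monoid_scheme \<Rightarrow> ('k, 'm \<Rightarrow> 'k) module"
  where "monoid_algebra K M = \<lparr>
    carrier = finsupp_funs K M,
    monoid.mult = (\<lambda>f h u. finsum K (\<lambda>(s, t). f s \<otimes>\<^bsub>K\<^esub> h t)
      {(s, t) \<in> supp K f \<times> supp K h. s \<otimes>\<^bsub>M\<^esub> t = u}),
    one = single K \<one>\<^bsub>M\<^esub> \<one>\<^bsub>K\<^esub>,
    ring.zero = (\<lambda>u. \<zero>\<^bsub>K\<^esub>),
    add = (\<lambda>f h u. f u \<oplus>\<^bsub>K\<^esub> h u),
    smult = (\<lambda>c f u. c \<otimes>\<^bsub>K\<^esub> f u)\<rparr>"

(* The element a g of the smash product is single A g a, and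
   (a s)(b t) = (a (s . b)) (s t), where s . b = act s b. *)
definition smash_product ::
    "('k, 'a, 'd) module_scheme \<Rightarrow> ('g, 'e) monoid_scheme \<Rightarrow> ('g \<Rightarrow> 'a \<Rightarrow> 'a)
      \<Rightarrow> ('k, 'g \<Rightarrow> 'a) module"
  where "smash_product A G act = \<lparr>
    carrier = finsupp_funs A G,
    monoid.mult = (\<lambda>f h u. finsum A (\<lambda>(s, t). f s \<otimes>\<^bsub>A\<^esub> act s (h t))
      {(s, t) \<in> supp A f \<times> supp A h. s \<otimes>\<^bsub>G\<^esub> t = u}),
    one = single A \<one>\<^bsub>G\<^esub> \<one>\<^bsub>A\<^esub>,
    ring.zero = (\<lambda>u. \<zero>\<^bsub>A\<^esub>),
    add = (\<lambda>f h u. f u \<oplus>\<^bsub>A\<^esub> h u),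
    smult = (\<lambda>c f u. c \<odot>\<^bsub>A\<^esub> f u)\<rparr>"

(* The K-vector space with basis A x B, multiplied by (a, b)(c, d) = (ac, bd), modulo the
   bilinearity relations.  Multiplying a relation by a basis element gives a relation, up to
   rewriting the entries, so the ideal is just the span of the relations and the quotient is
   the usual tensor product of vector spaces with (a (x) b)(c (x) d) = ac (x) bd. *)
definition tensor_relations ::
    "('k, 'c) ring_scheme \<Rightarrow> ('k, 'a, 'd) module_scheme \<Rightarrow> ('k, 'b, 'e) module_scheme
      \<Rightarrow> ('a \<times> 'b \<Rightarrow> 'k) set"
  where "tensor_relations K A B =
    (let F = monoid_algebra K (A \<times>\<times> B); e = (\<lambda>a b. single K (a, b) \<one>\<^bsub>K\<^esub>) in
      {e (a \<oplus>\<^bsub>A\<^esub> a') b \<ominus>\<^bsub>F\<^esub> (e a b \<oplus>\<^bsub>F\<^esub> e a' b) | a a' b.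
        a \<in> carrier A \<and> a' \<in> carrier A \<and> b \<in> carrier B} \<union>
      {e a (b \<oplus>\<^bsub>B\<^esub> b') \<ominus>\<^bsub>F\<^esub> (e a b \<oplus>\<^bsub>F\<^esub> e a b') | a b b'.
        a \<in> carrier A \<and> b \<in> carrier B \<and> b' \<in> carrier B} \<union>
      {e (c \<odot>\<^bsub>A\<^esub> a) b \<ominus>\<^bsub>F\<^esub> (c \<odot>\<^bsub>F\<^esub> e a b) | c a b.
        c \<in> carrier K \<and> a \<in> carrier A \<and> b \<in> carrier B} \<union>
      {e a (c \<odot>\<^bsub>B\<^esub> b) \<ominus>\<^bsub>F\<^esub> (c \<odot>\<^bsub>F\<^esub> e a b) | c a b.
        c \<in> carrier K \<and> a \<in> carrier A \<and> b \<in> carrier B})"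

definition tensor_ideal ::
    "('k, 'c) ring_scheme \<Rightarrow> ('k, 'a, 'd) module_scheme \<Rightarrow> ('k, 'b, 'e) module_scheme
      \<Rightarrow> ('a \<times> 'b \<Rightarrow> 'k) set"
  where "tensor_ideal K A B = Idl\<^bsub>monoid_algebra K (A \<times>\<times> B)\<^esub> (tensor_relations K A B)"

definition tensor_algebra ::
    "('k, 'c) ring_scheme \<Rightarrow> ('k, 'a, 'd) module_scheme \<Rightarrow> ('k, 'b, 'e) module_scheme
      \<Rightarrow> ('k, ('a \<times> 'b \<Rightarrow> 'k) set) module"
  where "tensor_algebra K A B =
    quotient_algebra (monoid_algebra K (A \<times>\<times> B)) (tensor_ideal K A B)"

definition pure_tensor ::
    "('k, 'c) ring_scheme \<Rightarrow> ('k, 'a, 'd) module_scheme \<Rightarrow> ('k, 'b, 'e) module_scheme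
      \<Rightarrow> 'a \<Rightarrow> 'b \<Rightarrow> ('a \<times> 'b \<Rightarrow> 'k) set"
  where "pure_tensor K A B a b =
    tensor_ideal K A B +>\<^bsub>monoid_algebra K (A \<times>\<times> B)\<^esub> single K (a, b) \<one>\<^bsub>K\<^esub>"

(* A sequence f stands for the sum of all y^n f(n), with coefficients on the right.  Since
   y^n r y = y^(n+1) r + y^n \<delta>(r), right multiplication by y is ore_shift. *)
definition ore_shift ::
    "('a, 'c) ring_scheme \<Rightarrow> ('a \<Rightarrow> 'a) \<Rightarrow> (nat \<Rightarrow> 'a) \<Rightarrow> nat \<Rightarrow> 'a"
  where "ore_shift R \<delta> f =
    (\<lambda>n. (if n = 0 then \<zero>\<^bsub>R\<^esub> else f (n - 1)) \<oplus>\<^bsub>R\<^esub> \<delta> (f n))"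

definition ore_extension ::
    "('k, 'a, 'd) module_scheme \<Rightarrow> ('a \<Rightarrow> 'a) \<Rightarrow> ('k, nat \<Rightarrow> 'a) module"
  where "ore_extension R \<delta> = \<lparr>
    carrier = carrier (UP R),
    monoid.mult = (\<lambda>f h n. \<Oplus>\<^bsub>R\<^esub>j \<in> supp R h. (ore_shift R \<delta> ^^ j) f n \<otimes>\<^bsub>R\<^esub> h j),
    one = \<one>\<^bsub>UP R\<^esub>,
    ring.zero = \<zero>\<^bsub>UP R\<^esub>,
    add = add (UP R),
    smult = (\<lambda>c f n. c \<odot>\<^bsub>R\<^esub> f n)\<rparr>"

datatype letter = LX | LY

definition free_monoid :: "letter list monoid"
  where "free_monoid = \<lparr>carrier = UNIV, monoid.mult = (@), one = []\<rparr>"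

definition free_algebra :: "('k, 'c) ring_scheme \<Rightarrow> ('k, letter list \<Rightarrow> 'k) module"
  where "free_algebra K = monoid_algebra K free_monoid"

definition gen :: "('k, 'c) ring_scheme \<Rightarrow> letter \<Rightarrow> letter list \<Rightarrow> 'k"
  where "gen K l = single K [l] \<one>\<^bsub>K\<^esub>"

definition substitution ::
    "('k, 'c) ring_scheme \<Rightarrow> (letter \<Rightarrow> letter list \<Rightarrow> 'k) \<Rightarrow> (letter list \<Rightarrow> 'k) \<Rightarrow> letter list \<Rightarrow> 'k"
  where "substitution K \<sigma> f =
    (\<Oplus>\<^bsub>free_algebra K\<^esub>w \<in> supp K f.
      f w \<odot>\<^bsub>free_algebra K\<^esub> foldr (\<lambda>l q. \<sigma> l \<otimes>\<^bsub>free_algebra K\<^esub> q) w \<one>\<^bsub>free_algebra K\<^esub>)"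

(* (a, b, c, d) is the matrix with rows (a, b) and (c, d). *)
definition SL2 :: "('a, 'c) ring_scheme \<Rightarrow> ('a \<times> 'a \<times> 'a \<times> 'a) monoid"
  where "SL2 R = \<lparr>
    carrier = {(a, b, c, d). a \<in> carrier R \<and> b \<in> carrier R \<and> c \<in> carrier R \<and> d \<in> carrier R \<and>
      (a \<otimes>\<^bsub>R\<^esub> d) \<ominus>\<^bsub>R\<^esub> (b \<otimes>\<^bsub>R\<^esub> c) = \<one>\<^bsub>R\<^esub>},
    monoid.mult = (\<lambda>(a, b, c, d) (a', b', c', d').
      ((a \<otimes>\<^bsub>R\<^esub> a') \<oplus>\<^bsub>R\<^esub> (b \<otimes>\<^bsub>R\<^esub> c'), (a \<otimes>\<^bsub>R\<^esub> b') \<oplus>\<^bsub>R\<^esub> (b \<otimes>\<^bsub>R\<^esub> d'),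
       (c \<otimes>\<^bsub>R\<^esub> a') \<oplus>\<^bsub>R\<^esub> (d \<otimes>\<^bsub>R\<^esub> c'), (c \<otimes>\<^bsub>R\<^esub> b') \<oplus>\<^bsub>R\<^esub> (d \<otimes>\<^bsub>R\<^esub> d'))),
    one = (\<one>\<^bsub>R\<^esub>, \<zero>\<^bsub>R\<^esub>, \<zero>\<^bsub>R\<^esub>, \<one>\<^bsub>R\<^esub>)\<rparr>"

type_synonym mat2 = "int \<times> int \<times> int \<times> int"

definition g_mat :: mat2
  where "g_mat = (1, 1, 0, 1)"

definition cyc_group :: "nat \<Rightarrow> mat2 monoid"
  where "cyc_group p = subgroup_generated (SL2 (residue_ring (int p))) {g_mat}"

(* The action of matrices on the column vectors spanned by x and y, extended to algebra
   endomorphisms; in particular g_mat fixes x and sends y to x + y.  The entries, elements of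
   the prime field, act through their integer representatives, which is well defined in
   characteristic p. *)
definition mat_act :: "('k, 'c) ring_scheme \<Rightarrow> mat2 \<Rightarrow> (letter list \<Rightarrow> 'k) \<Rightarrow> letter list \<Rightarrow> 'k"
  where "mat_act K M = (case M of (a, b, c, d) \<Rightarrow>
    let F = free_algebra K; x = gen K LX; y = gen K LY in
      substitution K (\<lambda>l. case l of
        LX \<Rightarrow> ([a] \<cdot>\<^bsub>F\<^esub> x) \<oplus>\<^bsub>F\<^esub> ([c] \<cdot>\<^bsub>F\<^esub> y)
      | LY \<Rightarrow> ([b] \<cdot>\<^bsub>F\<^esub> x) \<oplus>\<^bsub>F\<^esub> ([d] \<cdot>\<^bsub>F\<^esub> y)))"

definition free_smash :: "('k, 'c) ring_scheme \<Rightarrow> nat \<Rightarrow> ('k, mat2 \<Rightarrow> letter list \<Rightarrow> 'k) module"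
  where "free_smash K p = smash_product (free_algebra K) (cyc_group p) (mat_act K)"

definition group_algebra :: "('k, 'c) ring_scheme \<Rightarrow> nat \<Rightarrow> ('k, mat2 \<Rightarrow> 'k) module"
  where "group_algebra K p = monoid_algebra K (cyc_group p)"

definition H_algebra ::
    "('k, 'c) ring_scheme \<Rightarrow> nat \<Rightarrow> (mat2 \<Rightarrow> 'k) \<Rightarrow> ('k, (mat2 \<Rightarrow> letter list \<Rightarrow> 'k) set) module"
  where "H_algebra K p lam =
    (let A = free_algebra K; S = free_smash K p;
         x = single A \<one>\<^bsub>cyc_group p\<^esub> (gen K LX);
         y = single A \<one>\<^bsub>cyc_group p\<^esub> (gen K LY);
         lamS = (\<lambda>s. lam s \<odot>\<^bsub>A\<^esub> \<one>\<^bsub>A\<^esub>)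
     in quotient_algebra S (Idl\<^bsub>S\<^esub> {(x \<otimes>\<^bsub>S\<^esub> y) \<ominus>\<^bsub>S\<^esub> (y \<otimes>\<^bsub>S\<^esub> x) \<ominus>\<^bsub>S\<^esub> lamS}))"

definition R_algebra ::
    "('k, 'c) ring_scheme \<Rightarrow> nat \<Rightarrow> ('k, ((nat \<Rightarrow> 'k) \<times> (mat2 \<Rightarrow> 'k) \<Rightarrow> 'k) set) module"
  where "R_algebra K p = tensor_algebra K (UP K) (group_algebra K p)"

definition R_of_poly ::
    "('k, 'c) ring_scheme \<Rightarrow> nat \<Rightarrow> (nat \<Rightarrow> 'k) \<Rightarrow> ((nat \<Rightarrow> 'k) \<times> (mat2 \<Rightarrow> 'k) \<Rightarrow> 'k) set"
  where "R_of_poly K p f =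
    pure_tensor K (UP K) (group_algebra K p) f \<one>\<^bsub>group_algebra K p\<^esub>"

definition R_of_group_algebra ::
    "('k, 'c) ring_scheme \<Rightarrow> nat \<Rightarrow> (mat2 \<Rightarrow> 'k) \<Rightarrow> ((nat \<Rightarrow> 'k) \<times> (mat2 \<Rightarrow> 'k) \<Rightarrow> 'k) set"
  where "R_of_group_algebra K p = pure_tensor K (UP K) (group_algebra K p) \<one>\<^bsub>UP K\<^esub>"

definition R_x :: "('k, 'c) ring_scheme \<Rightarrow> nat \<Rightarrow> ((nat \<Rightarrow> 'k) \<times> (mat2 \<Rightarrow> 'k) \<Rightarrow> 'k) set"
  where "R_x K p = R_of_poly K p (up_ring.monom (UP K) \<one>\<^bsub>K\<^esub> 1)"

definition R_g :: "('k, 'c) ring_scheme \<Rightarrow> nat \<Rightarrow> ((nat \<Rightarrow> 'k) \<times> (mat2 \<Rightarrow> 'k) \<Rightarrow> 'k) set"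
  where "R_g K p = R_of_group_algebra K p (single K g_mat \<one>\<^bsub>K\<^esub>)"

end

(*
  All the algebras are handled through their universal properties.  A homomorphism from R to an
  algebra B is a pair of commuting elements x, u of B with u^p = 1; with values in the dual numbers
  over R this yields the derivation, because g + x g epsilon has order p in characteristic p.
  A homomorphism from H_lambda to B is a triple x, y, u with u^p = 1, u x = x u, u y = (x + y) u
  and x y = y x + lambda(u), and one from R[y; delta] is a homomorphism rho on R with an element y
  such that rho(r) y = y rho(r) + rho(delta r).  The generators of each of the two algebras satisfy
  the relations of the other, so there are homomorphisms in both directions; they are mutually
  inverse since they are so on generators.
*)
theory Submission
  imports Defs
begin

section \<open>Algebras over a commutative ring\<close>

text \<open>The obstacle is that \<open>H_algebra\<close> is a quotient by a generated ideal and
  comes with no normal form. Proving that the monomials y^n x^i g^j form a basis would amount to a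
  PBW theorem. Only the universal property is used instead, and linear independence is never
  discussed: it is built into the Ore extension, whose carrier is explicit. The price is that the
  Ore extension and the smash product must be shown to be associative algebras directly on
  coefficient functions, each together with its mapping property. The values of \<delta> are forced:
  x y = y x + \<lambda> and g y = y g + x g are the rule r y = y r + \<delta>(r) for r = x and r =
  g. Conversely this rule is tested only on x and g, because by the Leibniz identity the r that obey
  it form a subalgebra of R.\<close>

lemma (in abelian_group) eq_add_of_minus_minus_eq_zero:
  assumes a: "a \<in> carrier G" and b: "b \<in> carrier G" and c: "c \<in> carrier G"
    and "a \<ominus> b \<ominus> c = \<zero>"
  shows "a = b \<oplus> c"
proof -
  have "a = (a \<ominus> b \<ominus> c) \<oplus> (b \<oplus> c)"
    using a b c by (simp add: a_minus_def a_ac r_neg r_neg1)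
  then show ?thesis using assms by simp
qed

text \<open>Since A may be noncommutative, scalars are required to pass both factors of a product;
  together the two laws put the image of K in the centre of A. This centrality later lets scalars
  serve as coefficients of monoid algebras.\<close>

locale kalgebra = K: cring K + A: ring A
  for K :: "('k, 'c) ring_scheme" and A :: "('k, 'a, 'd) module_scheme" +
  assumes smult_closed [simp, intro]:
      "\<lbrakk>c \<in> carrier K; a \<in> carrier A\<rbrakk> \<Longrightarrow> c \<odot>\<^bsub>A\<^esub> a \<in> carrier A"
    and smult_l_distr: "\<lbrakk>c \<in> carrier K; d \<in> carrier K; a \<in> carrier A\<rbrakk> \<Longrightarrow>
      (c \<oplus>\<^bsub>K\<^esub> d) \<odot>\<^bsub>A\<^esub> a = c \<odot>\<^bsub>A\<^esub> a \<oplus>\<^bsub>A\<^esub> d \<odot>\<^bsub>A\<^esub> a"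
    and smult_r_distr: "\<lbrakk>c \<in> carrier K; a \<in> carrier A; b \<in> carrier A\<rbrakk> \<Longrightarrow>
      c \<odot>\<^bsub>A\<^esub> (a \<oplus>\<^bsub>A\<^esub> b) = c \<odot>\<^bsub>A\<^esub> a \<oplus>\<^bsub>A\<^esub> c \<odot>\<^bsub>A\<^esub> b"
    and smult_assoc: "\<lbrakk>c \<in> carrier K; d \<in> carrier K; a \<in> carrier A\<rbrakk> \<Longrightarrow>
      (c \<otimes>\<^bsub>K\<^esub> d) \<odot>\<^bsub>A\<^esub> a = c \<odot>\<^bsub>A\<^esub> (d \<odot>\<^bsub>A\<^esub> a)"
    and smult_one [simp]: "a \<in> carrier A \<Longrightarrow> \<one>\<^bsub>K\<^esub> \<odot>\<^bsub>A\<^esub> a = a"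
    and smult_mult_left: "\<lbrakk>c \<in> carrier K; a \<in> carrier A; b \<in> carrier A\<rbrakk> \<Longrightarrow>
      (c \<odot>\<^bsub>A\<^esub> a) \<otimes>\<^bsub>A\<^esub> b = c \<odot>\<^bsub>A\<^esub> (a \<otimes>\<^bsub>A\<^esub> b)"
    and smult_mult_right: "\<lbrakk>c \<in> carrier K; a \<in> carrier A; b \<in> carrier A\<rbrakk> \<Longrightarrow>
      a \<otimes>\<^bsub>A\<^esub> (c \<odot>\<^bsub>A\<^esub> b) = c \<odot>\<^bsub>A\<^esub> (a \<otimes>\<^bsub>A\<^esub> b)"
begin

sublocale module K A
  by unfold_locales (simp_all add: smult_l_distr smult_r_distr smult_assoc)

end

definition alg_hom ::
    "('k, 'c) ring_scheme \<Rightarrow> ('k, 'a, 'd) module_scheme \<Rightarrow> ('k, 'b, 'e) module_scheme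
      \<Rightarrow> ('a \<Rightarrow> 'b) set"
  where "alg_hom K A B = {\<phi> \<in> ring_hom A B.
    \<forall>c\<in>carrier K. \<forall>a\<in>carrier A. \<phi> (c \<odot>\<^bsub>A\<^esub> a) = c \<odot>\<^bsub>B\<^esub> \<phi> a}"

lemma alg_homI:
  assumes "\<And>a. a \<in> carrier A \<Longrightarrow> \<phi> a \<in> carrier B"
    and "\<And>a b. \<lbrakk>a \<in> carrier A; b \<in> carrier A\<rbrakk> \<Longrightarrow> \<phi> (a \<oplus>\<^bsub>A\<^esub> b) = \<phi> a \<oplus>\<^bsub>B\<^esub> \<phi> b"
    and "\<And>a b. \<lbrakk>a \<in> carrier A; b \<in> carrier A\<rbrakk> \<Longrightarrow> \<phi> (a \<otimes>\<^bsub>A\<^esub> b) = \<phi> a \<otimes>\<^bsub>B\<^esub> \<phi> b"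
    and "\<phi> \<one>\<^bsub>A\<^esub> = \<one>\<^bsub>B\<^esub>"
    and "\<And>c a. \<lbrakk>c \<in> carrier K; a \<in> carrier A\<rbrakk> \<Longrightarrow> \<phi> (c \<odot>\<^bsub>A\<^esub> a) = c \<odot>\<^bsub>B\<^esub> \<phi> a"
  shows "\<phi> \<in> alg_hom K A B"
  using assms by (auto simp: alg_hom_def ring_hom_def)

lemma alg_homD:
  assumes "\<phi> \<in> alg_hom K A B"
  shows alg_hom_closed: "\<And>a. a \<in> carrier A \<Longrightarrow> \<phi> a \<in> carrier B"
    and alg_hom_add:
      "\<And>a b. \<lbrakk>a \<in> carrier A; b \<in> carrier A\<rbrakk> \<Longrightarrow> \<phi> (a \<oplus>\<^bsub>A\<^esub> b) = \<phi> a \<oplus>\<^bsub>B\<^esub> \<phi> b"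
    and alg_hom_mult:
      "\<And>a b. \<lbrakk>a \<in> carrier A; b \<in> carrier A\<rbrakk> \<Longrightarrow> \<phi> (a \<otimes>\<^bsub>A\<^esub> b) = \<phi> a \<otimes>\<^bsub>B\<^esub> \<phi> b"
    and alg_hom_one: "\<phi> \<one>\<^bsub>A\<^esub> = \<one>\<^bsub>B\<^esub>"
    and alg_hom_smult:
      "\<And>c a. \<lbrakk>c \<in> carrier K; a \<in> carrier A\<rbrakk> \<Longrightarrow> \<phi> (c \<odot>\<^bsub>A\<^esub> a) = c \<odot>\<^bsub>B\<^esub> \<phi> a"
  using assms by (auto simp: alg_hom_def ring_hom_def)

text \<open>Zero is the scalar 0 times 1, so preservation of scalars and of 1 suffices;
  \<open>ring_hom\<close> itself speaks only of sums, products and 1.\<close>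

lemma alg_hom_zero:
  assumes "kalgebra K A" and "kalgebra K B" and h: "\<phi> \<in> alg_hom K A B"
  shows "\<phi> \<zero>\<^bsub>A\<^esub> = \<zero>\<^bsub>B\<^esub>"
proof -
  interpret A: kalgebra K A by fact
  interpret B: kalgebra K B by fact
  have "\<phi> \<zero>\<^bsub>A\<^esub> = \<phi> (\<zero>\<^bsub>K\<^esub> \<odot>\<^bsub>A\<^esub> \<one>\<^bsub>A\<^esub>)" by simp
  also have "\<dots> = \<zero>\<^bsub>B\<^esub>" by (simp add: alg_homD[OF h] del: A.smult_l_null)
  finally show ?thesis .
qed

lemma alg_hom_neg:
  assumes "kalgebra K A" and "kalgebra K B" and h: "\<phi> \<in> alg_hom K A B" and a: "a \<in> carrier A"
  shows "\<phi> (\<ominus>\<^bsub>A\<^esub> a) = \<ominus>\<^bsub>B\<^esub> \<phi> a"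
proof -
  interpret A: kalgebra K A by fact
  interpret B: kalgebra K B by fact
  have "\<phi> (\<ominus>\<^bsub>A\<^esub> a) \<oplus>\<^bsub>B\<^esub> \<phi> a = \<phi> (\<ominus>\<^bsub>A\<^esub> a \<oplus>\<^bsub>A\<^esub> a)"
    using a by (simp add: alg_homD[OF h])
  also have "\<dots> = \<zero>\<^bsub>B\<^esub>"
    using a alg_hom_zero[OF assms(1-3)] by (simp add: A.A.l_neg)
  finally show ?thesis
    using a by (metis A.A.a_inv_closed B.A.minus_equality alg_hom_closed[OF h])
qed

lemma alg_hom_minus:
  assumes "kalgebra K A" and "kalgebra K B" and h: "\<phi> \<in> alg_hom K A B"
    and "a \<in> carrier A" and "b \<in> carrier A"
  shows "\<phi> (a \<ominus>\<^bsub>A\<^esub> b) = \<phi> a \<ominus>\<^bsub>B\<^esub> \<phi> b"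
proof -
  interpret A: kalgebra K A by fact
  show ?thesis
    using assms by (simp add: a_minus_def alg_hom_add[OF h] alg_hom_neg[OF assms(1-3)])
qed

lemma alg_hom_pow:
  fixes n :: nat
  assumes "kalgebra K A" and "kalgebra K B" and h: "\<phi> \<in> alg_hom K A B" and a: "a \<in> carrier A"
  shows "\<phi> (a [^]\<^bsub>A\<^esub> n) = \<phi> a [^]\<^bsub>B\<^esub> n"
proof -
  interpret A: kalgebra K A by fact
  interpret B: kalgebra K B by fact
  show ?thesis using a by (induction n) (simp_all add: alg_homD[OF h])
qed

lemma alg_hom_comp:
  assumes f: "f \<in> alg_hom K A B" and g: "g \<in> alg_hom K B C"
  shows "(\<lambda>a. g (f a)) \<in> alg_hom K A C"
  by (rule alg_homI) (simp_all add: alg_homD[OF f] alg_homD[OF g])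

lemma alg_hom_id: "(\<lambda>a. a) \<in> alg_hom K A A"
  by (rule alg_homI) simp_all

section \<open>Generated subalgebras and homomorphisms determined on generators\<close>

definition alg_closed ::
    "('k, 'c) ring_scheme \<Rightarrow> ('k, 'a, 'd) module_scheme \<Rightarrow> 'a set \<Rightarrow> bool"
  where "alg_closed K A Y \<longleftrightarrow> \<one>\<^bsub>A\<^esub> \<in> Y \<and>
    (\<forall>a\<in>Y. \<forall>b\<in>Y. a \<oplus>\<^bsub>A\<^esub> b \<in> Y \<and> a \<otimes>\<^bsub>A\<^esub> b \<in> Y) \<and>
    (\<forall>c\<in>carrier K. \<forall>a\<in>Y. c \<odot>\<^bsub>A\<^esub> a \<in> Y)"

text \<open>The intersection runs over all sets of the type, inside the carrier or not, so the
  closure rules hold without membership hypotheses. In an algebra, zero and negatives come from the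
  scalars 0 and -1, which is why \<open>alg_closed\<close> does not list them.\<close>

definition alg_span ::
    "('k, 'c) ring_scheme \<Rightarrow> ('k, 'a, 'd) module_scheme \<Rightarrow> 'a set \<Rightarrow> 'a set"
  where "alg_span K A U = \<Inter>{Y. U \<subseteq> Y \<and> alg_closed K A Y}"

lemma alg_span_intros:
  shows span_incl: "x \<in> U \<Longrightarrow> x \<in> alg_span K A U"
    and span_one: "\<one>\<^bsub>A\<^esub> \<in> alg_span K A U"
    and span_add: "\<lbrakk>a \<in> alg_span K A U; b \<in> alg_span K A U\<rbrakk> \<Longrightarrow> a \<oplus>\<^bsub>A\<^esub> b \<in> alg_span K A U"
    and span_mult: "\<lbrakk>a \<in> alg_span K A U; b \<in> alg_span K A U\<rbrakk> \<Longrightarrow> a \<otimes>\<^bsub>A\<^esub> b \<in> alg_span K A U"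
    and span_smult: "\<lbrakk>c \<in> carrier K; a \<in> alg_span K A U\<rbrakk> \<Longrightarrow> c \<odot>\<^bsub>A\<^esub> a \<in> alg_span K A U"
  by (auto simp: alg_span_def alg_closed_def)

lemma alg_span_minimal:
  assumes "U \<subseteq> Y" and "alg_closed K A Y"
  shows "alg_span K A U \<subseteq> Y"
  using assms by (auto simp: alg_span_def)

lemma alg_span_pow:
  fixes n :: nat
  assumes "a \<in> alg_span K A U"
  shows "a [^]\<^bsub>A\<^esub> n \<in> alg_span K A U"
  using assms by (induction n) (auto intro: alg_span_intros simp: nat_pow_def)

context kalgebra
begin

text \<open>Minimality of the span is applied to the set of those carrier elements that satisfy
  \<open>P\<close>; this also supplies carrier membership in every induction step.\<close>

lemma alg_span_induct [consumes 3, case_names incl one add mult smult]: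
  assumes gen: "carrier A \<subseteq> alg_span K A U" and U: "U \<subseteq> carrier A" and a: "a \<in> carrier A"
    and "\<And>x. x \<in> U \<Longrightarrow> P x" and "P \<one>\<^bsub>A\<^esub>"
    and "\<And>a b. \<lbrakk>a \<in> carrier A; b \<in> carrier A; P a; P b\<rbrakk> \<Longrightarrow> P (a \<oplus>\<^bsub>A\<^esub> b)"
    and "\<And>a b. \<lbrakk>a \<in> carrier A; b \<in> carrier A; P a; P b\<rbrakk> \<Longrightarrow> P (a \<otimes>\<^bsub>A\<^esub> b)"
    and "\<And>c a. \<lbrakk>c \<in> carrier K; a \<in> carrier A; P a\<rbrakk> \<Longrightarrow> P (c \<odot>\<^bsub>A\<^esub> a)"
  shows "P a"
proof -
  have "alg_span K A U \<subseteq> {a \<in> carrier A. P a}"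
    by (rule alg_span_minimal) (use assms(4-) U in \<open>auto simp: alg_closed_def\<close>)
  then show ?thesis using gen a by blast
qed

lemma scalar_mult:
  assumes "c \<in> carrier K" and "a \<in> carrier A"
  shows "(c \<odot>\<^bsub>A\<^esub> \<one>\<^bsub>A\<^esub>) \<otimes>\<^bsub>A\<^esub> a = c \<odot>\<^bsub>A\<^esub> a" "a \<otimes>\<^bsub>A\<^esub> (c \<odot>\<^bsub>A\<^esub> \<one>\<^bsub>A\<^esub>) = c \<odot>\<^bsub>A\<^esub> a"
  using assms by (simp_all add: smult_mult_left smult_mult_right)

end

text \<open>The set where two homomorphisms agree is a subalgebra. This is the uniqueness half of
  all the universal properties; agreement is meant on the carrier, since homomorphisms are not
  extensional here.\<close>

lemma alg_hom_agree:
  assumes "kalgebra K A" and f: "f \<in> alg_hom K A B" and g: "g \<in> alg_hom K A B"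
    and gen: "carrier A \<subseteq> alg_span K A U" "U \<subseteq> carrier A"
    and agree: "\<And>x. x \<in> U \<Longrightarrow> f x = g x" and a: "a \<in> carrier A"
  shows "f a = g a"
proof -
  interpret kalgebra K A by fact
  show ?thesis
    using gen a by (induction rule: alg_span_induct)
      (simp_all add: agree alg_homD[OF f] alg_homD[OF g])
qed

text \<open>Preimages of subalgebras are subalgebras. The lemma carries generating sets along
  homomorphisms: into quotients, from tensor factors, and along the embeddings into smash products
  and Ore extensions.\<close>

lemma alg_hom_span:
  assumes "kalgebra K A" and f: "f \<in> alg_hom K A B"
    and gen: "carrier A \<subseteq> alg_span K A U" "U \<subseteq> carrier A"
    and im: "f ` U \<subseteq> alg_span K B Y" and a: "a \<in> carrier A"
  shows "f a \<in> alg_span K B Y"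
proof -
  interpret kalgebra K A by fact
  show ?thesis
    using gen a im by (induction rule: alg_span_induct)
      (auto simp: alg_homD[OF f] intro: alg_span_intros)
qed

lemma isomorphic_algebrasI:
  assumes f: "f \<in> alg_hom K A B" and g: "g \<in> alg_hom K B A"
    and gf: "\<And>a. a \<in> carrier A \<Longrightarrow> g (f a) = a"
    and fg: "\<And>b. b \<in> carrier B \<Longrightarrow> f (g b) = b"
  shows "isomorphic_algebras K A B"
proof -
  have "bij_betw f (carrier A) (carrier B)"
    by (rule bij_betw_byWitness[where f' = g])
      (auto simp: gf fg alg_hom_closed[OF f] alg_hom_closed[OF g])
  then have "f \<in> algebra_iso K A B"
    using f by (simp add: algebra_iso_def alg_hom_def ring_iso_def)
  then show ?thesis by (auto simp: isomorphic_algebras_def)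
qed

text \<open>K as an algebra over itself, in the record type of algebras. With these coefficients and
  the trivial action the smash product is the monoid algebra, so one construction yields group
  algebra, free algebra, polynomials and the basis algebra behind the tensor product.\<close>

definition scalar_algebra :: "('k, 'c) ring_scheme \<Rightarrow> ('k, 'k) module"
  where "scalar_algebra K = \<lparr>carrier = carrier K, monoid.mult = monoid.mult K, one = \<one>\<^bsub>K\<^esub>,
    ring.zero = \<zero>\<^bsub>K\<^esub>, add = add K, smult = monoid.mult K\<rparr>"

lemma scalar_algebra_simps [simp]:
  "carrier (scalar_algebra K) = carrier K" "monoid.mult (scalar_algebra K) = monoid.mult K"
  "one (scalar_algebra K) = one K" "ring.zero (scalar_algebra K) = ring.zero K"
  "add (scalar_algebra K) = add K" "smult (scalar_algebra K) = monoid.mult K"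
  "supp (scalar_algebra K) = supp K" "finsum (scalar_algebra K) = finsum K"
  "single (scalar_algebra K) = single K" "finsupp_funs (scalar_algebra K) M = finsupp_funs K M"
  by (simp_all add: scalar_algebra_def supp_def finsum_def finprod_def single_def
      finsupp_funs_def fun_eq_iff)

lemma scalar_algebra:
  assumes "cring K"
  shows "kalgebra K (scalar_algebra K)"
proof -
  interpret cring K by fact
  have "ring (scalar_algebra K)"
    by (rule ringI, rule abelian_groupI, auto simp: a_ac l_distr r_distr m_assoc
        intro!: monoidI bexI[of _ "\<ominus>\<^bsub>K\<^esub> _"])
  then show ?thesis
    by (auto intro!: kalgebra.intro kalgebra_axioms.intro is_cring
        simp: l_distr r_distr m_ac)
qed

lemma scalar_hom:
  assumes "kalgebra K A"
  shows "(\<lambda>c. c \<odot>\<^bsub>A\<^esub> \<one>\<^bsub>A\<^esub>) \<in> alg_hom K (scalar_algebra K) A"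
proof -
  interpret kalgebra K A by fact
  show ?thesis
    by (rule alg_homI) (auto simp: smult_l_distr smult_assoc smult_mult_left)
qed

lemma alg_hom_cong:
  assumes "kalgebra K A" and f: "f \<in> alg_hom K A B" and eq: "\<And>a. a \<in> carrier A \<Longrightarrow> f a = g a"
  shows "g \<in> alg_hom K A B"
proof -
  interpret kalgebra K A by fact
  show ?thesis
    by (rule alg_homI) (simp_all add: alg_homD[OF f] flip: eq)
qed

text \<open>The centralizer of \<open>z\<close> is closed under the algebra operations, so it
  contains the whole image once it contains the images of generators.\<close>

lemma commute_with_image:
  assumes "kalgebra K A" and B: "kalgebra K B" and f: "f \<in> alg_hom K A B"
    and gen: "carrier A \<subseteq> alg_span K A U" "U \<subseteq> carrier A"
    and z: "z \<in> carrier B" and comm: "\<And>u. u \<in> U \<Longrightarrow> f u \<otimes>\<^bsub>B\<^esub> z = z \<otimes>\<^bsub>B\<^esub> f u"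
    and a: "a \<in> carrier A"
  shows "f a \<otimes>\<^bsub>B\<^esub> z = z \<otimes>\<^bsub>B\<^esub> f a"
proof -
  interpret kalgebra K A by fact
  interpret B: kalgebra K B by fact
  note [simp] = alg_homD[OF f]
  show ?thesis
    using gen a
  proof (induction rule: alg_span_induct)
    case (mult a b)
    have "f a \<otimes>\<^bsub>B\<^esub> f b \<otimes>\<^bsub>B\<^esub> z = (f a \<otimes>\<^bsub>B\<^esub> z) \<otimes>\<^bsub>B\<^esub> f b"
      using mult(1,2,4) z by (simp add: B.A.m_assoc)
    also have "\<dots> = z \<otimes>\<^bsub>B\<^esub> f a \<otimes>\<^bsub>B\<^esub> f b" using mult by simp
    finally show ?case using mult(1,2) z by (simp add: B.A.m_assoc)
  qed (simp_all add: comm z B.A.l_distr B.A.r_distr B.smult_mult_left B.smult_mult_right)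
qed

context kalgebra
begin

abbreviation nat_scalar :: "nat \<Rightarrow> 'k" where "nat_scalar n \<equiv> [n] \<cdot>\<^bsub>K\<^esub> \<one>\<^bsub>K\<^esub>"

lemma add_pow_eq_smult: "a \<in> carrier A \<Longrightarrow> [(n :: nat)] \<cdot>\<^bsub>A\<^esub> a = nat_scalar n \<odot>\<^bsub>A\<^esub> a"
  by (induction n) (simp_all add: smult_l_distr)

end

section \<open>Smash products\<close>

lemma finsupp_funs_iff:
  "f \<in> finsupp_funs A M \<longleftrightarrow>
    (\<forall>m. f m \<in> carrier A) \<and> finite (supp A f) \<and> supp A f \<subseteq> carrier M"
  by (auto simp: finsupp_funs_def)

lemma supp_single: "supp A (single A m a) \<subseteq> {m}"
  by (auto simp: supp_def single_def)

text \<open>Terms outside the support vanish by \<open>t0\<close>, so any finite set around the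
  support may replace it; functions with different supports can then be summed over a common
  set.\<close>

lemma finsum_finsupp_eq:
  assumes "abelian_monoid B" and f: "f \<in> finsupp_funs A M"
    and F: "finite F" "supp A f \<subseteq> F" "F \<subseteq> carrier M"
    and t: "\<And>m a. \<lbrakk>m \<in> carrier M; a \<in> carrier A\<rbrakk> \<Longrightarrow> t m a \<in> carrier B"
    and t0: "\<And>m. m \<in> carrier M \<Longrightarrow> t m \<zero>\<^bsub>A\<^esub> = \<zero>\<^bsub>B\<^esub>"
  shows "(\<Oplus>\<^bsub>B\<^esub>m\<in>supp A f. t m (f m)) = (\<Oplus>\<^bsub>B\<^esub>m\<in>F. t m (f m))"
proof -
  interpret abelian_monoid B by fact
  show ?thesis
  proof (rule add.finprod_mono_neutral_cong_left)
    show "(\<lambda>m. t m (f m)) \<in> F \<rightarrow> carrier B"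
      using f F t by (auto simp: finsupp_funs_iff)
    show "t m (f m) = \<zero>\<^bsub>B\<^esub>" if "m \<in> F - supp A f" for m
      using that F t0 by (auto simp: supp_def)
  qed (use F in auto)
qed

text \<open>Cancellation can make the support of the sum smaller than the union of the supports, so
  all three sums are taken over that union before terms are added.\<close>

lemma finsum_finsupp_add:
  assumes "ring A" and "abelian_monoid B"
    and f: "f \<in> finsupp_funs A M" and h: "h \<in> finsupp_funs A M"
    and t: "\<And>m a. \<lbrakk>m \<in> carrier M; a \<in> carrier A\<rbrakk> \<Longrightarrow> t m a \<in> carrier B"
    and ta: "\<And>m a b. \<lbrakk>m \<in> carrier M; a \<in> carrier A; b \<in> carrier A\<rbrakk> \<Longrightarrow>
      t m (a \<oplus>\<^bsub>A\<^esub> b) = t m a \<oplus>\<^bsub>B\<^esub> t m b"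
    and t0: "\<And>m. m \<in> carrier M \<Longrightarrow> t m \<zero>\<^bsub>A\<^esub> = \<zero>\<^bsub>B\<^esub>"
  shows "(\<lambda>m. f m \<oplus>\<^bsub>A\<^esub> h m) \<in> finsupp_funs A M"
    and "(\<Oplus>\<^bsub>B\<^esub>m\<in>supp A (\<lambda>m. f m \<oplus>\<^bsub>A\<^esub> h m). t m (f m \<oplus>\<^bsub>A\<^esub> h m)) =
      (\<Oplus>\<^bsub>B\<^esub>m\<in>supp A f. t m (f m)) \<oplus>\<^bsub>B\<^esub> (\<Oplus>\<^bsub>B\<^esub>m\<in>supp A h. t m (h m))"
proof -
  interpret A: ring A by fact
  interpret B: abelian_monoid B by fact
  define F where "F = supp A f \<union> supp A h"
  have F: "finite F" "F \<subseteq> carrier M" "supp A f \<subseteq> F" "supp A h \<subseteq> F"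
    using f h by (auto simp: F_def finsupp_funs_iff)
  have cl: "f m \<in> carrier A" "h m \<in> carrier A" for m
    using f h by (auto simp: finsupp_funs_iff)
  have sub: "supp A (\<lambda>m. f m \<oplus>\<^bsub>A\<^esub> h m) \<subseteq> F"
    by (auto simp: F_def supp_def)
  show fh: "(\<lambda>m. f m \<oplus>\<^bsub>A\<^esub> h m) \<in> finsupp_funs A M"
    using sub F cl by (auto simp: finsupp_funs_iff dest: finite_subset)
  have "(\<Oplus>\<^bsub>B\<^esub>m\<in>supp A (\<lambda>m. f m \<oplus>\<^bsub>A\<^esub> h m). t m (f m \<oplus>\<^bsub>A\<^esub> h m)) =
      (\<Oplus>\<^bsub>B\<^esub>m\<in>F. t m (f m \<oplus>\<^bsub>A\<^esub> h m))"
    by (rule finsum_finsupp_eq[where t = t, OF assms(2) fh F(1) sub F(2) t t0])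
  also have "\<dots> = (\<Oplus>\<^bsub>B\<^esub>m\<in>F. t m (f m) \<oplus>\<^bsub>B\<^esub> t m (h m))"
    by (rule B.finsum_cong') (use F cl t ta in auto)
  also have "\<dots> = (\<Oplus>\<^bsub>B\<^esub>m\<in>F. t m (f m)) \<oplus>\<^bsub>B\<^esub> (\<Oplus>\<^bsub>B\<^esub>m\<in>F. t m (h m))"
    by (rule B.finsum_addf) (use F cl t in auto)
  also have "(\<Oplus>\<^bsub>B\<^esub>m\<in>F. t m (f m)) = (\<Oplus>\<^bsub>B\<^esub>m\<in>supp A f. t m (f m))"
    by (rule finsum_finsupp_eq[where t = t, symmetric, OF assms(2) f F(1) F(3) F(2) t t0])
  also have "(\<Oplus>\<^bsub>B\<^esub>m\<in>F. t m (h m)) = (\<Oplus>\<^bsub>B\<^esub>m\<in>supp A h. t m (h m))"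
    by (rule finsum_finsupp_eq[where t = t, symmetric, OF assms(2) h F(1) F(4) F(2) t t0])
  finally show "(\<Oplus>\<^bsub>B\<^esub>m\<in>supp A (\<lambda>m. f m \<oplus>\<^bsub>A\<^esub> h m). t m (f m \<oplus>\<^bsub>A\<^esub> h m)) =
      (\<Oplus>\<^bsub>B\<^esub>m\<in>supp A f. t m (f m)) \<oplus>\<^bsub>B\<^esub> (\<Oplus>\<^bsub>B\<^esub>m\<in>supp A h. t m (h m))" .
qed

text \<open>The support is empty when \<open>a\<close> is zero; the formula survives because
  \<open>t m\<close> sends zero to zero.\<close>

lemma finsum_single:
  assumes "ring A" and "abelian_monoid B" and m: "m \<in> carrier M" and a: "a \<in> carrier A"
    and t: "\<And>m a. \<lbrakk>m \<in> carrier M; a \<in> carrier A\<rbrakk> \<Longrightarrow> t m a \<in> carrier B"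
    and t0: "\<And>m. m \<in> carrier M \<Longrightarrow> t m \<zero>\<^bsub>A\<^esub> = \<zero>\<^bsub>B\<^esub>"
  shows "single A m a \<in> finsupp_funs A M"
    and "(\<Oplus>\<^bsub>B\<^esub>n\<in>supp A (single A m a). t n (single A m a n)) = t m a"
proof -
  interpret A: ring A by fact
  interpret B: abelian_monoid B by fact
  show *: "single A m a \<in> finsupp_funs A M"
    using m a supp_single[of A m a] by (auto simp: finsupp_funs_iff single_def dest: finite_subset)
  have "(\<Oplus>\<^bsub>B\<^esub>n\<in>supp A (single A m a). t n (single A m a n)) =
      (\<Oplus>\<^bsub>B\<^esub>n\<in>{m}. t n (single A m a n))"
    by (rule finsum_finsupp_eq[where t = t, OF assms(2) * _ supp_single _ t t0]) (use m in auto)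
  also have "\<dots> = t m a"
    using t[OF m a] by (simp add: single_def)
  finally show "(\<Oplus>\<^bsub>B\<^esub>n\<in>supp A (single A m a). t n (single A m a n)) = t m a" .
qed

text \<open>Indices are removed from a finite set around the support rather than from the support
  itself, so a vanishing coefficient needs no case of its own. Every additive identity between
  formal sums is thereby reduced to monomials.\<close>

lemma finsupp_induct [consumes 3, case_names single add]:
  assumes "ring A" and "monoid M" and f: "f \<in> finsupp_funs A M"
    and single: "\<And>m a. \<lbrakk>m \<in> carrier M; a \<in> carrier A\<rbrakk> \<Longrightarrow> P (single A m a)"
    and add: "\<And>f h. \<lbrakk>f \<in> finsupp_funs A M; h \<in> finsupp_funs A M; P f; P h\<rbrakk> \<Longrightarrow>
      P (\<lambda>m. f m \<oplus>\<^bsub>A\<^esub> h m)"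
  shows "P f"
proof -
  interpret A: ring A by fact
  interpret M: monoid M by fact
  have "P f" if "finite F" "supp A f \<subseteq> F" "F \<subseteq> carrier M" "f \<in> finsupp_funs A M" for F f
    using that
  proof (induction F arbitrary: f rule: finite_induct)
    case empty
    \<comment> \<open>The zero function is a monomial with coefficient zero; the unit of
      \<open>M\<close> provides an index in the carrier.\<close>
    then have "f = single A \<one>\<^bsub>M\<^esub> \<zero>\<^bsub>A\<^esub>"
      by (auto simp: supp_def single_def)
    then show ?case using single by simp
  next
    case (insert m F)
    define h where "h = f(m := \<zero>\<^bsub>A\<^esub>)"
    have cl: "f n \<in> carrier A" for n using insert.prems by (auto simp: finsupp_funs_iff)
    have hF: "supp A h \<subseteq> F" using insert.prems by (auto simp: h_def supp_def)
    have h: "h \<in> finsupp_funs A M"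
      using hF insert cl by (auto simp: finsupp_funs_iff h_def dest: finite_subset)
    have m: "m \<in> carrier M" using insert by auto
    have "P (\<lambda>n. single A m (f m) n \<oplus>\<^bsub>A\<^esub> h n)"
    proof (rule add)
      show "single A m (f m) \<in> finsupp_funs A M"
        using m cl supp_single[of A m "f m"]
        by (auto simp: finsupp_funs_iff single_def dest: finite_subset)
      show "P h" using insert.IH[of h] hF h insert.prems by auto
    qed (use h m cl single in auto)
    also have "(\<lambda>n. single A m (f m) n \<oplus>\<^bsub>A\<^esub> h n) = f"
      using cl by (auto simp: single_def h_def)
    finally show ?case .
  qed
  then show ?thesis using f by (auto simp: finsupp_funs_iff)
qed

section \<open>Smash products as associative algebras\<close>

locale crossed = A: kalgebra K A + G: monoid G
  for K :: "('k, 'c) ring_scheme" and A :: "('k, 'a, 'd) module_scheme"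
    and G :: "('g, 'e) monoid_scheme" +
  fixes act :: "'g \<Rightarrow> 'a \<Rightarrow> 'a"
  assumes act_hom: "s \<in> carrier G \<Longrightarrow> act s \<in> alg_hom K A A"
    and act_one: "a \<in> carrier A \<Longrightarrow> act \<one>\<^bsub>G\<^esub> a = a"
    and act_mult: "\<lbrakk>s \<in> carrier G; t \<in> carrier G; a \<in> carrier A\<rbrakk> \<Longrightarrow>
      act (s \<otimes>\<^bsub>G\<^esub> t) a = act s (act t a)"
begin

abbreviation S where "S \<equiv> smash_product A G act"

lemma smash_simps [simp]:
  "carrier S = finsupp_funs A G" "\<one>\<^bsub>S\<^esub> = single A \<one>\<^bsub>G\<^esub> \<one>\<^bsub>A\<^esub>"
  "\<zero>\<^bsub>S\<^esub> = (\<lambda>u. \<zero>\<^bsub>A\<^esub>)" "f \<oplus>\<^bsub>S\<^esub> h = (\<lambda>u. f u \<oplus>\<^bsub>A\<^esub> h u)"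
  "c \<odot>\<^bsub>S\<^esub> f = (\<lambda>u. c \<odot>\<^bsub>A\<^esub> f u)"
  by (simp_all add: smash_product_def)

lemma act_closed [simp]: "\<lbrakk>s \<in> carrier G; a \<in> carrier A\<rbrakk> \<Longrightarrow> act s a \<in> carrier A"
  by (rule alg_hom_closed[OF act_hom])

lemma act_zero [simp]: "s \<in> carrier G \<Longrightarrow> act s \<zero>\<^bsub>A\<^esub> = \<zero>\<^bsub>A\<^esub>"
  by (rule alg_hom_zero[OF A.kalgebra_axioms A.kalgebra_axioms act_hom])

lemma finsupp_closed:
  "f \<in> finsupp_funs A G \<Longrightarrow> f u \<in> carrier A"
  "\<lbrakk>f \<in> finsupp_funs A G; h \<in> finsupp_funs A G\<rbrakk> \<Longrightarrow> (\<lambda>u. f u \<oplus>\<^bsub>A\<^esub> h u) \<in> finsupp_funs A G"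
  "\<lbrakk>f \<in> finsupp_funs A G; c \<in> carrier K\<rbrakk> \<Longrightarrow> (\<lambda>u. c \<odot>\<^bsub>A\<^esub> f u) \<in> finsupp_funs A G"
  "f \<in> finsupp_funs A G \<Longrightarrow> (\<lambda>u. \<ominus>\<^bsub>A\<^esub> f u) \<in> finsupp_funs A G"
  "(\<lambda>u. \<zero>\<^bsub>A\<^esub>) \<in> finsupp_funs A G"
  "\<lbrakk>s \<in> carrier G; a \<in> carrier A\<rbrakk> \<Longrightarrow> single A s a \<in> finsupp_funs A G"
proof -
  show "f u \<in> carrier A" if "f \<in> finsupp_funs A G" for f u
    using that by (simp add: finsupp_funs_iff)
  have mono: "h \<in> finsupp_funs A G"
    if "f \<in> finsupp_funs A G" "f' \<in> finsupp_funs A G" "\<And>u. h u \<in> carrier A"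
      "supp A h \<subseteq> supp A f \<union> supp A f'" for f f' h
    using that finite_subset[OF that(4)] by (auto simp: finsupp_funs_iff)
  show "(\<lambda>u. f u \<oplus>\<^bsub>A\<^esub> h u) \<in> finsupp_funs A G"
    if "f \<in> finsupp_funs A G" "h \<in> finsupp_funs A G" for f h
    by (rule mono[OF that]) (use that in \<open>auto simp: finsupp_funs_iff supp_def\<close>)
  show "(\<lambda>u. c \<odot>\<^bsub>A\<^esub> f u) \<in> finsupp_funs A G" if "f \<in> finsupp_funs A G" "c \<in> carrier K" for f c
    by (rule mono[OF that(1) that(1)]) (use that in \<open>auto simp: finsupp_funs_iff supp_def\<close>)
  show "(\<lambda>u. \<ominus>\<^bsub>A\<^esub> f u) \<in> finsupp_funs A G" if "f \<in> finsupp_funs A G" for f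
    by (rule mono[OF that that]) (use that in \<open>auto simp: finsupp_funs_iff supp_def\<close>)
  show "(\<lambda>u. \<zero>\<^bsub>A\<^esub>) \<in> finsupp_funs A G"
    by (simp add: finsupp_funs_iff supp_def)
  show "single A s a \<in> finsupp_funs A G" if "s \<in> carrier G" "a \<in> carrier A" for s a
    using that supp_single[of A s a]
    by (auto simp: finsupp_funs_iff single_def dest: finite_subset)
qed

lemma smash_abelian_group: "abelian_group S"
proof (rule abelian_groupI)
  fix f assume f: "f \<in> carrier S"
  show "\<exists>h\<in>carrier S. h \<oplus>\<^bsub>S\<^esub> f = \<zero>\<^bsub>S\<^esub>"
    by (rule bexI[of _ "\<lambda>u. \<ominus>\<^bsub>A\<^esub> f u"])
      (use f in \<open>auto simp: finsupp_closed A.A.l_neg\<close>)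
qed (auto simp: finsupp_closed A.A.a_ac)

lemma mult_eq:
  assumes f: "f \<in> finsupp_funs A G" and h: "h \<in> finsupp_funs A G"
    and F: "finite F" "supp A f \<subseteq> F" "F \<subseteq> carrier G"
    and E: "finite E" "supp A h \<subseteq> E" "E \<subseteq> carrier G"
  shows "(f \<otimes>\<^bsub>S\<^esub> h) u = (\<Oplus>\<^bsub>A\<^esub>p\<in>F \<times> E.
    if fst p \<otimes>\<^bsub>G\<^esub> snd p = u then f (fst p) \<otimes>\<^bsub>A\<^esub> act (fst p) (h (snd p)) else \<zero>\<^bsub>A\<^esub>)"
  unfolding smash_product_def monoid.simps
proof (rule A.A.add.finprod_mono_neutral_cong_left)
  show "{(s, t). (s, t) \<in> supp A f \<times> supp A h \<and> s \<otimes>\<^bsub>G\<^esub> t = u} \<subseteq> F \<times> E"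
    using F E by auto
qed (use F E f h in \<open>auto simp: supp_def finsupp_funs_iff subset_iff\<close>)

lemma mult_closed:
  assumes f: "f \<in> finsupp_funs A G" and h: "h \<in> finsupp_funs A G"
  shows "f \<otimes>\<^bsub>S\<^esub> h \<in> finsupp_funs A G"
proof -
  have fh: "finite (supp A f)" "finite (supp A h)" "supp A f \<subseteq> carrier G" "supp A h \<subseteq> carrier G"
    using f h by (auto simp: finsupp_funs_iff)
  note eq = mult_eq[OF f h fh(1) subset_refl fh(3) fh(2) subset_refl fh(4)]
  have "(f \<otimes>\<^bsub>S\<^esub> h) u = \<zero>\<^bsub>A\<^esub>" if "u \<notin> (\<lambda>(s, t). s \<otimes>\<^bsub>G\<^esub> t) ` (supp A f \<times> supp A h)" for u
    unfolding eq by (rule A.A.add.finprod_one_eqI) (use that in auto)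
  then have sub: "supp A (f \<otimes>\<^bsub>S\<^esub> h) \<subseteq> (\<lambda>(s, t). s \<otimes>\<^bsub>G\<^esub> t) ` (supp A f \<times> supp A h)"
    by (auto simp: supp_def)
  have "(f \<otimes>\<^bsub>S\<^esub> h) u \<in> carrier A" for u
    unfolding eq by (rule A.A.finsum_closed) (use f h fh in \<open>auto simp: finsupp_funs_iff subset_iff\<close>)
  moreover have "finite (supp A (f \<otimes>\<^bsub>S\<^esub> h))"
    by (rule finite_subset[OF sub]) (use fh in simp)
  ultimately show ?thesis
    using fh sub by (fastforce simp: finsupp_funs_iff)
qed

lemma mult_add_left:
  assumes f: "f \<in> finsupp_funs A G" and g: "g \<in> finsupp_funs A G" and h: "h \<in> finsupp_funs A G"
  shows "(\<lambda>u. f u \<oplus>\<^bsub>A\<^esub> g u) \<otimes>\<^bsub>S\<^esub> h = (\<lambda>u. (f \<otimes>\<^bsub>S\<^esub> h) u \<oplus>\<^bsub>A\<^esub> (g \<otimes>\<^bsub>S\<^esub> h) u)"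
proof
  fix u
  define F where "F = supp A f \<union> supp A g"
  have F: "finite F" "F \<subseteq> carrier G" "supp A f \<subseteq> F" "supp A g \<subseteq> F"
    "supp A (\<lambda>u. f u \<oplus>\<^bsub>A\<^esub> g u) \<subseteq> F"
    using f g by (auto simp: F_def finsupp_funs_iff) (auto simp: supp_def)
  have E: "finite (supp A h)" "supp A h \<subseteq> carrier G" using h by (auto simp: finsupp_funs_iff)
  note eq = mult_eq[OF _ h F(1) _ F(2) E(1) subset_refl E(2)]
  have cl: "f s \<in> carrier A" "g s \<in> carrier A" "h s \<in> carrier A" for s
    using f g h by (auto simp: finsupp_funs_iff)
  show "((\<lambda>u. f u \<oplus>\<^bsub>A\<^esub> g u) \<otimes>\<^bsub>S\<^esub> h) u = (f \<otimes>\<^bsub>S\<^esub> h) u \<oplus>\<^bsub>A\<^esub> (g \<otimes>\<^bsub>S\<^esub> h) u"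
    unfolding eq[OF f F(3)] eq[OF g F(4)] eq[OF finsupp_closed(2)[OF f g] F(5)]
    by (subst A.A.finsum_addf[symmetric])
      (use F E cl in \<open>auto simp: A.A.l_distr subset_iff intro!: A.A.finsum_cong'\<close>)
qed

lemma mult_add_right:
  assumes f: "f \<in> finsupp_funs A G" and g: "g \<in> finsupp_funs A G" and h: "h \<in> finsupp_funs A G"
  shows "h \<otimes>\<^bsub>S\<^esub> (\<lambda>u. f u \<oplus>\<^bsub>A\<^esub> g u) = (\<lambda>u. (h \<otimes>\<^bsub>S\<^esub> f) u \<oplus>\<^bsub>A\<^esub> (h \<otimes>\<^bsub>S\<^esub> g) u)"
proof
  fix u
  define F where "F = supp A f \<union> supp A g"
  have F: "finite F" "F \<subseteq> carrier G" "supp A f \<subseteq> F" "supp A g \<subseteq> F"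
    "supp A (\<lambda>u. f u \<oplus>\<^bsub>A\<^esub> g u) \<subseteq> F"
    using f g by (auto simp: F_def finsupp_funs_iff) (auto simp: supp_def)
  have E: "finite (supp A h)" "supp A h \<subseteq> carrier G" using h by (auto simp: finsupp_funs_iff)
  note eq = mult_eq[OF h _ E(1) subset_refl E(2) F(1) _ F(2)]
  have cl: "f s \<in> carrier A" "g s \<in> carrier A" "h s \<in> carrier A" for s
    using f g h by (auto simp: finsupp_funs_iff)
  show "(h \<otimes>\<^bsub>S\<^esub> (\<lambda>u. f u \<oplus>\<^bsub>A\<^esub> g u)) u = (h \<otimes>\<^bsub>S\<^esub> f) u \<oplus>\<^bsub>A\<^esub> (h \<otimes>\<^bsub>S\<^esub> g) u"
    unfolding eq[OF f F(3)] eq[OF g F(4)] eq[OF finsupp_closed(2)[OF f g] F(5)]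
    by (subst A.A.finsum_addf[symmetric])
      (use F E cl in \<open>auto simp: A.A.r_distr alg_hom_add[OF act_hom] subset_iff
        intro!: A.A.finsum_cong'\<close>)
qed

lemma mult_single:
  assumes s: "s \<in> carrier G" and t: "t \<in> carrier G" and a: "a \<in> carrier A" and b: "b \<in> carrier A"
  shows "single A s a \<otimes>\<^bsub>S\<^esub> single A t b = single A (s \<otimes>\<^bsub>G\<^esub> t) (a \<otimes>\<^bsub>A\<^esub> act s b)"
proof
  fix u
  have "(single A s a \<otimes>\<^bsub>S\<^esub> single A t b) u = (\<Oplus>\<^bsub>A\<^esub>p\<in>{s} \<times> {t}.
    if fst p \<otimes>\<^bsub>G\<^esub> snd p = u then single A s a (fst p) \<otimes>\<^bsub>A\<^esub> act (fst p) (single A t b (snd p))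
    else \<zero>\<^bsub>A\<^esub>)"
    by (rule mult_eq) (use assms in \<open>auto simp: finsupp_closed supp_single[THEN subsetD]
        dest: supp_single[THEN subsetD]\<close>)
  also have "\<dots> = single A (s \<otimes>\<^bsub>G\<^esub> t) (a \<otimes>\<^bsub>A\<^esub> act s b) u"
    using assms by (simp add: single_def)
  finally show "(single A s a \<otimes>\<^bsub>S\<^esub> single A t b) u = single A (s \<otimes>\<^bsub>G\<^esub> t) (a \<otimes>\<^bsub>A\<^esub> act s b) u" .
qed

lemma smash_single_induct [consumes 1, case_names single add]:
  assumes "f \<in> finsupp_funs A G"
    and "\<And>m a. \<lbrakk>m \<in> carrier G; a \<in> carrier A\<rbrakk> \<Longrightarrow> P (single A m a)"
    and "\<And>f h. \<lbrakk>f \<in> finsupp_funs A G; h \<in> finsupp_funs A G; P f; P h\<rbrakk> \<Longrightarrow>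
      P (\<lambda>m. f m \<oplus>\<^bsub>A\<^esub> h m)"
  shows "P f"
  using A.A.ring_axioms G.monoid_axioms assms by (rule finsupp_induct)

text \<open>By additivity in each argument only monomials matter. For (a s)(b t)(c r) both
  bracketings have the coefficient a (s.b) (st.c), because each s acts multiplicatively on A and the
  action respects products in G.\<close>

lemma mult_assoc:
  assumes f: "f \<in> finsupp_funs A G" and g: "g \<in> finsupp_funs A G" and h: "h \<in> finsupp_funs A G"
  shows "(f \<otimes>\<^bsub>S\<^esub> g) \<otimes>\<^bsub>S\<^esub> h = f \<otimes>\<^bsub>S\<^esub> (g \<otimes>\<^bsub>S\<^esub> h)"
  using f
proof (induction rule: smash_single_induct)
  case (single s a)
  note s = single
  show ?case using g
  proof (induction rule: smash_single_induct)
    case (single t b)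
    note t = single
    show ?case using h
    proof (induction rule: smash_single_induct)
      case (single r c)
      then show ?case using s t
        by (simp add: mult_single G.m_assoc A.A.m_assoc alg_hom_mult[OF act_hom] act_mult)
    next
      case (add h h')
      then show ?case using s t
        by (simp add: mult_add_right mult_closed finsupp_closed)
    qed
  next
    case (add g g')
    then show ?case using s h
      by (simp add: mult_add_right mult_add_left mult_closed finsupp_closed)
  qed
next
  case (add f f')
  then show ?case using g h
    by (simp add: mult_add_left mult_closed finsupp_closed)
qed

lemma mult_one:
  assumes "f \<in> finsupp_funs A G"
  shows "single A \<one>\<^bsub>G\<^esub> \<one>\<^bsub>A\<^esub> \<otimes>\<^bsub>S\<^esub> f = f" "f \<otimes>\<^bsub>S\<^esub> single A \<one>\<^bsub>G\<^esub> \<one>\<^bsub>A\<^esub> = f"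
  using assms
  by (induction rule: smash_single_induct)
    (simp_all add: mult_single act_one alg_hom_one[OF act_hom] mult_add_left mult_add_right
      finsupp_closed)

lemma smult_single:
  assumes "c \<in> carrier K" "a \<in> carrier A" "s \<in> carrier G"
  shows "(\<lambda>u. c \<odot>\<^bsub>A\<^esub> single A s a u) = single A s (c \<odot>\<^bsub>A\<^esub> a)"
  using assms by (auto simp: single_def fun_eq_iff)

lemma add_single:
  assumes "a \<in> carrier A" "b \<in> carrier A"
  shows "(\<lambda>u. single A s a u \<oplus>\<^bsub>A\<^esub> single A s b u) = single A s (a \<oplus>\<^bsub>A\<^esub> b)"
  using assms by (auto simp: single_def)

lemma smult_add:
  assumes "c \<in> carrier K" "f \<in> finsupp_funs A G" "g \<in> finsupp_funs A G"
  shows "(\<lambda>u. c \<odot>\<^bsub>A\<^esub> (f u \<oplus>\<^bsub>A\<^esub> g u)) = (\<lambda>u. c \<odot>\<^bsub>A\<^esub> f u \<oplus>\<^bsub>A\<^esub> c \<odot>\<^bsub>A\<^esub> g u)"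
  using assms by (simp add: A.smult_r_distr finsupp_closed)

lemma mult_smult_left:
  assumes c: "c \<in> carrier K" and f: "f \<in> finsupp_funs A G" and h: "h \<in> finsupp_funs A G"
  shows "(\<lambda>u. c \<odot>\<^bsub>A\<^esub> f u) \<otimes>\<^bsub>S\<^esub> h = (\<lambda>u. c \<odot>\<^bsub>A\<^esub> (f \<otimes>\<^bsub>S\<^esub> h) u)"
  using f
proof (induction rule: smash_single_induct)
  case (single s a)
  note s = single
  show ?case using h
  proof (induction rule: smash_single_induct)
    case (single t b)
    then show ?case using s c by (simp add: smult_single mult_single A.smult_mult_left)
  next
    case (add h h')
    then show ?case using s c
      by (simp add: mult_add_right smult_add mult_closed finsupp_closed)
  qed
next
  case (add f f')
  then show ?case using h c by (simp add: mult_add_left smult_add mult_closed finsupp_closed)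
qed

lemma mult_smult_right:
  assumes c: "c \<in> carrier K" and f: "f \<in> finsupp_funs A G" and h: "h \<in> finsupp_funs A G"
  shows "f \<otimes>\<^bsub>S\<^esub> (\<lambda>u. c \<odot>\<^bsub>A\<^esub> h u) = (\<lambda>u. c \<odot>\<^bsub>A\<^esub> (f \<otimes>\<^bsub>S\<^esub> h) u)"
  using f
proof (induction rule: smash_single_induct)
  case (single s a)
  note s = single
  show ?case using h
  proof (induction rule: smash_single_induct)
    case (single t b)
    then show ?case using s c
      by (simp add: smult_single mult_single A.smult_mult_right alg_hom_smult[OF act_hom])
  next
    case (add h h')
    then show ?case using s c
      by (simp add: mult_add_right smult_add mult_closed finsupp_closed)
  qed
next
  case (add f f')
  then show ?case using h c by (simp add: mult_add_left smult_add mult_closed finsupp_closed)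
qed

lemma smash_kalgebra: "kalgebra K S"
proof (intro kalgebra.intro kalgebra_axioms.intro ringI smash_abelian_group monoidI)
  show "cring K" ..
qed (auto simp: finsupp_closed mult_closed mult_assoc mult_one mult_add_left mult_add_right
    mult_smult_left mult_smult_right smult_add A.smult_l_distr A.smult_assoc)

sublocale S: kalgebra K S
  by (rule smash_kalgebra)

end

section \<open>The universal property of smash products\<close>

definition smash_lift ::
    "('a, 'c) ring_scheme \<Rightarrow> ('b, 'd) ring_scheme \<Rightarrow> ('a \<Rightarrow> 'b) \<Rightarrow> ('m \<Rightarrow> 'b) \<Rightarrow> ('m \<Rightarrow> 'a) \<Rightarrow> 'b"
  where "smash_lift A B \<alpha> \<phi> f = (\<Oplus>\<^bsub>B\<^esub>s\<in>supp A f. \<alpha> (f s) \<otimes>\<^bsub>B\<^esub> \<phi> s)"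

text \<open>A covariant pair: \<open>\<phi>_\<alpha>\<close> is the rule s a = (s.a) s of the smash
  product, read in B. Such a pair extends to a homomorphism by a s \<mapsto> \<alpha>(a)
  \<phi>(s).\<close>

locale crossed_lift = crossed K A G act + B: kalgebra K B
  for K :: "('k, 'c) ring_scheme" and A :: "('k, 'a, 'd) module_scheme"
    and G :: "('g, 'e) monoid_scheme" and act and B :: "('k, 'b, 'f) module_scheme" +
  fixes \<alpha> :: "'a \<Rightarrow> 'b" and \<phi> :: "'g \<Rightarrow> 'b"
  assumes \<alpha>: "\<alpha> \<in> alg_hom K A B"
    and \<phi>_closed [simp]: "s \<in> carrier G \<Longrightarrow> \<phi> s \<in> carrier B"
    and \<phi>_one: "\<phi> \<one>\<^bsub>G\<^esub> = \<one>\<^bsub>B\<^esub>"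
    and \<phi>_mult: "\<lbrakk>s \<in> carrier G; t \<in> carrier G\<rbrakk> \<Longrightarrow> \<phi> (s \<otimes>\<^bsub>G\<^esub> t) = \<phi> s \<otimes>\<^bsub>B\<^esub> \<phi> t"
    and \<phi>_\<alpha>: "\<lbrakk>s \<in> carrier G; a \<in> carrier A\<rbrakk> \<Longrightarrow> \<phi> s \<otimes>\<^bsub>B\<^esub> \<alpha> a = \<alpha> (act s a) \<otimes>\<^bsub>B\<^esub> \<phi> s"
begin

lemma \<alpha>_closed [simp]: "a \<in> carrier A \<Longrightarrow> \<alpha> a \<in> carrier B"
  by (rule alg_hom_closed[OF \<alpha>])

lemma \<alpha>_zero [simp]: "\<alpha> \<zero>\<^bsub>A\<^esub> = \<zero>\<^bsub>B\<^esub>"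
  by (rule alg_hom_zero[OF A.kalgebra_axioms B.kalgebra_axioms \<alpha>])

lemma smash_lift_single:
  assumes "s \<in> carrier G" "a \<in> carrier A"
  shows "smash_lift A B \<alpha> \<phi> (single A s a) = \<alpha> a \<otimes>\<^bsub>B\<^esub> \<phi> s"
  unfolding smash_lift_def
  by (rule finsum_single(2)[where t = "\<lambda>s a. \<alpha> a \<otimes>\<^bsub>B\<^esub> \<phi> s",
        OF A.A.ring_axioms B.A.abelian_monoid_axioms assms]) auto

lemma smash_lift_add:
  assumes "f \<in> finsupp_funs A G" "h \<in> finsupp_funs A G"
  shows "smash_lift A B \<alpha> \<phi> (\<lambda>u. f u \<oplus>\<^bsub>A\<^esub> h u) = smash_lift A B \<alpha> \<phi> f \<oplus>\<^bsub>B\<^esub> smash_lift A B \<alpha> \<phi> h"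
  unfolding smash_lift_def
  by (rule finsum_finsupp_add(2)[where t = "\<lambda>s a. \<alpha> a \<otimes>\<^bsub>B\<^esub> \<phi> s",
        OF A.A.ring_axioms B.A.abelian_monoid_axioms assms])
    (auto simp: alg_hom_add[OF \<alpha>] B.A.l_distr)

lemma smash_lift_closed:
  assumes "f \<in> finsupp_funs A G"
  shows "smash_lift A B \<alpha> \<phi> f \<in> carrier B"
  using assms by (induction rule: smash_single_induct) (auto simp: smash_lift_single smash_lift_add)

lemma smash_lift_mult:
  assumes f: "f \<in> finsupp_funs A G" and h: "h \<in> finsupp_funs A G"
  shows "smash_lift A B \<alpha> \<phi> (f \<otimes>\<^bsub>S\<^esub> h) = smash_lift A B \<alpha> \<phi> f \<otimes>\<^bsub>B\<^esub> smash_lift A B \<alpha> \<phi> h"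
  using f
proof (induction rule: smash_single_induct)
  case (single s a)
  note s = single
  show ?case using h
  proof (induction rule: smash_single_induct)
    case (single t b)
    have "\<alpha> (a \<otimes>\<^bsub>A\<^esub> act s b) \<otimes>\<^bsub>B\<^esub> \<phi> (s \<otimes>\<^bsub>G\<^esub> t) = \<alpha> a \<otimes>\<^bsub>B\<^esub> (\<alpha> (act s b) \<otimes>\<^bsub>B\<^esub> \<phi> s) \<otimes>\<^bsub>B\<^esub> \<phi> t"
      using s single by (simp add: alg_hom_mult[OF \<alpha>] \<phi>_mult B.A.m_assoc)
    \<comment> \<open>Covariance turns the inner \<alpha>(s.b) \<phi>(s) into \<phi>(s) \<alpha>(b),
      which separates the factors of the two monomials.\<close>
    also have "\<dots> = \<alpha> a \<otimes>\<^bsub>B\<^esub> \<phi> s \<otimes>\<^bsub>B\<^esub> (\<alpha> b \<otimes>\<^bsub>B\<^esub> \<phi> t)"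
      using s single by (simp add: \<phi>_\<alpha>[symmetric] B.A.m_assoc)
    finally show ?case using s single by (simp add: mult_single smash_lift_single)
  next
    case (add h h')
    then show ?case using s
      by (simp add: mult_add_right smash_lift_add mult_closed finsupp_closed smash_lift_closed
          B.A.r_distr)
  qed
next
  case (add f f')
  then show ?case using h
    by (simp add: mult_add_left smash_lift_add mult_closed finsupp_closed smash_lift_closed
        B.A.l_distr)
qed

lemma smash_lift_smult:
  assumes c: "c \<in> carrier K" and f: "f \<in> finsupp_funs A G"
  shows "smash_lift A B \<alpha> \<phi> (\<lambda>u. c \<odot>\<^bsub>A\<^esub> f u) = c \<odot>\<^bsub>B\<^esub> smash_lift A B \<alpha> \<phi> f"
  using f
proof (induction rule: smash_single_induct)
  case (single s a)
  then show ?case using c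
    by (simp add: smult_single smash_lift_single alg_hom_smult[OF \<alpha>] B.smult_mult_left)
next
  case (add f f')
  then show ?case using c
    by (simp add: smult_add smash_lift_add finsupp_closed smash_lift_closed B.smult_r_distr)
qed

lemma smash_lift_hom: "smash_lift A B \<alpha> \<phi> \<in> alg_hom K S B"
  by (rule alg_homI)
    (auto simp: smash_lift_closed smash_lift_add smash_lift_mult smash_lift_smult smash_lift_single
      alg_hom_one[OF \<alpha>] \<phi>_one)

end

context crossed
begin

text \<open>The monomial a s is the product of a, placed at the identity of G, with 1 placed at s.
  The first factor depends homomorphically on a, so generators of A and the elements of G
  suffice.\<close>

lemma smash_span:
  assumes "carrier A \<subseteq> alg_span K A U" and "U \<subseteq> carrier A"
    and G: "\<And>s. s \<in> carrier G \<Longrightarrow> single A s \<one>\<^bsub>A\<^esub> \<in> alg_span K S V"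
    and U: "\<And>a. a \<in> U \<Longrightarrow> single A \<one>\<^bsub>G\<^esub> a \<in> alg_span K S V"
  shows "carrier S \<subseteq> alg_span K S V"
proof
  have emb: "(\<lambda>a. single A \<one>\<^bsub>G\<^esub> a) \<in> alg_hom K A S"
    by (rule alg_homI) (auto simp: finsupp_closed mult_single act_one smult_single add_single)
  fix f assume "f \<in> carrier S"
  then have "f \<in> finsupp_funs A G" by simp
  then show "f \<in> alg_span K S V"
  proof (induction rule: smash_single_induct)
    case (single s a)
    have "single A \<one>\<^bsub>G\<^esub> a \<in> alg_span K S V"
      by (rule alg_hom_span[OF A.kalgebra_axioms emb assms(1,2)]) (use U single in auto)
    then have "single A \<one>\<^bsub>G\<^esub> a \<otimes>\<^bsub>S\<^esub> single A s \<one>\<^bsub>A\<^esub> \<in> alg_span K S V"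
      using G single by (auto intro: span_mult)
    then show ?case using single by (simp add: mult_single alg_hom_one[OF act_hom])
  next
    case (add f h)
    then show ?case using span_add[of f K S V h] by simp
  qed
qed

end

lemma monoid_algebra_eq_smash:
  "monoid_algebra K M = smash_product (scalar_algebra K) M (\<lambda>_ c. c)"
  by (simp add: monoid_algebra_def smash_product_def)

lemma crossed_scalar:
  assumes "cring K" and "monoid M"
  shows "crossed K (scalar_algebra K) M (\<lambda>_ c. c)"
proof -
  interpret kalgebra K "scalar_algebra K" by (rule scalar_algebra) fact
  show ?thesis
    using assms(2) kalgebra_axioms
    by (intro crossed.intro crossed_axioms.intro) (auto simp: alg_hom_id)
qed

section \<open>Monoid algebras, free algebras and polynomials\<close>

lemma monoid_algebra_simps [simp]:
  "carrier (monoid_algebra K M) = finsupp_funs K M"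
  "\<one>\<^bsub>monoid_algebra K M\<^esub> = single K \<one>\<^bsub>M\<^esub> \<one>\<^bsub>K\<^esub>"
  "\<zero>\<^bsub>monoid_algebra K M\<^esub> = (\<lambda>u. \<zero>\<^bsub>K\<^esub>)"
  "f \<oplus>\<^bsub>monoid_algebra K M\<^esub> h = (\<lambda>u. f u \<oplus>\<^bsub>K\<^esub> h u)"
  "c \<odot>\<^bsub>monoid_algebra K M\<^esub> f = (\<lambda>u. c \<otimes>\<^bsub>K\<^esub> f u)"
  by (simp_all add: monoid_algebra_def)

locale monoid_alg = K: cring K + M: monoid M
  for K :: "('k, 'c) ring_scheme" and M :: "('m, 'd) monoid_scheme"
begin

sublocale sc: crossed K "scalar_algebra K" M "\<lambda>_ c. c"
  by (rule crossed_scalar) (rule K.is_cring, rule M.monoid_axioms)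

lemma single_closed: "\<lbrakk>s \<in> carrier M; a \<in> carrier K\<rbrakk> \<Longrightarrow> single K s a \<in> finsupp_funs K M"
  using sc.finsupp_closed(6) by simp

lemma monoid_algebra_mult_single:
  "\<lbrakk>s \<in> carrier M; t \<in> carrier M; a \<in> carrier K; b \<in> carrier K\<rbrakk> \<Longrightarrow>
    single K s a \<otimes>\<^bsub>monoid_algebra K M\<^esub> single K t b = single K (s \<otimes>\<^bsub>M\<^esub> t) (a \<otimes>\<^bsub>K\<^esub> b)"
  using sc.mult_single by (simp add: monoid_algebra_eq_smash)

lemma smult_single_one:
  assumes "c \<in> carrier K"
  shows "c \<odot>\<^bsub>monoid_algebra K M\<^esub> single K s \<one>\<^bsub>K\<^esub> = single K s c"
  using assms by (auto simp: single_def)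

lemma monoid_algebra_kalgebra: "kalgebra K (monoid_algebra K M)"
  using sc.smash_kalgebra by (simp add: monoid_algebra_eq_smash)

lemma single_pow:
  fixes n :: nat
  assumes "s \<in> carrier M"
  shows "single K s \<one>\<^bsub>K\<^esub> [^]\<^bsub>monoid_algebra K M\<^esub> n = single K (s [^]\<^bsub>M\<^esub> n) \<one>\<^bsub>K\<^esub>"
proof -
  interpret S: kalgebra K "monoid_algebra K M" by (rule monoid_algebra_kalgebra)
  show ?thesis
    using assms by (induction n) (simp_all add: monoid_algebra_mult_single)
qed

lemma monoid_algebra_span:
  assumes "\<And>s. s \<in> carrier M \<Longrightarrow> single K s \<one>\<^bsub>K\<^esub> \<in> alg_span K (monoid_algebra K M) V"
  shows "carrier (monoid_algebra K M) \<subseteq> alg_span K (monoid_algebra K M) V"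
proof
  fix f assume "f \<in> carrier (monoid_algebra K M)"
  then have "f \<in> finsupp_funs (scalar_algebra K) M" by simp
  then show "f \<in> alg_span K (monoid_algebra K M) V"
  proof (induction rule: sc.smash_single_induct)
    case (single s a)
    then have "a \<odot>\<^bsub>monoid_algebra K M\<^esub> single K s \<one>\<^bsub>K\<^esub> \<in> alg_span K (monoid_algebra K M) V"
      using assms by (intro span_smult) auto
    moreover have "a \<odot>\<^bsub>monoid_algebra K M\<^esub> single K s \<one>\<^bsub>K\<^esub> = single (scalar_algebra K) s a"
      using single by (simp only: smult_single_one scalar_algebra_simps)
    ultimately show ?case by simp
  next
    case (add f h)
    then show ?case using span_add[of f K "monoid_algebra K M" V h] by simp
  qed
qed

text \<open>Both products are biadditive, which leaves monomials, where commutativity of K and of M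
  decides.\<close>

lemma monoid_algebra_comm:
  assumes "comm_monoid M"
  shows "cring (monoid_algebra K M)"
proof -
  interpret M: comm_monoid M by fact
  interpret S: kalgebra K "monoid_algebra K M" by (rule monoid_algebra_kalgebra)
  have "f \<otimes>\<^bsub>monoid_algebra K M\<^esub> h = h \<otimes>\<^bsub>monoid_algebra K M\<^esub> f"
    if f: "f \<in> finsupp_funs K M" and h: "h \<in> finsupp_funs K M" for f h
    using K.ring_axioms M.monoid_axioms f
  proof (induction rule: finsupp_induct)
    case (single s a)
    note s = single
    show ?case using K.ring_axioms M.monoid_axioms h
    proof (induction rule: finsupp_induct)
      case (single t b)
      then show ?case using s by (simp add: monoid_algebra_mult_single M.m_comm K.m_comm)
    next
      case (add h h')
      then show ?case
        using s S.A.l_distr[of h h' "single K s a"] S.A.r_distr[of h h' "single K s a"]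
        by (simp add: single_closed)
    qed
  next
    case (add f f')
    then show ?case using h S.A.l_distr[of f f' h] S.A.r_distr[of f f' h] by simp
  qed
  then show ?thesis
    by (intro cring.intro S.A.ring_axioms comm_monoid.intro comm_monoid_axioms.intro
        S.A.monoid_axioms) auto
qed

end

definition monoid_lift ::
    "('k, 'c) ring_scheme \<Rightarrow> ('k, 'b, 'd) module_scheme \<Rightarrow> ('m \<Rightarrow> 'b) \<Rightarrow> ('m \<Rightarrow> 'k) \<Rightarrow> 'b"
  where "monoid_lift K B = smash_lift K B (\<lambda>c. c \<odot>\<^bsub>B\<^esub> \<one>\<^bsub>B\<^esub>)"

locale monoid_alg_lift = monoid_alg K M + B: kalgebra K B
  for K :: "('k, 'c) ring_scheme" and M :: "('m, 'd) monoid_scheme"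
    and B :: "('k, 'b, 'f) module_scheme" +
  fixes \<phi> :: "'m \<Rightarrow> 'b"
  assumes \<phi>_closed: "s \<in> carrier M \<Longrightarrow> \<phi> s \<in> carrier B"
    and \<phi>_one: "\<phi> \<one>\<^bsub>M\<^esub> = \<one>\<^bsub>B\<^esub>"
    and \<phi>_mult: "\<lbrakk>s \<in> carrier M; t \<in> carrier M\<rbrakk> \<Longrightarrow> \<phi> (s \<otimes>\<^bsub>M\<^esub> t) = \<phi> s \<otimes>\<^bsub>B\<^esub> \<phi> t"
begin

text \<open>With trivial action, covariance only asks that scalars commute with the values of
  \<phi>, and scalars are central in every algebra.\<close>

sublocale cl: crossed_lift K "scalar_algebra K" M "\<lambda>_ c. c" B "\<lambda>c. c \<odot>\<^bsub>B\<^esub> \<one>\<^bsub>B\<^esub>" \<phi>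
  by unfold_locales (auto simp: scalar_hom B.kalgebra_axioms \<phi>_closed \<phi>_one \<phi>_mult B.scalar_mult)

lemma monoid_lift_eq:
  "monoid_lift K B \<phi> = smash_lift (scalar_algebra K) B (\<lambda>c. c \<odot>\<^bsub>B\<^esub> \<one>\<^bsub>B\<^esub>) \<phi>"
  by (simp add: monoid_lift_def smash_lift_def fun_eq_iff)

lemma monoid_lift_hom: "monoid_lift K B \<phi> \<in> alg_hom K (monoid_algebra K M) B"
  using cl.smash_lift_hom by (simp add: monoid_lift_eq monoid_algebra_eq_smash)

lemma monoid_lift_single:
  "\<lbrakk>s \<in> carrier M; c \<in> carrier K\<rbrakk> \<Longrightarrow> monoid_lift K B \<phi> (single K s c) = c \<odot>\<^bsub>B\<^esub> \<phi> s"
  using cl.smash_lift_single by (simp add: monoid_lift_eq B.scalar_mult \<phi>_closed)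

lemma monoid_lift_finsum:
  assumes "f \<in> finsupp_funs K M"
  shows "monoid_lift K B \<phi> f = (\<Oplus>\<^bsub>B\<^esub>s\<in>supp K f. f s \<odot>\<^bsub>B\<^esub> \<phi> s)"
  unfolding monoid_lift_def smash_lift_def
  by (rule B.A.finsum_cong') (use assms in \<open>auto simp: finsupp_funs_iff B.scalar_mult \<phi>_closed\<close>)

end

section \<open>The free algebra on two letters\<close>

lemma free_monoid_simps [simp]:
  "carrier free_monoid = UNIV" "v \<otimes>\<^bsub>free_monoid\<^esub> w = v @ w" "\<one>\<^bsub>free_monoid\<^esub> = []"
  by (simp_all add: free_monoid_def)

text \<open>Written with the same \<open>foldr\<close> as in \<open>substitution\<close>, so that
  the two match by unfolding.\<close>

definition word_prod :: "('b, 'd) monoid_scheme \<Rightarrow> (letter \<Rightarrow> 'b) \<Rightarrow> letter list \<Rightarrow> 'b"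
  where "word_prod B \<sigma> w = foldr (\<lambda>l q. \<sigma> l \<otimes>\<^bsub>B\<^esub> q) w \<one>\<^bsub>B\<^esub>"

definition free_lift ::
    "('k, 'c) ring_scheme \<Rightarrow> ('k, 'b, 'd) module_scheme \<Rightarrow> (letter \<Rightarrow> 'b) \<Rightarrow> (letter list \<Rightarrow> 'k) \<Rightarrow> 'b"
  where "free_lift K B \<sigma> = monoid_lift K B (word_prod B \<sigma>)"

lemma free_monoid_alg:
  assumes "cring K"
  shows "monoid_alg K free_monoid"
  using assms by (auto intro!: monoid_alg.intro monoidI)

lemma free_lift_locale:
  assumes "kalgebra K B" and "\<And>l. \<sigma> l \<in> carrier B"
  shows "monoid_alg_lift K free_monoid B (word_prod B \<sigma>)"
proof -
  interpret B: kalgebra K B by fact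
  interpret monoid_alg K free_monoid by (rule free_monoid_alg) (rule B.K.is_cring)
  have cl: "word_prod B \<sigma> w \<in> carrier B" for w
    using assms(2) by (induction w) (auto simp: word_prod_def)
  have "word_prod B \<sigma> (v @ w) = word_prod B \<sigma> v \<otimes>\<^bsub>B\<^esub> word_prod B \<sigma> w" for v w
    using assms(2) cl by (induction v) (auto simp: word_prod_def B.A.m_assoc)
  moreover have nil: "word_prod B \<sigma> [] = \<one>\<^bsub>B\<^esub>" by (simp add: word_prod_def)
  ultimately show ?thesis
    by unfold_locales (auto simp: cl)
qed

lemma free_algebra_kalgebra:
  assumes "cring K"
  shows "kalgebra K (free_algebra K)"
  unfolding free_algebra_def
  by (rule monoid_alg.monoid_algebra_kalgebra[OF free_monoid_alg[OF assms]])

lemma gen_closed: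
  assumes "cring K"
  shows "gen K l \<in> carrier (free_algebra K)"
proof -
  interpret monoid_alg K free_monoid by (rule free_monoid_alg) fact
  show ?thesis by (simp add: gen_def free_algebra_def single_closed)
qed

lemma free_lift_hom:
  assumes "kalgebra K B" and "\<And>l. \<sigma> l \<in> carrier B"
  shows "free_lift K B \<sigma> \<in> alg_hom K (free_algebra K) B"
  unfolding free_lift_def free_algebra_def
  by (rule monoid_alg_lift.monoid_lift_hom[OF free_lift_locale[OF assms]])

lemma free_lift_gen:
  assumes "kalgebra K B" and "\<And>l. \<sigma> l \<in> carrier B"
  shows "free_lift K B \<sigma> (gen K l) = \<sigma> l"
proof -
  interpret B: kalgebra K B by fact
  show ?thesis
    unfolding free_lift_def gen_def using assms(2)
    by (subst monoid_alg_lift.monoid_lift_single[OF free_lift_locale[OF assms]])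
      (auto simp: word_prod_def)
qed

lemma free_algebra_span:
  assumes "cring K"
  shows "carrier (free_algebra K) \<subseteq> alg_span K (free_algebra K) (range (gen K))"
proof -
  interpret monoid_alg K free_monoid by (rule free_monoid_alg) fact
  have "single K w \<one>\<^bsub>K\<^esub> \<in> alg_span K (free_algebra K) (range (gen K))" for w
  proof (induction w)
    case Nil
    then show ?case
      using span_one[of "free_algebra K" K] by (simp add: free_algebra_def)
  next
    case (Cons l w)
    have "gen K l \<otimes>\<^bsub>free_algebra K\<^esub> single K w \<one>\<^bsub>K\<^esub> \<in> alg_span K (free_algebra K) (range (gen K))"
      by (intro span_mult span_incl Cons.IH) auto
    then show ?case by (simp add: gen_def free_algebra_def monoid_algebra_mult_single)
  qed
  then show ?thesis
    using monoid_algebra_span by (simp add: free_algebra_def)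
qed

text \<open>Both sides are the same sum over the words in the support. The identification makes
  substitution, and with it the matrix action, an algebra homomorphism on the free algebra.\<close>

lemma substitution_eq_free_lift:
  assumes "cring K" and "\<And>l. \<sigma> l \<in> carrier (free_algebra K)" and "f \<in> carrier (free_algebra K)"
  shows "substitution K \<sigma> f = free_lift K (free_algebra K) \<sigma> f"
  using assms(3) unfolding free_lift_def
  by (subst monoid_alg_lift.monoid_lift_finsum[OF free_lift_locale[OF free_algebra_kalgebra[OF assms(1)] assms(2)]])
    (auto simp: substitution_def word_prod_def free_algebra_def)

section \<open>Polynomials as the monoid algebra of the exponents\<close>

definition nat_monoid :: "nat monoid"
  where "nat_monoid = \<lparr>carrier = UNIV, monoid.mult = (+), one = 0\<rparr>"

lemma nat_monoid_simps [simp]: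
  "carrier nat_monoid = UNIV" "m \<otimes>\<^bsub>nat_monoid\<^esub> n = m + n" "\<one>\<^bsub>nat_monoid\<^esub> = 0"
  by (simp_all add: nat_monoid_def)

lemma nat_monoid_alg:
  assumes "cring K"
  shows "monoid_alg K nat_monoid"
  using assms by (auto intro!: monoid_alg.intro monoidI)

text \<open>A set of natural numbers is finite exactly when it is bounded. Through this
  identification K[x] takes its mapping property from monoid algebras.\<close>

lemma up_eq_finsupp: "up K = finsupp_funs K nat_monoid"
proof -
  have "finite (supp K f) \<longleftrightarrow> (\<exists>n. bound \<zero>\<^bsub>K\<^esub> n f)" for f :: "nat \<Rightarrow> 'a"
  proof
    assume "finite (supp K f)"
    then obtain n where "\<forall>m\<in>supp K f. m \<le> n"
      using finite_nat_set_iff_bounded_le by blast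
    then have "bound \<zero>\<^bsub>K\<^esub> n f" by (force simp: supp_def bound_def)
    then show "\<exists>n. bound \<zero>\<^bsub>K\<^esub> n f" ..
  next
    assume "\<exists>n. bound \<zero>\<^bsub>K\<^esub> n f"
    then obtain n where "bound \<zero>\<^bsub>K\<^esub> n f" ..
    then have "supp K f \<subseteq> {..n}"
      by (auto simp: supp_def dest: bound_below)
    then show "finite (supp K f)" by (rule finite_subset) simp
  qed
  then show ?thesis by (auto simp: up_def finsupp_funs_def)
qed

lemma UP_carrier [simp]: "carrier (UP K) = up K"
  by (simp add: UP_def)

lemma UP_mult_eq:
  assumes "cring K" and f: "f \<in> up K" and h: "h \<in> up K"
  shows "f \<otimes>\<^bsub>UP K\<^esub> h = f \<otimes>\<^bsub>monoid_algebra K nat_monoid\<^esub> h"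
proof
  interpret K: cring K by fact
  fix n
  have cl: "f i \<in> carrier K" "h i \<in> carrier K" for i using f h by auto
  have "(f \<otimes>\<^bsub>monoid_algebra K nat_monoid\<^esub> h) n =
      (\<Oplus>\<^bsub>K\<^esub>p\<in>{(s, t) \<in> supp K f \<times> supp K h. s + t = n}. f (fst p) \<otimes>\<^bsub>K\<^esub> h (snd p))"
    by (simp add: monoid_algebra_def case_prod_unfold)
  \<comment> \<open>The pairs with sum n are the pairs (i, n - i); those added here have a zero
    factor.\<close>
  also have "\<dots> = (\<Oplus>\<^bsub>K\<^esub>p\<in>(\<lambda>i. (i, n - i)) ` {..n}. f (fst p) \<otimes>\<^bsub>K\<^esub> h (snd p))"
    by (rule K.add.finprod_mono_neutral_cong_left)
      (use cl in \<open>auto simp: supp_def image_iff\<close>)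
  also have "\<dots> = (\<Oplus>\<^bsub>K\<^esub>i\<in>{..n}. f i \<otimes>\<^bsub>K\<^esub> h (n - i))"
    by (subst K.finsum_reindex) (use cl in \<open>auto simp: inj_on_def\<close>)
  also have "\<dots> = (f \<otimes>\<^bsub>UP K\<^esub> h) n" using f h by (simp add: UP_def)
  finally show "(f \<otimes>\<^bsub>UP K\<^esub> h) n = (f \<otimes>\<^bsub>monoid_algebra K nat_monoid\<^esub> h) n" by simp
qed

text \<open>The operations of \<open>UP\<close> are specified on polynomials only, so equality of
  the two records is not claimed; the identity as a homomorphism in both directions transports
  results instead.\<close>

lemma UP_id_hom:
  assumes "cring K"
  shows "(\<lambda>f. f) \<in> alg_hom K (UP K) (monoid_algebra K nat_monoid)"
    and "(\<lambda>f. f) \<in> alg_hom K (monoid_algebra K nat_monoid) (UP K)"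
proof -
  have one: "\<one>\<^bsub>UP K\<^esub> = \<one>\<^bsub>monoid_algebra K nat_monoid\<^esub>"
    by (auto simp: UP_def single_def)
  have ops: "f \<oplus>\<^bsub>UP K\<^esub> h = f \<oplus>\<^bsub>monoid_algebra K nat_monoid\<^esub> h"
    "c \<in> carrier K \<Longrightarrow> c \<odot>\<^bsub>UP K\<^esub> f = c \<odot>\<^bsub>monoid_algebra K nat_monoid\<^esub> f"
    if "f \<in> up K" "h \<in> up K" for f h c
    using that by (auto simp: UP_def)
  show "(\<lambda>f. f) \<in> alg_hom K (UP K) (monoid_algebra K nat_monoid)"
    by (rule alg_homI) (simp_all only: UP_carrier monoid_algebra_simps(1) up_eq_finsupp[symmetric]
        ops UP_mult_eq[OF assms] one)
  show "(\<lambda>f. f) \<in> alg_hom K (monoid_algebra K nat_monoid) (UP K)"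
    by (rule alg_homI) (simp_all only: UP_carrier monoid_algebra_simps(1) up_eq_finsupp[symmetric]
        ops UP_mult_eq[OF assms] one)
qed

lemma UP_kalgebra:
  assumes "cring K"
  shows "kalgebra K (UP K)" and "cring (UP K)"
proof -
  interpret K: cring K by fact
  interpret U: UP_cring K "UP K" by unfold_locales
  note alg = U.UP_algebra and mod = algebra.axioms(1)[OF U.UP_algebra]
  show "cring (UP K)" by (rule U.UP_cring)
  have *: "a \<otimes>\<^bsub>UP K\<^esub> (c \<odot>\<^bsub>UP K\<^esub> b) = c \<odot>\<^bsub>UP K\<^esub> (a \<otimes>\<^bsub>UP K\<^esub> b)"
    if "c \<in> carrier K" "a \<in> carrier (UP K)" "b \<in> carrier (UP K)" for c a b
    using that algebra.smult_assoc2[OF alg, of c b a]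
    by (metis U.P.m_comm module.smult_closed[OF mod])
  show "kalgebra K (UP K)"
    by (intro kalgebra.intro kalgebra_axioms.intro assms U.UP_cring[THEN cring.axioms(1)])
      (simp_all add: module.smult_closed[OF mod] module.smult_l_distr[OF mod]
        module.smult_r_distr[OF mod] module.smult_assoc1[OF mod] module.smult_one[OF mod]
        algebra.smult_assoc2[OF alg] * del: UP_carrier)
qed

definition up_var :: "('k, 'c) ring_scheme \<Rightarrow> nat \<Rightarrow> 'k"
  where "up_var K = single K 1 \<one>\<^bsub>K\<^esub>"

lemma monom_one_eq_up_var:
  assumes "cring K"
  shows "up_ring.monom (UP K) \<one>\<^bsub>K\<^esub> 1 = up_var K"
proof -
  interpret cring K by fact
  show ?thesis by (auto simp: UP_def up_var_def single_def)
qed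

lemma up_var_closed:
  assumes "cring K"
  shows "up_var K \<in> carrier (UP K)"
proof -
  interpret monoid_alg K nat_monoid by (rule nat_monoid_alg) fact
  show ?thesis using single_closed[of 1] by (simp add: up_eq_finsupp up_var_def)
qed

lemma UP_span:
  assumes "cring K"
  shows "carrier (UP K) \<subseteq> alg_span K (UP K) {up_var K}"
proof
  interpret monoid_alg K nat_monoid by (rule nat_monoid_alg) fact
  let ?N = "monoid_algebra K nat_monoid"
  have "single K n \<one>\<^bsub>K\<^esub> \<in> alg_span K ?N {up_var K}" for n
  proof (induction n)
    case 0
    then show ?case using span_one[of ?N K "{up_var K}"] by simp
  next
    case (Suc n)
    have "up_var K \<otimes>\<^bsub>?N\<^esub> single K n \<one>\<^bsub>K\<^esub> \<in> alg_span K ?N {up_var K}"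
      by (intro span_mult span_incl Suc.IH) auto
    then show ?case by (simp add: up_var_def monoid_algebra_mult_single)
  qed
  then have gen: "carrier ?N \<subseteq> alg_span K ?N {up_var K}"
    by (intro monoid_algebra_span)
  fix f assume "f \<in> carrier (UP K)"
  then have "f \<in> carrier ?N" by (simp add: up_eq_finsupp)
  then show "f \<in> alg_span K (UP K) {up_var K}"
    using alg_hom_span[OF monoid_algebra_kalgebra UP_id_hom(2)[OF assms] gen, of "{up_var K}" f]
      up_var_closed[OF assms]
    by (simp add: up_eq_finsupp span_incl)
qed

lemma UP_lift_exists:
  assumes "kalgebra K B" and b: "b \<in> carrier B"
  obtains \<psi> where "\<psi> \<in> alg_hom K (UP K) B" and "\<psi> (up_var K) = b"
proof -
  interpret B: kalgebra K B by fact
  interpret monoid_alg_lift K nat_monoid B "\<lambda>n. b [^]\<^bsub>B\<^esub> n"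
    by (intro monoid_alg_lift.intro monoid_alg_lift_axioms.intro nat_monoid_alg B.K.is_cring
        B.kalgebra_axioms) (auto simp: b B.A.nat_pow_mult)
  show ?thesis
  proof
    show "monoid_lift K B (\<lambda>n. b [^]\<^bsub>B\<^esub> n) \<in> alg_hom K (UP K) B"
      using alg_hom_comp[OF UP_id_hom(1)[OF B.K.is_cring] monoid_lift_hom] by simp
    show "monoid_lift K B (\<lambda>n. b [^]\<^bsub>B\<^esub> n) (up_var K) = b"
      using monoid_lift_single[of 1 "\<one>\<^bsub>K\<^esub>"] b by (simp add: up_var_def)
  qed
qed

section \<open>Quotients and tensor products\<close>

text \<open>The predicate \<open>ring\<close> looks only at the five ring fields, so it passes from
  \<open>A Quot I\<close> to the same ring extended by a scalar multiplication.\<close>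

lemma ring_cong:
  assumes "ring R" and "carrier S = carrier R" "monoid.mult S = monoid.mult R" "one S = one R"
    "ring.zero S = ring.zero R" "ring.add S = ring.add R"
  shows "ring S"
proof -
  interpret ring R by fact
  show ?thesis
  proof (rule ringI)
    show "abelian_group S"
      by (rule abelian_groupI) (use assms in \<open>auto simp: a_ac intro: add.l_inv_ex\<close>)
    show "Group.monoid S"
      by (rule monoidI) (use assms in \<open>auto simp: m_assoc\<close>)
  qed (use assms in \<open>auto simp: l_distr r_distr\<close>)
qed

lemma quotient_algebra_simps [simp]:
  "carrier (quotient_algebra A I) = carrier (A Quot I)"
  "monoid.mult (quotient_algebra A I) = monoid.mult (A Quot I)"
  "one (quotient_algebra A I) = one (A Quot I)"
  "ring.zero (quotient_algebra A I) = ring.zero (A Quot I)"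
  "ring.add (quotient_algebra A I) = ring.add (A Quot I)"
  "c \<odot>\<^bsub>quotient_algebra A I\<^esub> C = (\<Union>x\<in>C. I +>\<^bsub>A\<^esub> (c \<odot>\<^bsub>A\<^esub> x))"
  by (simp_all add: quotient_algebra_def ring.defs module.defs)

locale alg_ideal = kalgebra K A + I: ideal I A
  for K :: "('k, 'c) ring_scheme" and A :: "('k, 'a, 'd) module_scheme" and I :: "'a set"
begin

abbreviation Q where "Q \<equiv> quotient_algebra A I"
abbreviation coset where "coset a \<equiv> I +>\<^bsub>A\<^esub> a"

lemma quotient_carrier: "carrier Q = coset ` carrier A"
  by (auto simp: FactRing_simps)

lemma coset_add: "\<lbrakk>a \<in> carrier A; b \<in> carrier A\<rbrakk> \<Longrightarrow> coset (a \<oplus>\<^bsub>A\<^esub> b) = coset a \<oplus>\<^bsub>Q\<^esub> coset b"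
  unfolding quotient_algebra_simps by (rule ring_hom_add[OF I.rcos_ring_hom])

lemma coset_mult: "\<lbrakk>a \<in> carrier A; b \<in> carrier A\<rbrakk> \<Longrightarrow> coset (a \<otimes>\<^bsub>A\<^esub> b) = coset a \<otimes>\<^bsub>Q\<^esub> coset b"
  unfolding quotient_algebra_simps by (rule ring_hom_mult[OF I.rcos_ring_hom])

text \<open>An ideal of the ring A is stable under scalars, because c i = (c 1) i. Hence the union
  over representatives in \<open>quotient_algebra\<close> is a nonempty union of equal
  cosets.\<close>

lemma coset_smult:
  assumes c: "c \<in> carrier K" and a: "a \<in> carrier A"
  shows "c \<odot>\<^bsub>Q\<^esub> coset a = coset (c \<odot>\<^bsub>A\<^esub> a)"
proof -
  have "coset (c \<odot>\<^bsub>A\<^esub> x) = coset (c \<odot>\<^bsub>A\<^esub> a)" if x: "x \<in> coset a" for x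
  proof -
    obtain i where i: "i \<in> I" "x = i \<oplus>\<^bsub>A\<^esub> a" using x by (auto simp: a_r_coset_def')
    have iA: "i \<in> carrier A" using i I.a_Hcarr by auto
    have "(c \<odot>\<^bsub>A\<^esub> \<one>\<^bsub>A\<^esub>) \<otimes>\<^bsub>A\<^esub> i \<in> I" using c i by (intro I.I_l_closed) auto
    then have "c \<odot>\<^bsub>A\<^esub> i \<in> I" using c iA by (simp add: scalar_mult)
    then have "c \<odot>\<^bsub>A\<^esub> x \<in> coset (c \<odot>\<^bsub>A\<^esub> a)"
      using i iA c a by (auto simp: smult_r_distr a_r_coset_def')
    from I.a_repr_independence'[OF this] show ?thesis
      using c a by (metis smult_closed)
  qed
  moreover have "coset a \<noteq> {}" using I.a_rcos_self[OF a] by blast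
  ultimately show ?thesis
    unfolding quotient_algebra_simps by (intro SUP_eq_const)
qed

lemma quotient_kalgebra: "kalgebra K Q"
proof (intro kalgebra.intro kalgebra_axioms.intro)
  show "cring K" ..
  show "ring Q" by (rule ring_cong[OF I.quotient_is_ring]) simp_all
qed (auto simp: quotient_carrier image_iff coset_smult coset_add[symmetric] coset_mult[symmetric]
    smult_l_distr smult_r_distr smult_assoc smult_mult_left smult_mult_right
    simp del: quotient_algebra_simps)

lemma coset_hom: "coset \<in> alg_hom K A Q"
proof (rule alg_homI)
  show "coset \<one>\<^bsub>A\<^esub> = \<one>\<^bsub>Q\<^esub>" by (simp add: FactRing_def)
qed (auto simp: quotient_carrier coset_add coset_mult coset_smult simp del: quotient_algebra_simps)

lemma coset_eq_zero_iff: "a \<in> carrier A \<Longrightarrow> coset a = \<zero>\<^bsub>Q\<^esub> \<longleftrightarrow> a \<in> I"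
  using I.a_rcos_self I.a_rcos_const by (auto simp: FactRing_def)

lemma quotient_cring: "cring A \<Longrightarrow> cring Q"
  using I.quotient_is_cring quotient_kalgebra
  by (auto simp: cring_def comm_monoid_def comm_monoid_axioms_def kalgebra_def ring_def)

lemma quotient_span:
  assumes "carrier A \<subseteq> alg_span K A U" "U \<subseteq> carrier A" "coset ` U \<subseteq> alg_span K Q V"
  shows "carrier Q \<subseteq> alg_span K Q V"
  unfolding quotient_carrier
  using alg_hom_span[OF kalgebra_axioms coset_hom assms] by auto

end

lemma genideal_alg_ideal:
  assumes "kalgebra K A" and "U \<subseteq> carrier A"
  shows "alg_ideal K A (Idl\<^bsub>A\<^esub> U)"
proof -
  interpret kalgebra K A by fact
  show ?thesis
    by (intro alg_ideal.intro kalgebra_axioms A.genideal_ideal assms(2))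
qed

text \<open>The kernel of a homomorphism is an ideal, so vanishing on generators means vanishing on
  the ideal they generate. Then \<phi> is constant on cosets, and \<open>the_elem\<close> reads off
  its value.\<close>

lemma quotient_lift_exists:
  assumes A: "kalgebra K A" and B: "kalgebra K B" and U: "U \<subseteq> carrier A"
    and f: "\<phi> \<in> alg_hom K A B" and zero: "\<And>u. u \<in> U \<Longrightarrow> \<phi> u = \<zero>\<^bsub>B\<^esub>"
  obtains \<psi> where "\<psi> \<in> alg_hom K (quotient_algebra A (Idl\<^bsub>A\<^esub> U)) B"
    and "\<And>a. a \<in> carrier A \<Longrightarrow> \<psi> (Idl\<^bsub>A\<^esub> U +>\<^bsub>A\<^esub> a) = \<phi> a"
proof -
  define I where "I = Idl\<^bsub>A\<^esub> U"
  interpret alg_ideal K A I unfolding I_def by (rule genideal_alg_ideal[OF A U])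
  interpret B: kalgebra K B by fact
  interpret h: ring_hom_ring A B \<phi>
    by (rule ring_hom_ringI2) (use f in \<open>auto simp: alg_hom_def A.ring_axioms B.A.ring_axioms\<close>)
  have "I \<subseteq> a_kernel A B \<phi>"
    unfolding I_def
  proof (rule A.genideal_minimal[OF h.kernel_is_ideal])
    show "U \<subseteq> a_kernel A B \<phi>" using U zero unfolding a_kernel_def' by blast
  qed
  then have ker: "\<phi> i = \<zero>\<^bsub>B\<^esub>" if "i \<in> I" for i
    using that unfolding a_kernel_def' by blast
  define \<psi> where "\<psi> C = the_elem (\<phi> ` C)" for C
  have \<psi>: "\<psi> (coset a) = \<phi> a" if a: "a \<in> carrier A" for a
  proof -
    have "\<phi> ` coset a = {\<phi> a}"
    proof -
      have "\<phi> x = \<phi> a" if x: "x \<in> coset a" for x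
      proof -
        obtain i where "i \<in> I" "x = i \<oplus>\<^bsub>A\<^esub> a" using x by (auto simp: a_r_coset_def')
        then show ?thesis
          using a ker I.a_Hcarr alg_hom_closed[OF f a] by (auto simp: alg_hom_add[OF f])
      qed
      then show ?thesis using I.a_rcos_self[OF a] by blast
    qed
    then show ?thesis by (simp add: \<psi>_def)
  qed
  show ?thesis
  proof
    show "\<psi> (Idl\<^bsub>A\<^esub> U +>\<^bsub>A\<^esub> a) = \<phi> a" if "a \<in> carrier A" for a
      using \<psi>[OF that] by (simp add: I_def)
    have "\<psi> \<in> alg_hom K Q B"
    proof (rule alg_homI)
      show "\<psi> \<one>\<^bsub>Q\<^esub> = \<one>\<^bsub>B\<^esub>"
        using \<psi>[of "\<one>\<^bsub>A\<^esub>"] alg_hom_one[OF f] alg_hom_one[OF coset_hom] by simp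
    qed (auto simp: quotient_carrier coset_add[symmetric] coset_mult[symmetric] coset_smult \<psi>
        alg_homD[OF f] simp del: quotient_algebra_simps)
    then show "\<psi> \<in> alg_hom K (quotient_algebra A (Idl\<^bsub>A\<^esub> U)) B" by (simp add: I_def)
  qed
qed

section \<open>Tensor products of algebras\<close>

locale tensor = A: kalgebra K A + B: kalgebra K B
  for K :: "('k, 'c) ring_scheme" and A :: "('k, 'a, 'd) module_scheme"
    and B :: "('k, 'b, 'e) module_scheme"
begin

abbreviation F where "F \<equiv> monoid_algebra K (A \<times>\<times> B)"
abbreviation e where "e a b \<equiv> single K (a, b) \<one>\<^bsub>K\<^esub>"
abbreviation T where "T \<equiv> tensor_algebra K A B"
abbreviation pure where "pure a b \<equiv> pure_tensor K A B a b"

sublocale AB: monoid_alg K "A \<times>\<times> B"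
  by (intro monoid_alg.intro A.K.is_cring DirProd_monoid A.A.monoid_axioms B.A.monoid_axioms)

sublocale F: kalgebra K F
  by (rule AB.monoid_algebra_kalgebra)

lemma e_closed: "\<lbrakk>a \<in> carrier A; b \<in> carrier B\<rbrakk> \<Longrightarrow> e a b \<in> carrier F"
  using AB.single_closed[of "(a, b)"] by (simp add: DirProd_def)

lemma tensor_relations_closed: "tensor_relations K A B \<subseteq> carrier F"
  unfolding tensor_relations_def Let_def
  by (auto intro!: F.A.minus_closed F.A.a_closed F.smult_closed e_closed
      simp del: monoid_algebra_simps)

sublocale I: alg_ideal K F "tensor_ideal K A B"
  unfolding tensor_ideal_def
  by (rule genideal_alg_ideal[OF F.kalgebra_axioms tensor_relations_closed])

lemma tensor_eq: "T = quotient_algebra F (tensor_ideal K A B)"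
  by (simp add: tensor_algebra_def)

lemma tensor_kalgebra: "kalgebra K T"
  unfolding tensor_eq by (rule I.quotient_kalgebra)

sublocale T: kalgebra K T
  by (rule tensor_kalgebra)

lemma coset_hom: "(\<lambda>a. tensor_ideal K A B +>\<^bsub>F\<^esub> a) \<in> alg_hom K F T"
  unfolding tensor_eq by (rule I.coset_hom)

lemma pure_closed: "\<lbrakk>a \<in> carrier A; b \<in> carrier B\<rbrakk> \<Longrightarrow> pure a b \<in> carrier T"
  unfolding pure_tensor_def by (rule alg_hom_closed[OF coset_hom e_closed])

text \<open>All bilinearity rules go through this criterion: each relation is by definition the
  difference of the two representatives to be identified.\<close>

lemma coset_eqI:
  assumes "f \<ominus>\<^bsub>F\<^esub> g \<in> tensor_relations K A B" "f \<in> carrier F" "g \<in> carrier F"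
  shows "tensor_ideal K A B +>\<^bsub>F\<^esub> f = tensor_ideal K A B +>\<^bsub>F\<^esub> g"
proof -
  have "f \<ominus>\<^bsub>F\<^esub> g \<in> tensor_ideal K A B"
    using assms(1) F.A.genideal_self[OF tensor_relations_closed] by (auto simp: tensor_ideal_def)
  then show ?thesis
    using assms(2,3) F.A.quotient_eq_iff_same_a_r_cos[OF I.I.ideal_axioms] by blast
qed

lemma tensor_relationsI:
  "\<lbrakk>a \<in> carrier A; a' \<in> carrier A; b \<in> carrier B\<rbrakk> \<Longrightarrow>
    e (a \<oplus>\<^bsub>A\<^esub> a') b \<ominus>\<^bsub>F\<^esub> (e a b \<oplus>\<^bsub>F\<^esub> e a' b) \<in> tensor_relations K A B"
  "\<lbrakk>a \<in> carrier A; b \<in> carrier B; b' \<in> carrier B\<rbrakk> \<Longrightarrow>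
    e a (b \<oplus>\<^bsub>B\<^esub> b') \<ominus>\<^bsub>F\<^esub> (e a b \<oplus>\<^bsub>F\<^esub> e a b') \<in> tensor_relations K A B"
  "\<lbrakk>c \<in> carrier K; a \<in> carrier A; b \<in> carrier B\<rbrakk> \<Longrightarrow>
    e (c \<odot>\<^bsub>A\<^esub> a) b \<ominus>\<^bsub>F\<^esub> (c \<odot>\<^bsub>F\<^esub> e a b) \<in> tensor_relations K A B"
  "\<lbrakk>c \<in> carrier K; a \<in> carrier A; b \<in> carrier B\<rbrakk> \<Longrightarrow>
    e a (c \<odot>\<^bsub>B\<^esub> b) \<ominus>\<^bsub>F\<^esub> (c \<odot>\<^bsub>F\<^esub> e a b) \<in> tensor_relations K A B"
  unfolding tensor_relations_def Let_def by blast+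

lemma pure_add_left:
  assumes "a \<in> carrier A" "a' \<in> carrier A" "b \<in> carrier B"
  shows "pure (a \<oplus>\<^bsub>A\<^esub> a') b = pure a b \<oplus>\<^bsub>T\<^esub> pure a' b"
proof -
  have "pure (a \<oplus>\<^bsub>A\<^esub> a') b = tensor_ideal K A B +>\<^bsub>F\<^esub> (e a b \<oplus>\<^bsub>F\<^esub> e a' b)"
    unfolding pure_tensor_def
    by (rule coset_eqI) (use assms e_closed in
      \<open>auto intro: tensor_relationsI simp del: monoid_algebra_simps\<close>)
  then show ?thesis
    using alg_hom_add[OF coset_hom] assms e_closed by (simp add: pure_tensor_def)
qed

lemma pure_add_right:
  assumes "a \<in> carrier A" "b \<in> carrier B" "b' \<in> carrier B"
  shows "pure a (b \<oplus>\<^bsub>B\<^esub> b') = pure a b \<oplus>\<^bsub>T\<^esub> pure a b'"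
proof -
  have "pure a (b \<oplus>\<^bsub>B\<^esub> b') = tensor_ideal K A B +>\<^bsub>F\<^esub> (e a b \<oplus>\<^bsub>F\<^esub> e a b')"
    unfolding pure_tensor_def
    by (rule coset_eqI) (use assms e_closed in
      \<open>auto intro: tensor_relationsI simp del: monoid_algebra_simps\<close>)
  then show ?thesis
    using alg_hom_add[OF coset_hom] assms e_closed by (simp add: pure_tensor_def)
qed

lemma pure_smult:
  assumes "c \<in> carrier K" "a \<in> carrier A" "b \<in> carrier B"
  shows "pure (c \<odot>\<^bsub>A\<^esub> a) b = c \<odot>\<^bsub>T\<^esub> pure a b" "pure a (c \<odot>\<^bsub>B\<^esub> b) = c \<odot>\<^bsub>T\<^esub> pure a b"
proof -
  have "pure (c \<odot>\<^bsub>A\<^esub> a) b = tensor_ideal K A B +>\<^bsub>F\<^esub> (c \<odot>\<^bsub>F\<^esub> e a b)"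
    "pure a (c \<odot>\<^bsub>B\<^esub> b) = tensor_ideal K A B +>\<^bsub>F\<^esub> (c \<odot>\<^bsub>F\<^esub> e a b)"
    unfolding pure_tensor_def
    by (rule coset_eqI; use assms e_closed in
      \<open>auto intro: tensor_relationsI simp del: monoid_algebra_simps\<close>)+
  then show "pure (c \<odot>\<^bsub>A\<^esub> a) b = c \<odot>\<^bsub>T\<^esub> pure a b" "pure a (c \<odot>\<^bsub>B\<^esub> b) = c \<odot>\<^bsub>T\<^esub> pure a b"
    using alg_hom_smult[OF coset_hom] assms e_closed by (simp_all add: pure_tensor_def)
qed

lemma pure_mult:
  assumes "a \<in> carrier A" "a' \<in> carrier A" "b \<in> carrier B" "b' \<in> carrier B"
  shows "pure a b \<otimes>\<^bsub>T\<^esub> pure a' b' = pure (a \<otimes>\<^bsub>A\<^esub> a') (b \<otimes>\<^bsub>B\<^esub> b')"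
proof -
  have "e a b \<otimes>\<^bsub>F\<^esub> e a' b' = e (a \<otimes>\<^bsub>A\<^esub> a') (b \<otimes>\<^bsub>B\<^esub> b')"
    using assms AB.monoid_algebra_mult_single[of "(a, b)" "(a', b')"] by (simp add: DirProd_def)
  then show ?thesis
    using alg_hom_mult[OF coset_hom e_closed[of a b] e_closed[of a' b']] assms by (simp add: pure_tensor_def)
qed

lemma pure_one: "pure \<one>\<^bsub>A\<^esub> \<one>\<^bsub>B\<^esub> = \<one>\<^bsub>T\<^esub>"
  using alg_hom_one[OF coset_hom] by (simp add: pure_tensor_def DirProd_def)

lemma pure_left_hom: "(\<lambda>a. pure a \<one>\<^bsub>B\<^esub>) \<in> alg_hom K A T"
  by (rule alg_homI) (simp_all add: pure_closed pure_add_left pure_mult pure_one pure_smult)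

lemma pure_right_hom: "(\<lambda>b. pure \<one>\<^bsub>A\<^esub> b) \<in> alg_hom K B T"
  by (rule alg_homI) (simp_all add: pure_closed pure_add_right pure_mult pure_one pure_smult)

text \<open>An elementary tensor is the product of (a tensor 1) and (1 tensor b), and each factor
  depends homomorphically on its entry, so generators of A and of B suffice.\<close>

lemma tensor_span:
  assumes A: "carrier A \<subseteq> alg_span K A U" "U \<subseteq> carrier A"
    and B: "carrier B \<subseteq> alg_span K B V" "V \<subseteq> carrier B"
    and U: "\<And>u. u \<in> U \<Longrightarrow> pure u \<one>\<^bsub>B\<^esub> \<in> alg_span K T W"
    and V: "\<And>v. v \<in> V \<Longrightarrow> pure \<one>\<^bsub>A\<^esub> v \<in> alg_span K T W"
  shows "carrier T \<subseteq> alg_span K T W"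
proof -
  let ?E = "{e a b |a b. a \<in> carrier A \<and> b \<in> carrier B}"
  have F: "carrier F \<subseteq> alg_span K F ?E"
    by (rule AB.monoid_algebra_span) (auto intro!: span_incl simp: DirProd_def)
  have "pure a b \<in> alg_span K T W" if "a \<in> carrier A" "b \<in> carrier B" for a b
  proof -
    have "pure a \<one>\<^bsub>B\<^esub> \<otimes>\<^bsub>T\<^esub> pure \<one>\<^bsub>A\<^esub> b \<in> alg_span K T W"
      by (intro span_mult alg_hom_span[OF A.kalgebra_axioms pure_left_hom A]
          alg_hom_span[OF B.kalgebra_axioms pure_right_hom B]) (use U V that in auto)
    then show ?thesis using that by (simp add: pure_mult)
  qed
  then have E: "I.coset ` ?E \<subseteq> alg_span K T W" by (auto simp: pure_tensor_def)
  show ?thesis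
    unfolding tensor_eq
    by (rule I.quotient_span[OF F]) (use E e_closed in \<open>auto simp: tensor_eq\<close>)
qed

lemma tensor_comm:
  assumes "cring A" "cring B"
  shows "cring T"
proof -
  interpret A: cring A by fact
  interpret B: cring B by fact
  have "comm_monoid (A \<times>\<times> B)"
    by (intro comm_monoid.intro AB.M.monoid_axioms comm_monoid_axioms.intro)
      (auto simp: DirProd_def A.m_comm B.m_comm)
  then show ?thesis
    unfolding tensor_eq by (intro I.quotient_cring AB.monoid_algebra_comm)
qed

text \<open>The target may be noncommutative. The commuting images make (a, b) \<mapsto> \<alpha>(a)
  \<beta>(b) multiplicative, hence extendable to the monoid algebra on pairs; the bilinearity
  relations die because \<alpha> and \<beta> are linear.\<close>

lemma tensor_lift_exists:
  assumes "kalgebra K C" and f: "\<alpha> \<in> alg_hom K A C" and g: "\<beta> \<in> alg_hom K B C"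
    and comm: "\<And>a b. \<lbrakk>a \<in> carrier A; b \<in> carrier B\<rbrakk> \<Longrightarrow> \<beta> b \<otimes>\<^bsub>C\<^esub> \<alpha> a = \<alpha> a \<otimes>\<^bsub>C\<^esub> \<beta> b"
  obtains \<psi> where "\<psi> \<in> alg_hom K T C"
    and "\<And>a b. \<lbrakk>a \<in> carrier A; b \<in> carrier B\<rbrakk> \<Longrightarrow> \<psi> (pure a b) = \<alpha> a \<otimes>\<^bsub>C\<^esub> \<beta> b"
proof -
  interpret C: kalgebra K C by fact
  note cl [simp] = alg_hom_closed[OF f] alg_hom_closed[OF g]
  interpret l: monoid_alg_lift K "A \<times>\<times> B" C "\<lambda>(a, b). \<alpha> a \<otimes>\<^bsub>C\<^esub> \<beta> b"
  proof (intro monoid_alg_lift.intro monoid_alg_lift_axioms.intro AB.monoid_alg_axioms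
      C.kalgebra_axioms, goal_cases)
    case (3 s t)
    then obtain a b a' b' where st: "s = (a, b)" "t = (a', b')"
      and ab: "a \<in> carrier A" "b \<in> carrier B" "a' \<in> carrier A" "b' \<in> carrier B"
      by (auto simp: DirProd_def)
    have "\<alpha> a \<otimes>\<^bsub>C\<^esub> \<alpha> a' \<otimes>\<^bsub>C\<^esub> (\<beta> b \<otimes>\<^bsub>C\<^esub> \<beta> b') = \<alpha> a \<otimes>\<^bsub>C\<^esub> (\<alpha> a' \<otimes>\<^bsub>C\<^esub> \<beta> b) \<otimes>\<^bsub>C\<^esub> \<beta> b'"
      using ab by (simp add: C.A.m_assoc)
    also have "\<dots> = \<alpha> a \<otimes>\<^bsub>C\<^esub> \<beta> b \<otimes>\<^bsub>C\<^esub> (\<alpha> a' \<otimes>\<^bsub>C\<^esub> \<beta> b')"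
      using ab by (simp add: C.A.m_assoc flip: comm[of a' b])
    finally show ?case
      using ab by (simp add: st DirProd_def alg_hom_mult[OF f] alg_hom_mult[OF g])
  qed (auto simp: DirProd_def alg_hom_one[OF f] alg_hom_one[OF g])
  define h where "h = monoid_lift K C (\<lambda>(a, b). \<alpha> a \<otimes>\<^bsub>C\<^esub> \<beta> b)"
  have h: "h \<in> alg_hom K F C" unfolding h_def by (rule l.monoid_lift_hom)
  have he: "h (e a b) = \<alpha> a \<otimes>\<^bsub>C\<^esub> \<beta> b" if "a \<in> carrier A" "b \<in> carrier B" for a b
    using l.monoid_lift_single[of "(a, b)" "\<one>\<^bsub>K\<^esub>"] that by (simp add: h_def DirProd_def)
  have hdiff: "h (f \<ominus>\<^bsub>F\<^esub> g) = \<zero>\<^bsub>C\<^esub>" if "f \<in> carrier F" "g \<in> carrier F" "h f = h g" for f g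
    using that alg_hom_closed[OF h that(2)]
    by (simp add: alg_hom_minus[OF F.kalgebra_axioms assms(1) h that(1,2)] C.A.r_neg
        a_minus_def[of C] del: monoid_algebra_simps)
  have "h r = \<zero>\<^bsub>C\<^esub>" if "r \<in> tensor_relations K A B" for r
    using that unfolding tensor_relations_def Let_def
    by (auto intro!: hdiff simp: e_closed alg_hom_add[OF h] alg_hom_smult[OF h] he alg_homD[OF f]
        alg_homD[OF g] C.A.l_distr C.A.r_distr C.smult_mult_left C.smult_mult_right
        simp del: monoid_algebra_simps)
  then obtain \<psi> where "\<psi> \<in> alg_hom K T C"
    and "\<And>a. a \<in> carrier F \<Longrightarrow> \<psi> (tensor_ideal K A B +>\<^bsub>F\<^esub> a) = h a"
    using quotient_lift_exists[OF F.kalgebra_axioms assms(1) tensor_relations_closed h]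
    by (metis tensor_eq tensor_ideal_def)
  then show ?thesis
    using that[of \<psi>] he e_closed by (simp add: pure_tensor_def)
qed

end

section \<open>Derivations and Ore extensions\<close>

definition dual_numbers :: "('k, 'a, 'd) module_scheme \<Rightarrow> ('k, 'a \<times> 'a) module"
  where "dual_numbers R = \<lparr>
    carrier = carrier R \<times> carrier R,
    monoid.mult = (\<lambda>(a, b) (c, d). (a \<otimes>\<^bsub>R\<^esub> c, a \<otimes>\<^bsub>R\<^esub> d \<oplus>\<^bsub>R\<^esub> b \<otimes>\<^bsub>R\<^esub> c)),
    one = (\<one>\<^bsub>R\<^esub>, \<zero>\<^bsub>R\<^esub>),
    ring.zero = (\<zero>\<^bsub>R\<^esub>, \<zero>\<^bsub>R\<^esub>),
    add = (\<lambda>(a, b) (c, d). (a \<oplus>\<^bsub>R\<^esub> c, b \<oplus>\<^bsub>R\<^esub> d)),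
    smult = (\<lambda>c (a, b). (c \<odot>\<^bsub>R\<^esub> a, c \<odot>\<^bsub>R\<^esub> b))\<rparr>"

lemma dual_numbers_simps [simp]:
  "carrier (dual_numbers R) = carrier R \<times> carrier R"
  "(a, b) \<otimes>\<^bsub>dual_numbers R\<^esub> (c, d) = (a \<otimes>\<^bsub>R\<^esub> c, a \<otimes>\<^bsub>R\<^esub> d \<oplus>\<^bsub>R\<^esub> b \<otimes>\<^bsub>R\<^esub> c)"
  "\<one>\<^bsub>dual_numbers R\<^esub> = (\<one>\<^bsub>R\<^esub>, \<zero>\<^bsub>R\<^esub>)"
  "\<zero>\<^bsub>dual_numbers R\<^esub> = (\<zero>\<^bsub>R\<^esub>, \<zero>\<^bsub>R\<^esub>)"
  "(a, b) \<oplus>\<^bsub>dual_numbers R\<^esub> (c, d) = (a \<oplus>\<^bsub>R\<^esub> c, b \<oplus>\<^bsub>R\<^esub> d)"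
  "k \<odot>\<^bsub>dual_numbers R\<^esub> (a, b) = (k \<odot>\<^bsub>R\<^esub> a, k \<odot>\<^bsub>R\<^esub> b)"
  by (simp_all add: dual_numbers_def)

lemma dual_numbers_kalgebra:
  assumes "kalgebra K R"
  shows "kalgebra K (dual_numbers R)"
proof -
  interpret kalgebra K R by fact
  have "abelian_group (dual_numbers R)"
  proof (rule abelian_groupI)
    fix u assume "u \<in> carrier (dual_numbers R)"
    then show "\<exists>v\<in>carrier (dual_numbers R). v \<oplus>\<^bsub>dual_numbers R\<^esub> u = \<zero>\<^bsub>dual_numbers R\<^esub>"
      by (intro bexI[of _ "(\<ominus>\<^bsub>R\<^esub> fst u, \<ominus>\<^bsub>R\<^esub> snd u)"]) (auto simp: A.l_neg)
  qed (auto simp: A.a_ac)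
  then have "ring (dual_numbers R)"
    by (intro ringI monoidI)
      (auto simp: A.l_distr A.r_distr A.m_assoc A.a_ac)
  then show ?thesis
    by (intro kalgebra.intro kalgebra_axioms.intro K.is_cring)
      (auto simp: smult_l_distr smult_r_distr smult_assoc smult_mult_left smult_mult_right)
qed

text \<open>A pair (a, b) stands for a + b \<epsilon> with \<epsilon>^2 = 0. If h(a) = a + d(a)
  \<epsilon>, comparing the \<epsilon>-parts of h(a b) = h(a) h(b) gives the Leibniz rule.
  Restriction to the carrier meets the extensionality built into \<open>derivations\<close>.\<close>

lemma dual_numbers_derivation:
  assumes R: "kalgebra K R" and h: "h \<in> alg_hom K R (dual_numbers R)"
    and fst: "\<And>a. a \<in> carrier R \<Longrightarrow> fst (h a) = a"
  shows "restrict (\<lambda>a. snd (h a)) (carrier R) \<in> derivations K R"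
proof -
  interpret kalgebra K R by fact
  have cl: "snd (h a) \<in> carrier R" if "a \<in> carrier R" for a
    using alg_hom_closed[OF h that] by (auto simp: mem_Times_iff)
  have ha: "h a = (a, snd (h a))" if "a \<in> carrier R" for a
    using fst[OF that] by (metis prod.collapse)
  have "snd (h (a \<oplus>\<^bsub>R\<^esub> b)) = snd (h a) \<oplus>\<^bsub>R\<^esub> snd (h b)"
    "snd (h (a \<otimes>\<^bsub>R\<^esub> b)) = a \<otimes>\<^bsub>R\<^esub> snd (h b) \<oplus>\<^bsub>R\<^esub> snd (h a) \<otimes>\<^bsub>R\<^esub> b"
    "c \<in> carrier K \<Longrightarrow> snd (h (c \<odot>\<^bsub>R\<^esub> a)) = c \<odot>\<^bsub>R\<^esub> snd (h a)"
    if "a \<in> carrier R" "b \<in> carrier R" for a b c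
    using alg_homD(2-)[OF h] that ha by (metis dual_numbers_simps(2,5,6) snd_conv)+
  then show ?thesis using cl by (auto simp: derivations_def)
qed

section \<open>The Ore extension as an associative algebra\<close>

locale ore = kalgebra K R + R: cring R
  for K :: "('k, 'c) ring_scheme" and R :: "('k, 'a, 'd) module_scheme" +
  fixes \<delta> :: "'a \<Rightarrow> 'a"
  assumes derivation: "\<delta> \<in> derivations K R"
begin

abbreviation Ore where "Ore \<equiv> ore_extension R \<delta>"
abbreviation shift where "shift \<equiv> ore_shift R \<delta>"
abbreviation mulr where "mulr r f \<equiv> (\<lambda>n. f n \<otimes>\<^bsub>R\<^esub> r)"
abbreviation emb where "emb a \<equiv> single R (0 :: nat) a"
abbreviation Y where "Y \<equiv> single R (Suc 0) \<one>\<^bsub>R\<^esub>"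

sublocale N: monoid_alg R nat_monoid
  by (rule nat_monoid_alg) (rule R.is_cring)

lemma \<delta>_closed [simp]: "a \<in> carrier R \<Longrightarrow> \<delta> a \<in> carrier R"
  using derivation by (auto simp: derivations_def)

lemma \<delta>_add: "\<lbrakk>a \<in> carrier R; b \<in> carrier R\<rbrakk> \<Longrightarrow> \<delta> (a \<oplus>\<^bsub>R\<^esub> b) = \<delta> a \<oplus>\<^bsub>R\<^esub> \<delta> b"
  using derivation by (auto simp: derivations_def)

lemma \<delta>_mult:
  "\<lbrakk>a \<in> carrier R; b \<in> carrier R\<rbrakk> \<Longrightarrow> \<delta> (a \<otimes>\<^bsub>R\<^esub> b) = a \<otimes>\<^bsub>R\<^esub> \<delta> b \<oplus>\<^bsub>R\<^esub> \<delta> a \<otimes>\<^bsub>R\<^esub> b"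
  using derivation by (auto simp: derivations_def)

lemma \<delta>_smult: "\<lbrakk>c \<in> carrier K; a \<in> carrier R\<rbrakk> \<Longrightarrow> \<delta> (c \<odot>\<^bsub>R\<^esub> a) = c \<odot>\<^bsub>R\<^esub> \<delta> a"
  using derivation by (auto simp: derivations_def)

lemma \<delta>_zero [simp]: "\<delta> \<zero>\<^bsub>R\<^esub> = \<zero>\<^bsub>R\<^esub>"
  using \<delta>_smult[of "\<zero>\<^bsub>K\<^esub>" "\<zero>\<^bsub>R\<^esub>"] by simp

text \<open>The Leibniz rule for the product of 1 with itself gives \<delta>(1) = \<delta>(1) +
  \<delta>(1).\<close>

lemma \<delta>_one [simp]: "\<delta> \<one>\<^bsub>R\<^esub> = \<zero>\<^bsub>R\<^esub>"
proof -
  have "\<delta> \<one>\<^bsub>R\<^esub> \<oplus>\<^bsub>R\<^esub> \<delta> \<one>\<^bsub>R\<^esub> = \<delta> \<one>\<^bsub>R\<^esub>"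
    using \<delta>_mult[of "\<one>\<^bsub>R\<^esub>" "\<one>\<^bsub>R\<^esub>"] by simp
  then show ?thesis
    using A.add.l_cancel_one \<delta>_closed A.one_closed by metis
qed

lemma up_closed [simp]: "f \<in> up R \<Longrightarrow> f n \<in> carrier R"
  by auto

lemma up_add [simp]: "\<lbrakk>f \<in> up R; h \<in> up R\<rbrakk> \<Longrightarrow> (\<lambda>n. f n \<oplus>\<^bsub>R\<^esub> h n) \<in> up R"
  using N.sc.finsupp_closed(2) by (simp add: up_eq_finsupp)

lemma up_single [simp]: "r \<in> carrier R \<Longrightarrow> single R n r \<in> up R"
  using N.single_closed by (simp add: up_eq_finsupp)

lemma up_zero [simp]: "(\<lambda>n. \<zero>\<^bsub>R\<^esub>) \<in> up R"
  by (auto simp: up_def)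

text \<open>Right multiplication by y can raise the degree by one, hence the part of the union with
  \<open>Suc\<close>; coefficientwise operations stay in the other part.\<close>

lemma up_supp_mono:
  assumes "f \<in> up R" "f' \<in> up R" and "\<And>n. h n \<in> carrier R"
    and "supp R h \<subseteq> supp R f \<union> Suc ` supp R f'"
  shows "h \<in> up R"
proof -
  have "finite (supp R h)"
    by (rule finite_subset[OF assms(4)]) (use assms in \<open>auto simp: up_eq_finsupp finsupp_funs_iff\<close>)
  then show ?thesis using assms by (auto simp: up_eq_finsupp finsupp_funs_iff)
qed

lemma up_mulr [simp]: "\<lbrakk>f \<in> up R; r \<in> carrier R\<rbrakk> \<Longrightarrow> mulr r f \<in> up R"
  by (rule up_supp_mono[of f f]) (auto simp: supp_def)

lemma up_smult [simp]: "\<lbrakk>f \<in> up R; c \<in> carrier K\<rbrakk> \<Longrightarrow> (\<lambda>n. c \<odot>\<^bsub>R\<^esub> f n) \<in> up R"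
  by (rule up_supp_mono[of f f]) (auto simp: supp_def)

lemma up_shift [simp]: "f \<in> up R \<Longrightarrow> shift f \<in> up R"
proof (rule up_supp_mono[of f f])
  assume f: "f \<in> up R"
  show "supp R (shift f) \<subseteq> supp R f \<union> Suc ` supp R f"
  proof
    fix n assume "n \<in> supp R (shift f)"
    then show "n \<in> supp R f \<union> Suc ` supp R f"
      by (cases n) (auto simp: supp_def ore_shift_def image_iff split: if_splits)
  qed
qed (auto simp: ore_shift_def)

lemma up_shift_pow [simp]: "f \<in> up R \<Longrightarrow> (shift ^^ j) f \<in> up R"
  by (induction j) auto

lemma up_induct [consumes 1, case_names single add]:
  assumes "f \<in> up R"
    and "\<And>n r. r \<in> carrier R \<Longrightarrow> P (single R n r)"
    and "\<And>f h. \<lbrakk>f \<in> up R; h \<in> up R; P f; P h\<rbrakk> \<Longrightarrow> P (\<lambda>n. f n \<oplus>\<^bsub>R\<^esub> h n)"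
  shows "P f"
  using A.ring_axioms N.M.monoid_axioms assms unfolding up_eq_finsupp by (rule finsupp_induct) auto

lemma shift_add:
  assumes "f \<in> up R" "h \<in> up R"
  shows "shift (\<lambda>n. f n \<oplus>\<^bsub>R\<^esub> h n) = (\<lambda>n. shift f n \<oplus>\<^bsub>R\<^esub> shift h n)"
  using assms by (auto simp: ore_shift_def \<delta>_add A.a_ac fun_eq_iff)

lemma shift_pow_add:
  assumes "f \<in> up R" "h \<in> up R"
  shows "(shift ^^ j) (\<lambda>n. f n \<oplus>\<^bsub>R\<^esub> h n) = (\<lambda>n. (shift ^^ j) f n \<oplus>\<^bsub>R\<^esub> (shift ^^ j) h n)"
  using assms by (induction j) (simp_all add: shift_add)

lemma shift_smult:
  assumes "f \<in> up R" "c \<in> carrier K"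
  shows "shift (\<lambda>n. c \<odot>\<^bsub>R\<^esub> f n) = (\<lambda>n. c \<odot>\<^bsub>R\<^esub> shift f n)"
  using assms by (auto simp: ore_shift_def \<delta>_smult smult_r_distr fun_eq_iff)

lemma shift_pow_smult:
  assumes "f \<in> up R" "c \<in> carrier K"
  shows "(shift ^^ j) (\<lambda>n. c \<odot>\<^bsub>R\<^esub> f n) = (\<lambda>n. c \<odot>\<^bsub>R\<^esub> (shift ^^ j) f n)"
  using assms by (induction j) (simp_all add: shift_smult)

text \<open>The Leibniz rule, applied to each coefficient, produces the extra term. This is where
  associativity of the Ore extension rests on it.\<close>

lemma shift_mulr:
  assumes "f \<in> up R" "r \<in> carrier R"
  shows "shift (mulr r f) = (\<lambda>n. shift f n \<otimes>\<^bsub>R\<^esub> r \<oplus>\<^bsub>R\<^esub> f n \<otimes>\<^bsub>R\<^esub> \<delta> r)"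
  using assms by (auto simp: ore_shift_def \<delta>_mult A.l_distr A.a_ac fun_eq_iff)

lemma shift_single:
  assumes "r \<in> carrier R"
  shows "shift (single R n r) = (\<lambda>m. single R (Suc n) r m \<oplus>\<^bsub>R\<^esub> single R n (\<delta> r) m)"
  using assms by (auto simp: ore_shift_def single_def fun_eq_iff)

lemma mulr_single: "\<lbrakk>r \<in> carrier R; s \<in> carrier R\<rbrakk> \<Longrightarrow> mulr r (single R n s) = single R n (s \<otimes>\<^bsub>R\<^esub> r)"
  by (auto simp: single_def)

lemma mulr_add:
  "\<lbrakk>f \<in> up R; h \<in> up R; r \<in> carrier R\<rbrakk> \<Longrightarrow>
    mulr r (\<lambda>n. f n \<oplus>\<^bsub>R\<^esub> h n) = (\<lambda>n. mulr r f n \<oplus>\<^bsub>R\<^esub> mulr r h n)"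
  by (auto simp: A.l_distr)

text \<open>Since \<delta>(1) = 0, shifting a monomial with coefficient 1 leaves no lower
  term.\<close>

lemma shift_pow_one: "(shift ^^ j) (emb \<one>\<^bsub>R\<^esub>) = single R j \<one>\<^bsub>R\<^esub>"
proof (induction j)
  case (Suc j)
  then show ?case by (simp add: shift_single) (auto simp: single_def)
qed simp

lemma ore_simps:
  "carrier Ore = up R" "\<one>\<^bsub>Ore\<^esub> = emb \<one>\<^bsub>R\<^esub>" "\<zero>\<^bsub>Ore\<^esub> = (\<lambda>n. \<zero>\<^bsub>R\<^esub>)"
  "\<lbrakk>f \<in> up R; h \<in> up R\<rbrakk> \<Longrightarrow> f \<oplus>\<^bsub>Ore\<^esub> h = (\<lambda>n. f n \<oplus>\<^bsub>R\<^esub> h n)"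
  "c \<odot>\<^bsub>Ore\<^esub> f = (\<lambda>n. c \<odot>\<^bsub>R\<^esub> f n)"
  by (auto simp: ore_extension_def UP_def single_def)

lemma ore_mult: "(f \<otimes>\<^bsub>Ore\<^esub> h) n = (\<Oplus>\<^bsub>R\<^esub>j\<in>supp R h. (shift ^^ j) f n \<otimes>\<^bsub>R\<^esub> h j)"
  by (simp add: ore_extension_def)

text \<open>Multiplying by y^j r on the right means multiplying j times by y and once by r.
  Additivity in the right factor reduces other products to this case.\<close>

lemma ore_mult_single:
  assumes "f \<in> up R" "r \<in> carrier R"
  shows "f \<otimes>\<^bsub>Ore\<^esub> single R j r = mulr r ((shift ^^ j) f)"
proof
  fix n
  show "(f \<otimes>\<^bsub>Ore\<^esub> single R j r) n = mulr r ((shift ^^ j) f) n"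
    unfolding ore_mult
    by (rule finsum_single(2)[where M = nat_monoid and t = "\<lambda>j c. (shift ^^ j) f n \<otimes>\<^bsub>R\<^esub> c",
          OF A.ring_axioms A.abelian_monoid_axioms]) (use assms in auto)
qed

lemma ore_mult_add_right:
  assumes "f \<in> up R" "g \<in> up R" "h \<in> up R"
  shows "f \<otimes>\<^bsub>Ore\<^esub> (\<lambda>n. g n \<oplus>\<^bsub>R\<^esub> h n) = (\<lambda>n. (f \<otimes>\<^bsub>Ore\<^esub> g) n \<oplus>\<^bsub>R\<^esub> (f \<otimes>\<^bsub>Ore\<^esub> h) n)"
proof
  fix n
  show "(f \<otimes>\<^bsub>Ore\<^esub> (\<lambda>n. g n \<oplus>\<^bsub>R\<^esub> h n)) n = (f \<otimes>\<^bsub>Ore\<^esub> g) n \<oplus>\<^bsub>R\<^esub> (f \<otimes>\<^bsub>Ore\<^esub> h) n"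
    unfolding ore_mult
    by (rule finsum_finsupp_add(2)[where M = nat_monoid and t = "\<lambda>j c. (shift ^^ j) f n \<otimes>\<^bsub>R\<^esub> c",
          OF A.ring_axioms A.abelian_monoid_axioms])
      (use assms in \<open>auto simp: A.r_distr up_eq_finsupp[symmetric]\<close>)
qed

lemma ore_mult_closed:
  assumes f: "f \<in> up R" and h: "h \<in> up R"
  shows "f \<otimes>\<^bsub>Ore\<^esub> h \<in> up R"
  using h by (induction rule: up_induct) (simp_all add: f ore_mult_single ore_mult_add_right)

lemma ore_mult_add_left:
  assumes f: "f \<in> up R" and g: "g \<in> up R" and h: "h \<in> up R"
  shows "(\<lambda>n. f n \<oplus>\<^bsub>R\<^esub> g n) \<otimes>\<^bsub>Ore\<^esub> h = (\<lambda>n. (f \<otimes>\<^bsub>Ore\<^esub> h) n \<oplus>\<^bsub>R\<^esub> (g \<otimes>\<^bsub>Ore\<^esub> h) n)"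
  using h
proof (induction rule: up_induct)
  case (single n r)
  then show ?case using f g by (simp add: ore_mult_single shift_pow_add A.l_distr)
next
  case (add h h')
  then show ?case
    using f g ore_mult_closed by (simp add: ore_mult_add_right A.a_ac)
qed

text \<open>Every right multiplication is a sum of composites of right multiplications by \<open>y\<close>
  (\<open>shift\<close>) and by elements of \<open>R\<close> (\<open>mulr\<close>), so associativity reduces to these two.\<close>

lemma ore_mult_mulr:
  assumes f: "f \<in> up R" and h: "h \<in> up R" and r: "r \<in> carrier R"
  shows "f \<otimes>\<^bsub>Ore\<^esub> mulr r h = mulr r (f \<otimes>\<^bsub>Ore\<^esub> h)"
  using h
proof (induction rule: up_induct)
  case (single n s)
  then show ?case using f r by (simp add: mulr_single ore_mult_single A.m_assoc)
next
  case (add h h')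
  then show ?case
    using f r ore_mult_closed by (simp add: ore_mult_add_right mulr_add)
qed

text \<open>For h = y^n s the product h y is y^(n+1) s + y^n \<delta>(s). Multiplying f by these two
  terms gives what \<open>shift_mulr\<close> yields on the other side.\<close>

lemma ore_mult_shift:
  assumes f: "f \<in> up R" and h: "h \<in> up R"
  shows "f \<otimes>\<^bsub>Ore\<^esub> shift h = shift (f \<otimes>\<^bsub>Ore\<^esub> h)"
  using h
proof (induction rule: up_induct)
  case (single n s)
  then show ?case
    using f by (simp add: shift_single ore_mult_single ore_mult_add_right shift_mulr)
next
  case (add h h')
  then show ?case
    using f ore_mult_closed by (simp add: ore_mult_add_right shift_add)
qed

lemma ore_mult_assoc:
  assumes f: "f \<in> up R" and g: "g \<in> up R" and h: "h \<in> up R"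
  shows "(f \<otimes>\<^bsub>Ore\<^esub> g) \<otimes>\<^bsub>Ore\<^esub> h = f \<otimes>\<^bsub>Ore\<^esub> (g \<otimes>\<^bsub>Ore\<^esub> h)"
  using h
proof (induction rule: up_induct)
  case (single j r)
  have "(shift ^^ j) (f \<otimes>\<^bsub>Ore\<^esub> g) = f \<otimes>\<^bsub>Ore\<^esub> (shift ^^ j) g"
    using f g by (induction j) (simp_all add: ore_mult_shift)
  then show ?case
    using f g single ore_mult_closed by (simp add: ore_mult_single ore_mult_mulr)
next
  case (add h h')
  then show ?case
    using f g ore_mult_closed by (simp add: ore_mult_add_right)
qed

lemma ore_one_mult:
  assumes "f \<in> up R"
  shows "emb \<one>\<^bsub>R\<^esub> \<otimes>\<^bsub>Ore\<^esub> f = f"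
  using assms
proof (induction rule: up_induct)
  case (single j r)
  then show ?case by (simp add: ore_mult_single shift_pow_one mulr_single)
qed (simp add: ore_mult_add_right)

lemma ore_mult_smult_left:
  assumes f: "f \<in> up R" and h: "h \<in> up R" and c: "c \<in> carrier K"
  shows "(\<lambda>n. c \<odot>\<^bsub>R\<^esub> f n) \<otimes>\<^bsub>Ore\<^esub> h = (\<lambda>n. c \<odot>\<^bsub>R\<^esub> (f \<otimes>\<^bsub>Ore\<^esub> h) n)"
  using h
proof (induction rule: up_induct)
  case (single j r)
  then show ?case using f c by (simp add: ore_mult_single shift_pow_smult smult_mult_left)
next
  case (add h h')
  then show ?case
    using f c ore_mult_closed by (simp add: ore_mult_add_right smult_r_distr)
qed

text \<open>The scalar c acts on coefficients as right multiplication by c 1 in R, so this is an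
  instance of \<open>ore_mult_mulr\<close>.\<close>

lemma ore_mult_smult_right:
  assumes f: "f \<in> up R" and h: "h \<in> up R" and c: "c \<in> carrier K"
  shows "f \<otimes>\<^bsub>Ore\<^esub> (\<lambda>n. c \<odot>\<^bsub>R\<^esub> h n) = (\<lambda>n. c \<odot>\<^bsub>R\<^esub> (f \<otimes>\<^bsub>Ore\<^esub> h) n)"
proof -
  have "(\<lambda>n. c \<odot>\<^bsub>R\<^esub> g n) = mulr (c \<odot>\<^bsub>R\<^esub> \<one>\<^bsub>R\<^esub>) g" if "g \<in> up R" for g :: "nat \<Rightarrow> 'a"
    using that c by (simp add: scalar_mult)
  then show ?thesis
    using f h c ore_mult_closed by (simp add: ore_mult_mulr)
qed

lemma ore_kalgebra: "kalgebra K Ore"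
proof -
  have "abelian_group Ore"
  proof (rule abelian_groupI)
    fix f assume f: "f \<in> carrier Ore"
    have "(\<lambda>n. \<ominus>\<^bsub>R\<^esub> f n) \<in> up R"
      by (rule up_supp_mono[of f f]) (use f in \<open>auto simp: supp_def ore_simps\<close>)
    then show "\<exists>h\<in>carrier Ore. h \<oplus>\<^bsub>Ore\<^esub> f = \<zero>\<^bsub>Ore\<^esub>"
      using f by (intro bexI[of _ "\<lambda>n. \<ominus>\<^bsub>R\<^esub> f n"]) (auto simp: ore_simps A.l_neg)
  qed (auto simp: ore_simps A.a_ac)
  then have "ring Ore"
    by (intro ringI monoidI)
      (auto simp: ore_simps ore_mult_closed ore_mult_assoc ore_one_mult ore_mult_add_left
        ore_mult_add_right ore_mult_single)
  then show ?thesis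
    by (intro kalgebra.intro kalgebra_axioms.intro K.is_cring)
      (auto simp: ore_simps ore_mult_closed smult_l_distr smult_r_distr smult_assoc
        ore_mult_smult_left ore_mult_smult_right)
qed

sublocale Ore: kalgebra K Ore
  by (rule ore_kalgebra)

lemma emb_hom: "(\<lambda>a. emb a) \<in> alg_hom K R Ore"
  by (rule alg_homI) (auto simp: ore_simps ore_mult_single mulr_single, auto simp: single_def)

lemma emb_Y:
  assumes "a \<in> carrier R"
  shows "emb a \<otimes>\<^bsub>Ore\<^esub> Y = Y \<otimes>\<^bsub>Ore\<^esub> emb a \<oplus>\<^bsub>Ore\<^esub> emb (\<delta> a)"
  using assms by (simp add: ore_simps ore_mult_single shift_single mulr_single)

lemma Y_closed: "Y \<in> carrier Ore"
  by (simp add: ore_simps)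

lemma Y_pow: "Y [^]\<^bsub>Ore\<^esub> (n :: nat) = single R n \<one>\<^bsub>R\<^esub>"
proof (induction n)
  case (Suc n)
  then show ?case
    by (simp add: ore_mult_single shift_single) (auto simp: single_def)
qed (simp add: ore_simps)

lemma ore_span:
  assumes R: "carrier R \<subseteq> alg_span K R U" "U \<subseteq> carrier R"
    and U: "\<And>u. u \<in> U \<Longrightarrow> emb u \<in> alg_span K Ore V" and Y: "Y \<in> alg_span K Ore V"
  shows "carrier Ore \<subseteq> alg_span K Ore V"
proof
  fix f assume "f \<in> carrier Ore"
  then have "f \<in> up R" by (simp add: ore_simps)
  then show "f \<in> alg_span K Ore V"
  proof (induction rule: up_induct)
    case (single n r)
    have "Y [^]\<^bsub>Ore\<^esub> n \<otimes>\<^bsub>Ore\<^esub> emb r \<in> alg_span K Ore V"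
      by (intro span_mult alg_span_pow Y alg_hom_span[OF kalgebra_axioms emb_hom R])
        (use U single in auto)
    then show ?case using single by (simp add: Y_pow ore_mult_single mulr_single)
  next
    case (add f h)
    then show ?case using span_add[of f K Ore V h] by (simp add: ore_simps)
  qed
qed

text \<open>The only possible map sends y^n r to b^n \<rho>(r). For multiplicativity it is enough
  that \<psi> turns \<open>mulr\<close> and \<open>shift\<close> into right multiplication by
  \<rho>(r) and by b, since every product is a sum of composites of these.\<close>

lemma ore_lift_exists:
  fixes B :: "('k, 'b, 'f) module_scheme"
  assumes B: "kalgebra K B" and f: "\<rho> \<in> alg_hom K R B" and b: "b \<in> carrier B"
    and comm: "\<And>a. a \<in> carrier R \<Longrightarrow> \<rho> a \<otimes>\<^bsub>B\<^esub> b = b \<otimes>\<^bsub>B\<^esub> \<rho> a \<oplus>\<^bsub>B\<^esub> \<rho> (\<delta> a)"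
  obtains \<psi> where "\<psi> \<in> alg_hom K Ore B" and "\<And>a. a \<in> carrier R \<Longrightarrow> \<psi> (emb a) = \<rho> a"
    and "\<psi> Y = b"
proof -
  interpret B: kalgebra K B by fact
  note rho [simp] = alg_hom_closed[OF f] alg_hom_zero[OF kalgebra_axioms B f]
  define \<psi> :: "(nat \<Rightarrow> 'a) \<Rightarrow> 'b" where "\<psi> h = (\<Oplus>\<^bsub>B\<^esub>n\<in>supp R h. b [^]\<^bsub>B\<^esub> n \<otimes>\<^bsub>B\<^esub> \<rho> (h n))" for h
  have psi_single: "\<psi> (single R n r) = b [^]\<^bsub>B\<^esub> n \<otimes>\<^bsub>B\<^esub> \<rho> r" if "r \<in> carrier R" for n r
    unfolding \<psi>_def
    by (rule finsum_single(2)[where M = nat_monoid and t = "\<lambda>(n :: nat) c. b [^]\<^bsub>B\<^esub> n \<otimes>\<^bsub>B\<^esub> \<rho> c",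
          OF A.ring_axioms B.A.abelian_monoid_axioms]) (use that b in auto)
  have psi_add: "\<psi> (\<lambda>n. g n \<oplus>\<^bsub>R\<^esub> h n) = \<psi> g \<oplus>\<^bsub>B\<^esub> \<psi> h" if "g \<in> up R" "h \<in> up R" for g h
    unfolding \<psi>_def
    by (rule finsum_finsupp_add(2)[where M = nat_monoid and t = "\<lambda>(n :: nat) c. b [^]\<^bsub>B\<^esub> n \<otimes>\<^bsub>B\<^esub> \<rho> c",
          OF A.ring_axioms B.A.abelian_monoid_axioms])
      (use that b in \<open>auto simp: up_eq_finsupp alg_hom_add[OF f] B.A.r_distr\<close>)
  have closed [simp]: "\<psi> h \<in> carrier B" if "h \<in> up R" for h
    using that by (induction rule: up_induct) (auto simp: psi_single psi_add b)
  have mulr: "\<psi> (mulr r h) = \<psi> h \<otimes>\<^bsub>B\<^esub> \<rho> r" if "h \<in> up R" "r \<in> carrier R" for h r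
    using that(1)
  proof (induction rule: up_induct)
    case (single n s)
    then show ?case
      using that b by (simp add: mulr_single psi_single
          alg_hom_mult[OF f] B.A.m_assoc)
  next
    case (add g h)
    then show ?case
      using that by (simp add: mulr_add B.A.l_distr
          psi_add)
  qed
  \<comment> \<open>The hypothesis \<open>comm\<close> enters here: moving b past \<rho>(s) creates
    the term \<rho>(\<delta> s) that \<open>shift\<close> puts into degree n.\<close>
  have shift: "\<psi> (shift h) = \<psi> h \<otimes>\<^bsub>B\<^esub> b" if "h \<in> up R" for h
    using that
  proof (induction rule: up_induct)
    case (single n s)
    have "b [^]\<^bsub>B\<^esub> n \<otimes>\<^bsub>B\<^esub> \<rho> s \<otimes>\<^bsub>B\<^esub> b = b [^]\<^bsub>B\<^esub> n \<otimes>\<^bsub>B\<^esub> (b \<otimes>\<^bsub>B\<^esub> \<rho> s \<oplus>\<^bsub>B\<^esub> \<rho> (\<delta> s))"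
      using single b by (simp add: B.A.m_assoc comm)
    then show ?case
      using single b by (simp add: shift_single psi_single
          psi_add B.A.r_distr B.A.m_assoc)
  next
    case (add g h)
    then show ?case
      using b by (simp add: shift_add B.A.l_distr
          psi_add)
  qed
  have shift_pow: "\<psi> ((shift ^^ j) h) = \<psi> h \<otimes>\<^bsub>B\<^esub> b [^]\<^bsub>B\<^esub> j" if "h \<in> up R" for h j
    using that b by (induction j) (simp_all add: shift B.A.m_assoc)
  have mult: "\<psi> (g \<otimes>\<^bsub>Ore\<^esub> h) = \<psi> g \<otimes>\<^bsub>B\<^esub> \<psi> h" if g: "g \<in> up R" and h: "h \<in> up R" for g h
    using h
  proof (induction rule: up_induct)
    case (single n s)
    then show ?case
      using g b by (simp add: ore_mult_single mulr shift_pow B.A.m_assoc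
          psi_single)
  next
    case (add h h')
    then show ?case
      using g ore_mult_closed by (simp add: ore_mult_add_right B.A.r_distr
          psi_add)
  qed
  have smult: "\<psi> (\<lambda>n. c \<odot>\<^bsub>R\<^esub> h n) = c \<odot>\<^bsub>B\<^esub> \<psi> h" if h: "h \<in> up R" and c: "c \<in> carrier K" for h c
  proof -
    have "(\<lambda>n. c \<odot>\<^bsub>R\<^esub> h n) = mulr (c \<odot>\<^bsub>R\<^esub> \<one>\<^bsub>R\<^esub>) h"
      using h c by (simp add: scalar_mult)
    then show ?thesis
      using h c by (simp add: mulr alg_hom_smult[OF f] alg_hom_one[OF f] B.scalar_mult)
  qed
  show ?thesis
  proof
    show "\<psi> \<in> alg_hom K Ore B"
      by (rule alg_homI)
        (auto simp: ore_simps psi_add mult smult psi_single alg_hom_one[OF f])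
    show "\<psi> (emb a) = \<rho> a" if "a \<in> carrier R" for a using that by (simp add: psi_single)
    show "\<psi> Y = b" using b by (simp add: psi_single alg_hom_one[OF f])
  qed
qed

end

section \<open>The cyclic group and its action\<close>

text \<open>The index of a product in the cyclic group is reduced modulo p, while the action needs
  the plain sum of exponents as a scalar; in characteristic p the two scalars agree.\<close>

lemma has_characteristic_mod:
  assumes "cring K" and "has_characteristic K p"
  shows "[(n mod p)] \<cdot>\<^bsub>K\<^esub> \<one>\<^bsub>K\<^esub> = [(n :: nat)] \<cdot>\<^bsub>K\<^esub> \<one>\<^bsub>K\<^esub>"
proof -
  interpret cring K by fact
  have "[n] \<cdot>\<^bsub>K\<^esub> \<one>\<^bsub>K\<^esub> = [(p * (n div p) + n mod p)] \<cdot>\<^bsub>K\<^esub> \<one>\<^bsub>K\<^esub>" by simp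
  also have "\<dots> = [(p * (n div p))] \<cdot>\<^bsub>K\<^esub> \<one>\<^bsub>K\<^esub> \<oplus>\<^bsub>K\<^esub> [(n mod p)] \<cdot>\<^bsub>K\<^esub> \<one>\<^bsub>K\<^esub>"
    by (rule add.nat_pow_mult[symmetric]) simp
  also have "[(p * (n div p))] \<cdot>\<^bsub>K\<^esub> \<one>\<^bsub>K\<^esub> = \<zero>\<^bsub>K\<^esub>"
    using assms(2) dvd_triv_left[of p "n div p"] unfolding has_characteristic_def by blast
  finally show ?thesis by simp
qed

definition transvection :: "int \<Rightarrow> mat2"
  where "transvection i = (1, i, 0, 1)"

text \<open>On the cyclic group this is the exponent n < p with s = g^n.\<close>

definition transvection_index :: "mat2 \<Rightarrow> nat"
  where "transvection_index s = (case s of (a, b, c, d) \<Rightarrow> nat b)"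

lemma transvection_index [simp]: "transvection_index (transvection i) = nat i"
  by (simp add: transvection_index_def transvection_def)

lemma g_mat_eq: "g_mat = transvection 1"
  by (simp add: g_mat_def transvection_def)

text \<open>The images of the letters under g^n: iterating y \<mapsto> x + y adds x n times. The
  multiple is written as a scalar of K so that linearity of homomorphisms applies to it.\<close>

definition shear :: "('k, 'c) ring_scheme \<Rightarrow> nat \<Rightarrow> letter \<Rightarrow> letter list \<Rightarrow> 'k"
  where "shear K n l = (case l of LX \<Rightarrow> gen K LX
    | LY \<Rightarrow> ([n] \<cdot>\<^bsub>K\<^esub> \<one>\<^bsub>K\<^esub>) \<odot>\<^bsub>free_algebra K\<^esub> gen K LX \<oplus>\<^bsub>free_algebra K\<^esub> gen K LY)"

lemma shear_closed:
  assumes "cring K"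
  shows "shear K n l \<in> carrier (free_algebra K)"
proof -
  interpret F: kalgebra K "free_algebra K" by (rule free_algebra_kalgebra) fact
  show ?thesis using gen_closed[OF assms] by (cases l) (auto simp: shear_def)
qed

context
  fixes p :: nat
  assumes p: "p > 1"
begin

lemma SL2_mult_transvection:
  "transvection i \<otimes>\<^bsub>SL2 (residue_ring (int p))\<^esub> transvection j = transvection ((i + j) mod int p)"
  using p by (simp add: SL2_def transvection_def residue_ring_def mod_add_eq add.commute)

lemma transvection_in_SL2:
  assumes "i \<in> {0..<int p}"
  shows "transvection i \<in> carrier (SL2 (residue_ring (int p)))"
proof -
  have "residues (int p)" by (rule residues.intro) (use p in simp)
  then interpret Z: cring "residue_ring (int p)" by (rule residues.cring)
  have i: "i \<in> carrier (residue_ring (int p))" using assms by (simp add: residue_ring_def)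
  have "\<one>\<^bsub>residue_ring (int p)\<^esub> = 1" "\<zero>\<^bsub>residue_ring (int p)\<^esub> = 0"
    "carrier (residue_ring (int p)) = {0..int p - 1}"
    by (simp_all add: residue_ring_def)
  moreover have "\<one>\<^bsub>residue_ring (int p)\<^esub> \<otimes>\<^bsub>residue_ring (int p)\<^esub> \<one>\<^bsub>residue_ring (int p)\<^esub>
      \<ominus>\<^bsub>residue_ring (int p)\<^esub> i \<otimes>\<^bsub>residue_ring (int p)\<^esub> \<zero>\<^bsub>residue_ring (int p)\<^esub>
      = \<one>\<^bsub>residue_ring (int p)\<^esub>"
    using i by (simp add: a_minus_def)
  ultimately show ?thesis
    using p assms by (simp add: SL2_def transvection_def)
qed

text \<open>Inverses enter through \<open>generate\<close>. The value is found from the definite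
  description itself, by solving g s = 1 entrywise, without appeal to group axioms for
  \<open>SL2\<close>.\<close>

lemma SL2_inv_g_mat:
  "inv\<^bsub>SL2 (residue_ring (int p))\<^esub> g_mat = transvection (int p - 1)"
  unfolding m_inv_def
proof (rule the_equality)
  let ?S = "SL2 (residue_ring (int p))"
  show "transvection (int p - 1) \<in> carrier ?S \<and> g_mat \<otimes>\<^bsub>?S\<^esub> transvection (int p - 1) = \<one>\<^bsub>?S\<^esub>
    \<and> transvection (int p - 1) \<otimes>\<^bsub>?S\<^esub> g_mat = \<one>\<^bsub>?S\<^esub>"
    using p by (simp add: transvection_in_SL2 g_mat_eq SL2_mult_transvection)
      (simp add: SL2_def transvection_def residue_ring_def)
next
  let ?S = "SL2 (residue_ring (int p))"
  fix s assume s: "s \<in> carrier ?S \<and> g_mat \<otimes>\<^bsub>?S\<^esub> s = \<one>\<^bsub>?S\<^esub> \<and> s \<otimes>\<^bsub>?S\<^esub> g_mat = \<one>\<^bsub>?S\<^esub>"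
  obtain a b c d where abcd: "s = (a, b, c, d)" by (cases s)
  from s have "s \<in> carrier ?S" and eq: "g_mat \<otimes>\<^bsub>?S\<^esub> s = \<one>\<^bsub>?S\<^esub>" by blast+
  have "{a, b, c, d} \<subseteq> carrier (residue_ring (int p))"
    using \<open>s \<in> carrier ?S\<close> unfolding abcd SL2_def partial_object.simps by blast
  then have rng: "0 \<le> a" "a < int p" "0 \<le> b" "b < int p" "0 \<le> c" "c < int p" "0 \<le> d" "d < int p"
    by (simp_all add: residue_ring_def)
  have gs: "g_mat \<otimes>\<^bsub>?S\<^esub> s = ((a + c) mod int p, (b + d) mod int p, c, d)"
    using rng by (simp add: abcd SL2_def residue_ring_def g_mat_def)
  have one: "\<one>\<^bsub>?S\<^esub> = (1, 0, 0, 1)"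
    by (simp add: SL2_def residue_ring_def)
  have "((a + c) mod int p, (b + d) mod int p, c, d) = (1, 0, 0, 1)"
    using eq unfolding gs one .
  then have cd: "c = 0" "d = 1" and ab: "(a + c) mod int p = 1" "(b + d) mod int p = 0"
    by blast+
  have "a = 1" "(b + 1) mod int p = 0" using ab rng unfolding cd by simp_all
  \<comment> \<open>In the range 0 \<le> b < p the residue of b + 1 vanishes only for b + 1 =
    p.\<close>
  moreover have "b = int p - 1"
    using rng calculation(2) mod_pos_pos_trivial[of "b + 1" "int p"] by linarith
  ultimately show "s = transvection (int p - 1)"
    by (simp add: abcd transvection_def cd)
qed

text \<open>Products of transvections add the entries modulo p and the inverse of g is again one, so
  nothing else is generated; conversely the n-th transvection is reached by n multiplications by
  g.\<close>

lemma cyc_group_carrier: "carrier (cyc_group p) = transvection ` {0..<int p}"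
proof -
  let ?S = "SL2 (residue_ring (int p))"
  have g: "g_mat \<in> carrier ?S"
    unfolding g_mat_eq by (rule transvection_in_SL2) (use p in auto)
  have one: "\<one>\<^bsub>?S\<^esub> = transvection 0"
    by (simp add: SL2_def transvection_def residue_ring_def)
  have "generate ?S {g_mat} = transvection ` {0..<int p}"
  proof (intro equalityI subsetI)
    fix s assume "s \<in> generate ?S {g_mat}"
    then show "s \<in> transvection ` {0..<int p}"
    proof induction
      case one
      then show ?case using p \<open>\<one>\<^bsub>?S\<^esub> = transvection 0\<close> by auto
    next
      case (incl h)
      then show ?case using p by (auto simp: g_mat_eq)
    next
      case (inv h)
      then show ?case using p SL2_inv_g_mat by auto
    next
      case (eng s t)
      then show ?case using p by (auto simp: SL2_mult_transvection)
    qed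
  next
    fix s assume "s \<in> transvection ` {0..<int p}"
    then obtain i where i: "s = transvection i" "0 \<le> i" "i < int p" by auto
    have "transvection (int n) \<in> generate ?S {g_mat}" if "n < p" for n
      using that
    proof (induction n)
      case 0
      then show ?case using generate.one[of ?S "{g_mat}"] one by simp
    next
      case (Suc n)
      then have "transvection (int n) \<otimes>\<^bsub>?S\<^esub> g_mat \<in> generate ?S {g_mat}"
        by (auto intro: generate.eng[OF _ generate.incl])
      then show ?case
        using Suc by (simp add: g_mat_eq SL2_mult_transvection add.commute)
    qed
    from this[of "nat i"] show "s \<in> generate ?S {g_mat}" using i by auto
  qed
  then show ?thesis
    using g by (simp add: cyc_group_def carrier_subgroup_generated)
qed

lemma cyc_group_simps:
  "transvection i \<otimes>\<^bsub>cyc_group p\<^esub> transvection j = transvection ((i + j) mod int p)"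
  "\<one>\<^bsub>cyc_group p\<^esub> = transvection 0"
proof -
  show "transvection i \<otimes>\<^bsub>cyc_group p\<^esub> transvection j = transvection ((i + j) mod int p)"
    using SL2_mult_transvection by (simp add: cyc_group_def subgroup_generated_def)
  show "\<one>\<^bsub>cyc_group p\<^esub> = transvection 0"
    by (simp add: cyc_group_def subgroup_generated_def SL2_def transvection_def residue_ring_def)
qed

lemma cyc_group_comm_monoid: "comm_monoid (cyc_group p)"
  by (rule comm_monoidI)
    (use p in \<open>auto simp: cyc_group_carrier cyc_group_simps mod_simps ac_simps\<close>)

lemma cyc_group_index:
  assumes "s \<in> carrier (cyc_group p)"
  shows "s = transvection (int (transvection_index s))" and "transvection_index s < p"
  using assms by (auto simp: cyc_group_carrier)

lemma cyc_group_index_mult: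
  assumes "s \<in> carrier (cyc_group p)" "t \<in> carrier (cyc_group p)"
  shows "transvection_index (s \<otimes>\<^bsub>cyc_group p\<^esub> t)
    = (transvection_index s + transvection_index t) mod p"
  using assms p by (auto simp: cyc_group_carrier cyc_group_simps nat_mod_distrib nat_add_distrib)

lemma g_mat_closed: "g_mat \<in> carrier (cyc_group p)"
  using p by (auto simp: cyc_group_carrier g_mat_eq)

lemma g_mat_pow: "g_mat [^]\<^bsub>cyc_group p\<^esub> (n :: nat) = transvection (int n mod int p)"
proof -
  interpret comm_monoid "cyc_group p" by (rule cyc_group_comm_monoid)
  show ?thesis
    by (induction n) (auto simp: cyc_group_simps g_mat_eq mod_simps add.commute)
qed

lemma cyc_group_eq_pow:
  assumes "s \<in> carrier (cyc_group p)"
  shows "s = g_mat [^]\<^bsub>cyc_group p\<^esub> transvection_index s"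
  using assms by (auto simp: g_mat_pow cyc_group_carrier)

text \<open>The index of s t is a sum reduced modulo p, and u^p = 1 makes powers of u insensitive to
  the reduction. Such a u therefore represents the cyclic group in B, the input for lifts out of the
  group algebra and out of the smash product.\<close>

lemma cyc_group_hom:
  assumes "monoid B" and u: "u \<in> carrier B" and up: "u [^]\<^bsub>B\<^esub> p = \<one>\<^bsub>B\<^esub>"
    and "s \<in> carrier (cyc_group p)" "t \<in> carrier (cyc_group p)"
  shows "u [^]\<^bsub>B\<^esub> transvection_index (s \<otimes>\<^bsub>cyc_group p\<^esub> t)
    = u [^]\<^bsub>B\<^esub> transvection_index s \<otimes>\<^bsub>B\<^esub> u [^]\<^bsub>B\<^esub> transvection_index t"
proof -
  interpret B: monoid B by fact
  have "u [^]\<^bsub>B\<^esub> (n mod p) = u [^]\<^bsub>B\<^esub> n" for n :: nat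
  proof -
    have "u [^]\<^bsub>B\<^esub> n = u [^]\<^bsub>B\<^esub> (p * (n div p)) \<otimes>\<^bsub>B\<^esub> u [^]\<^bsub>B\<^esub> (n mod p)"
      using u by (simp add: B.nat_pow_mult)
    also have "u [^]\<^bsub>B\<^esub> (p * (n div p)) = \<one>\<^bsub>B\<^esub>"
      using u by (simp add: up flip: B.nat_pow_pow)
    finally show ?thesis using u by simp
  qed
  then show ?thesis using assms by (simp add: cyc_group_index_mult B.nat_pow_mult)
qed

section \<open>The group algebra, generated by g with g^p = 1\<close>

lemma group_algebra_monoid_alg:
  assumes "cring K"
  shows "monoid_alg K (cyc_group p)"
  using assms cyc_group_comm_monoid by (auto intro!: monoid_alg.intro comm_monoid.axioms)

lemma group_algebra_kalgebra:
  assumes "cring K"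
  shows "kalgebra K (group_algebra K p)" "cring (group_algebra K p)"
  unfolding group_algebra_def
  using monoid_alg.monoid_algebra_kalgebra[OF group_algebra_monoid_alg[OF assms]]
    monoid_alg.monoid_algebra_comm[OF group_algebra_monoid_alg[OF assms] cyc_group_comm_monoid]
  by auto

lemma group_algebra_single:
  assumes "cring K" and "s \<in> carrier (cyc_group p)"
  shows "single K s \<one>\<^bsub>K\<^esub> = single K g_mat \<one>\<^bsub>K\<^esub> [^]\<^bsub>group_algebra K p\<^esub> transvection_index s"
  unfolding group_algebra_def
  using monoid_alg.single_pow[OF group_algebra_monoid_alg[OF assms(1)] g_mat_closed]
    cyc_group_eq_pow[OF assms(2)] by simp

lemma group_algebra_g_closed:
  assumes "cring K"
  shows "single K g_mat \<one>\<^bsub>K\<^esub> \<in> carrier (group_algebra K p)"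
proof -
  interpret monoid_alg K "cyc_group p" by (rule group_algebra_monoid_alg) fact
  show ?thesis by (simp add: group_algebra_def single_closed g_mat_closed)
qed

lemma group_algebra_g_pow:
  assumes "cring K"
  shows "single K g_mat \<one>\<^bsub>K\<^esub> [^]\<^bsub>group_algebra K p\<^esub> p = \<one>\<^bsub>group_algebra K p\<^esub>"
  unfolding group_algebra_def
  using monoid_alg.single_pow[OF group_algebra_monoid_alg[OF assms(1)] g_mat_closed, of p]
  by (simp add: g_mat_pow cyc_group_simps)

lemma group_algebra_span:
  assumes "cring K"
  shows "carrier (group_algebra K p) \<subseteq> alg_span K (group_algebra K p) {single K g_mat \<one>\<^bsub>K\<^esub>}"
proof -
  interpret monoid_alg K "cyc_group p" by (rule group_algebra_monoid_alg) fact
  show ?thesis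
    using group_algebra_single[OF assms] monoid_algebra_span
    by (simp add: group_algebra_def alg_span_pow span_incl)
qed

lemma group_algebra_lift_exists:
  assumes B: "kalgebra K B" and u: "u \<in> carrier B" and up: "u [^]\<^bsub>B\<^esub> p = \<one>\<^bsub>B\<^esub>"
  obtains \<psi> where "\<psi> \<in> alg_hom K (group_algebra K p) B" and "\<psi> (single K g_mat \<one>\<^bsub>K\<^esub>) = u"
proof -
  interpret B: kalgebra K B by fact
  interpret monoid_alg K "cyc_group p" by (rule group_algebra_monoid_alg) (rule B.K.is_cring)
  interpret monoid_alg_lift K "cyc_group p" B "\<lambda>s. u [^]\<^bsub>B\<^esub> transvection_index s"
    by (intro monoid_alg_lift.intro monoid_alg_lift_axioms.intro B monoid_alg_axioms)
      (use u in \<open>auto simp: cyc_group_hom[OF B.A.monoid_axioms u up] cyc_group_simps\<close>)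
  show ?thesis
  proof
    show "monoid_lift K B (\<lambda>s. u [^]\<^bsub>B\<^esub> transvection_index s) \<in> alg_hom K (group_algebra K p) B"
      unfolding group_algebra_def by (rule monoid_lift_hom)
    show "monoid_lift K B (\<lambda>s. u [^]\<^bsub>B\<^esub> transvection_index s) (single K g_mat \<one>\<^bsub>K\<^esub>) = u"
      using u by (simp add: monoid_lift_single g_mat_closed) (simp add: g_mat_eq)
  qed
qed

section \<open>The action of the cyclic group on the free algebra\<close>

lemma mat_act_eq_free_lift:
  assumes "cring K" and "s \<in> carrier (cyc_group p)" and "f \<in> carrier (free_algebra K)"
  shows "mat_act K s f = free_lift K (free_algebra K) (shear K (transvection_index s)) f"
proof -
  interpret F: kalgebra K "free_algebra K" by (rule free_algebra_kalgebra) fact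
  let ?F = "free_algebra K" and ?n = "transvection_index s"
  note gen = gen_closed[OF assms(1)]
  \<comment> \<open>\<open>mat_act\<close> takes integer multiples of the matrix entries; the
    entries 1, 0, n, 1 of a transvection turn them into the images prescribed by
    \<open>shear\<close>.\<close>
  have int: "[int n] \<cdot>\<^bsub>?F\<^esub> a = [n] \<cdot>\<^bsub>?F\<^esub> a" for n a
    by (simp add: add_pow_def int_pow_int)
  have "[(1 :: int)] \<cdot>\<^bsub>?F\<^esub> a = a" "[(0 :: int)] \<cdot>\<^bsub>?F\<^esub> a = \<zero>\<^bsub>?F\<^esub>" if "a \<in> carrier ?F" for a
    using int[of 1 a] int[of 0 a] that by simp_all
  then have "mat_act K (transvection (int ?n)) f = substitution K (shear K ?n) f"
    using gen by (auto simp: mat_act_def transvection_def Let_def shear_def int F.add_pow_eq_smult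
        intro!: arg_cong[where f = "\<lambda>\<sigma>. substitution K \<sigma> f"] split: letter.splits)
  then show ?thesis
    using cyc_group_index(1)[OF assms(2)]
      substitution_eq_free_lift[OF assms(1) shear_closed[OF assms(1)] assms(3)] by simp
qed

lemma mat_act_hom:
  assumes "cring K" and "s \<in> carrier (cyc_group p)"
  shows "mat_act K s \<in> alg_hom K (free_algebra K) (free_algebra K)"
  by (rule alg_hom_cong[OF free_algebra_kalgebra[OF assms(1)]
        free_lift_hom[OF free_algebra_kalgebra[OF assms(1)] shear_closed[OF assms(1)]]])
    (simp add: mat_act_eq_free_lift assms)

lemma mat_act_gen:
  assumes "cring K" and "s \<in> carrier (cyc_group p)"
  shows "mat_act K s (gen K l) = shear K (transvection_index s) l"
  using assms gen_closed[OF assms(1)]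
  by (simp add: mat_act_eq_free_lift free_lift_gen free_algebra_kalgebra shear_closed)

text \<open>Both sides of each action law are homomorphisms, so x and y suffice. Only y is moved:
  composing the shears for n and m adds (m + n) x, and the reduction of the index of s t is harmless
  by \<open>has_characteristic_mod\<close>.\<close>

lemma mat_act_crossed:
  assumes K: "cring K" and char: "has_characteristic K p"
  shows "crossed K (free_algebra K) (cyc_group p) (mat_act K)"
proof -
  interpret F: kalgebra K "free_algebra K" by (rule free_algebra_kalgebra) fact
  interpret C: comm_monoid "cyc_group p" by (rule cyc_group_comm_monoid)
  let ?F = "free_algebra K"
  note gen = gen_closed[OF K] and span = free_algebra_span[OF K]
  have range: "range (gen K) \<subseteq> carrier ?F" using gen by auto
  have one_gen: "mat_act K \<one>\<^bsub>cyc_group p\<^esub> (gen K l) = gen K l" for l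
    by (subst mat_act_gen[OF K C.one_closed])
      (cases l, simp_all add: cyc_group_simps shear_def gen)
  have one: "mat_act K \<one>\<^bsub>cyc_group p\<^esub> a = a" if a: "a \<in> carrier ?F" for a
    by (rule alg_hom_agree[OF F.kalgebra_axioms mat_act_hom[OF K C.one_closed] alg_hom_id
          span range _ a]) (auto simp: one_gen)
  have mult: "mat_act K (s \<otimes>\<^bsub>cyc_group p\<^esub> t) a = mat_act K s (mat_act K t a)"
    if s: "s \<in> carrier (cyc_group p)" and t: "t \<in> carrier (cyc_group p)" and a: "a \<in> carrier ?F"
    for s t a
  proof (rule alg_hom_agree[OF F.kalgebra_axioms mat_act_hom[OF K C.m_closed[OF s t]]
        alg_hom_comp[OF mat_act_hom[OF K t] mat_act_hom[OF K s]] span range _ a])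
    fix x assume "x \<in> range (gen K)"
    then obtain l where x: "x = gen K l" by auto
    note hom = alg_homD[OF mat_act_hom[OF K s]]
    show "mat_act K (s \<otimes>\<^bsub>cyc_group p\<^esub> t) x = mat_act K s (mat_act K t x)"
    proof (cases l)
      case LX
      then show ?thesis using s t by (simp add: x mat_act_gen[OF K] shear_def)
    next
      case LY
      let ?m = "transvection_index s" and ?n = "transvection_index t"
      have "[(?m + ?n)] \<cdot>\<^bsub>K\<^esub> \<one>\<^bsub>K\<^esub> = [?n] \<cdot>\<^bsub>K\<^esub> \<one>\<^bsub>K\<^esub> \<oplus>\<^bsub>K\<^esub> [?m] \<cdot>\<^bsub>K\<^esub> \<one>\<^bsub>K\<^esub>"
        by (simp add: F.K.add.nat_pow_mult add.commute)
      then show ?thesis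
        using s t gen LY
        by (simp add: x mat_act_gen[OF K] shear_def hom cyc_group_index_mult
            has_characteristic_mod[OF K char] F.smult_l_distr F.A.a_assoc)
    qed
  qed
  show ?thesis
    by (intro crossed.intro crossed_axioms.intro F.kalgebra_axioms C.monoid_axioms)
      (auto simp: mat_act_hom[OF K] one mult)
qed

end

section \<open>The isomorphism\<close>

locale char_p_setup = K: cring K for K :: "('k, 'c) ring_scheme" +
  fixes p :: nat
  assumes p: "p > 1" and char: "has_characteristic K p"
begin

section \<open>The smash product by generators and relations\<close>

abbreviation F where "F \<equiv> free_algebra K"
abbreviation C where "C \<equiv> cyc_group p"
abbreviation S where "S \<equiv> free_smash K p"
abbreviation GA where "GA \<equiv> group_algebra K p"
abbreviation R where "R \<equiv> R_algebra K p"
abbreviation g where "g \<equiv> single K g_mat \<one>\<^bsub>K\<^esub>"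
abbreviation xS where "xS \<equiv> single F \<one>\<^bsub>C\<^esub> (gen K LX)"
abbreviation yS where "yS \<equiv> single F \<one>\<^bsub>C\<^esub> (gen K LY)"
abbreviation gS where "gS \<equiv> single F g_mat \<one>\<^bsub>F\<^esub>"
abbreviation xR where "xR \<equiv> R_x K p"
abbreviation gR where "gR \<equiv> R_g K p"

sublocale F: kalgebra K F
  by (rule free_algebra_kalgebra) (rule K.is_cring)

sublocale C: comm_monoid C
  by (rule cyc_group_comm_monoid[OF p])

sublocale GA: kalgebra K GA
  by (rule group_algebra_kalgebra(1)[OF p K.is_cring])

sublocale sm: crossed K F C "mat_act K"
  by (rule mat_act_crossed[OF p K.is_cring char])

lemma S_eq: "S = sm.S"
  by (simp add: free_smash_def)

sublocale S: kalgebra K S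
  unfolding S_eq by (rule sm.smash_kalgebra)

lemmas gen_closed [simp] = gen_closed[OF K.is_cring]
lemmas g_mat_closed [simp] = g_mat_closed[OF p]
lemmas g_closed [simp] = group_algebra_g_closed[OF p K.is_cring]

lemma index_g_mat: "transvection_index g_mat = 1"
  by (simp add: g_mat_eq)

lemma index_one: "transvection_index \<one>\<^bsub>C\<^esub> = 0"
  by (simp add: cyc_group_simps[OF p])

lemma S_single_closed: "\<lbrakk>s \<in> carrier C; a \<in> carrier F\<rbrakk> \<Longrightarrow> single F s a \<in> carrier S"
  by (simp add: S_eq sm.finsupp_closed)

lemma S_mult_single:
  "\<lbrakk>s \<in> carrier C; t \<in> carrier C; a \<in> carrier F; b \<in> carrier F\<rbrakk> \<Longrightarrow>
    single F s a \<otimes>\<^bsub>S\<^esub> single F t b = single F (s \<otimes>\<^bsub>C\<^esub> t) (a \<otimes>\<^bsub>F\<^esub> mat_act K s b)"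
  by (simp add: S_eq sm.mult_single)

lemma xyg_closed [simp]: "xS \<in> carrier S" "yS \<in> carrier S" "gS \<in> carrier S"
  by (simp_all add: S_single_closed)

lemma S_g_pow: "gS [^]\<^bsub>S\<^esub> n = single F (g_mat [^]\<^bsub>C\<^esub> n) \<one>\<^bsub>F\<^esub>" for n :: nat
proof (induction n)
  case 0
  then show ?case by (simp add: S_eq)
next
  case (Suc n)
  then show ?case
    by (simp add: S_mult_single alg_hom_one[OF sm.act_hom])
qed

lemma S_g_pow_p: "gS [^]\<^bsub>S\<^esub> p = \<one>\<^bsub>S\<^esub>"
  by (simp add: S_g_pow g_mat_pow[OF p]) (simp add: S_eq cyc_group_simps[OF p])

lemma S_single_eq_pow:
  assumes "s \<in> carrier C"
  shows "single F s \<one>\<^bsub>F\<^esub> = gS [^]\<^bsub>S\<^esub> transvection_index s"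
  using cyc_group_eq_pow[OF p assms] by (simp add: S_g_pow)

lemma S_gx: "gS \<otimes>\<^bsub>S\<^esub> xS = xS \<otimes>\<^bsub>S\<^esub> gS"
  by (simp add: S_mult_single mat_act_gen[OF p K.is_cring] shear_def sm.act_one)

lemma S_gy: "gS \<otimes>\<^bsub>S\<^esub> yS = (xS \<oplus>\<^bsub>S\<^esub> yS) \<otimes>\<^bsub>S\<^esub> gS"
proof -
  have "xS \<oplus>\<^bsub>S\<^esub> yS = single F \<one>\<^bsub>C\<^esub> (gen K LX \<oplus>\<^bsub>F\<^esub> gen K LY)"
    by (simp add: S_eq sm.add_single)
  then show ?thesis
    by (simp add: S_mult_single mat_act_gen[OF p K.is_cring] index_g_mat shear_def sm.act_one)
qed

lemma S_span: "carrier S \<subseteq> alg_span K S {xS, yS, gS}"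
proof -
  have "single F \<one>\<^bsub>C\<^esub> (gen K l) \<in> alg_span K S {xS, yS, gS}" for l
    by (rule span_incl) (cases l; simp)
  moreover have "single F s \<one>\<^bsub>F\<^esub> \<in> alg_span K S {xS, yS, gS}" if "s \<in> carrier C" for s
    unfolding S_single_eq_pow[OF that] by (intro alg_span_pow span_incl) simp
  ultimately show ?thesis
    unfolding S_eq by (intro sm.smash_span[OF free_algebra_span[OF K.is_cring]]) auto
qed

text \<open>The task is to obtain covariance for the whole cyclic group and all free polynomials
  from relations that mention only u, x and y.\<close>

lemma S_lift_exists:
  assumes B: "kalgebra K B" and x: "x \<in> carrier B" and y: "y \<in> carrier B" and u: "u \<in> carrier B"
    and up: "u [^]\<^bsub>B\<^esub> p = \<one>\<^bsub>B\<^esub>" and ux: "u \<otimes>\<^bsub>B\<^esub> x = x \<otimes>\<^bsub>B\<^esub> u"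
    and uy: "u \<otimes>\<^bsub>B\<^esub> y = (x \<oplus>\<^bsub>B\<^esub> y) \<otimes>\<^bsub>B\<^esub> u"
  obtains \<psi> where "\<psi> \<in> alg_hom K S B" "\<psi> xS = x" "\<psi> yS = y" "\<psi> gS = u"
proof -
  interpret B: kalgebra K B by fact
  define \<sigma> where "\<sigma> l = (case l of LX \<Rightarrow> x | LY \<Rightarrow> y)" for l
  have \<sigma>: "\<sigma> l \<in> carrier B" for l using x y by (cases l) (auto simp: \<sigma>_def)
  define \<alpha> where "\<alpha> = free_lift K B \<sigma>"
  have \<alpha>: "\<alpha> \<in> alg_hom K F B" unfolding \<alpha>_def by (rule free_lift_hom[OF B \<sigma>])
  have gen: "\<alpha> (gen K l) = \<sigma> l" for l unfolding \<alpha>_def by (rule free_lift_gen[OF B \<sigma>])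
  note \<alpha>_hom [simp] = alg_homD[OF \<alpha>]
  have unx: "u [^]\<^bsub>B\<^esub> n \<otimes>\<^bsub>B\<^esub> x = x \<otimes>\<^bsub>B\<^esub> u [^]\<^bsub>B\<^esub> n" for n :: nat
  proof (induction n)
    case (Suc n)
    have "u [^]\<^bsub>B\<^esub> n \<otimes>\<^bsub>B\<^esub> u \<otimes>\<^bsub>B\<^esub> x = (u [^]\<^bsub>B\<^esub> n \<otimes>\<^bsub>B\<^esub> x) \<otimes>\<^bsub>B\<^esub> u"
      using u x by (simp add: B.A.m_assoc ux)
    also have "\<dots> = x \<otimes>\<^bsub>B\<^esub> u [^]\<^bsub>B\<^esub> n \<otimes>\<^bsub>B\<^esub> u" by (simp add: Suc)
    finally show ?case using u x by (simp add: B.A.m_assoc)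
  qed (use x in simp)
  \<comment> \<open>Every u that y passes leaves behind one x, and x commutes with the powers of u;
    the resulting coefficient n is that of \<open>shear\<close>.\<close>
  have uny: "u [^]\<^bsub>B\<^esub> n \<otimes>\<^bsub>B\<^esub> y = (F.nat_scalar n \<odot>\<^bsub>B\<^esub> x \<oplus>\<^bsub>B\<^esub> y) \<otimes>\<^bsub>B\<^esub> u [^]\<^bsub>B\<^esub> n" for n :: nat
  proof (induction n)
    case (Suc n)
    have "u [^]\<^bsub>B\<^esub> n \<otimes>\<^bsub>B\<^esub> u \<otimes>\<^bsub>B\<^esub> y = (u [^]\<^bsub>B\<^esub> n \<otimes>\<^bsub>B\<^esub> x \<oplus>\<^bsub>B\<^esub> u [^]\<^bsub>B\<^esub> n \<otimes>\<^bsub>B\<^esub> y) \<otimes>\<^bsub>B\<^esub> u"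
      using u x y by (simp add: B.A.m_assoc uy B.A.r_distr B.A.l_distr)
    also have "\<dots> = (x \<oplus>\<^bsub>B\<^esub> (F.nat_scalar n \<odot>\<^bsub>B\<^esub> x \<oplus>\<^bsub>B\<^esub> y)) \<otimes>\<^bsub>B\<^esub> u [^]\<^bsub>B\<^esub> n \<otimes>\<^bsub>B\<^esub> u"
      using u x y by (simp add: Suc unx B.A.l_distr)
    also have "x \<oplus>\<^bsub>B\<^esub> (F.nat_scalar n \<odot>\<^bsub>B\<^esub> x \<oplus>\<^bsub>B\<^esub> y) = F.nat_scalar (Suc n) \<odot>\<^bsub>B\<^esub> x \<oplus>\<^bsub>B\<^esub> y"
      using x y by (simp add: B.smult_l_distr B.A.a_ac)
    finally show ?case using u x y by (simp add: B.A.m_assoc)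
  qed (use x y in simp)
  \<comment> \<open>For fixed s the elements a obeying this form a subalgebra, as
    \<open>mat_act K s\<close> is a homomorphism; on x and y it is \<open>unx\<close> and
    \<open>uny\<close>.\<close>
  have comm: "u [^]\<^bsub>B\<^esub> transvection_index s \<otimes>\<^bsub>B\<^esub> \<alpha> a
      = \<alpha> (mat_act K s a) \<otimes>\<^bsub>B\<^esub> u [^]\<^bsub>B\<^esub> transvection_index s"
    if s: "s \<in> carrier C" and a: "a \<in> carrier F" for s a
  proof -
    let ?u = "u [^]\<^bsub>B\<^esub> transvection_index s"
    have uB: "?u \<in> carrier B" using u by simp
    have range: "range (gen K) \<subseteq> carrier F" by auto
    note act = alg_homD[OF sm.act_hom[OF s]]
    show ?thesis
      using free_algebra_span[OF K.is_cring] range a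
    proof (induction rule: F.alg_span_induct)
      case (incl a)
      then obtain l where l: "a = gen K l" by auto
      show ?case
        using s by (cases l)
          (simp_all add: l gen \<sigma>_def mat_act_gen[OF p K.is_cring] shear_def unx uny x y)
    next
      case one
      then show ?case using uB by (simp add: act)
    next
      case (add a b)
      then show ?case using uB s by (simp add: act B.A.l_distr B.A.r_distr)
    next
      case (mult a b)
      have "?u \<otimes>\<^bsub>B\<^esub> (\<alpha> a \<otimes>\<^bsub>B\<^esub> \<alpha> b) = (?u \<otimes>\<^bsub>B\<^esub> \<alpha> a) \<otimes>\<^bsub>B\<^esub> \<alpha> b"
        using mult(1,2) uB by (simp add: B.A.m_assoc)
      also have "\<dots> = \<alpha> (mat_act K s a) \<otimes>\<^bsub>B\<^esub> (?u \<otimes>\<^bsub>B\<^esub> \<alpha> b)"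
        unfolding mult(3) using mult(1,2) uB s by (simp add: B.A.m_assoc)
      also have "\<dots> = \<alpha> (mat_act K s a) \<otimes>\<^bsub>B\<^esub> \<alpha> (mat_act K s b) \<otimes>\<^bsub>B\<^esub> ?u"
        unfolding mult(4) using mult(1,2) uB s by (simp add: B.A.m_assoc)
      finally show ?case using mult(1,2) s by (simp add: act)
    next
      case (smult c a)
      then show ?case using uB s by (simp add: act B.smult_mult_left B.smult_mult_right)
    qed
  qed
  interpret l: crossed_lift K F C "mat_act K" B \<alpha> "\<lambda>s. u [^]\<^bsub>B\<^esub> transvection_index s"
    by (intro crossed_lift.intro crossed_lift_axioms.intro sm.crossed_axioms B \<alpha>)
      (use u in \<open>simp_all add: index_one comm cyc_group_hom[OF p B.A.monoid_axioms u up]\<close>)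
  show ?thesis
  proof
    show "smash_lift F B \<alpha> (\<lambda>s. u [^]\<^bsub>B\<^esub> transvection_index s) \<in> alg_hom K S B"
      unfolding S_eq by (rule l.smash_lift_hom)
  qed (use x y u in \<open>simp_all add: l.smash_lift_single gen \<sigma>_def index_one index_g_mat\<close>)
qed

text \<open>This is \<open>lamS\<close> of \<open>H_algebra\<close>: an element of the group algebra
  placed in the smash product with constant coefficients.\<close>

abbreviation scalars_in_S where "scalars_in_S f \<equiv> (\<lambda>s. f s \<odot>\<^bsub>F\<^esub> \<one>\<^bsub>F\<^esub>)"

text \<open>Each monomial is a scalar times a power of g on both sides, so homomorphisms on S and on
  the group algebra that agree at g agree throughout the latter. This evaluates \<lambda> in an
  arbitrary algebra from the image of g alone.\<close>

lemma scalars_in_S: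
  assumes f: "f \<in> carrier GA"
  shows "scalars_in_S f \<in> carrier S"
    and "\<lbrakk>kalgebra K B; h \<in> alg_hom K S B; h' \<in> alg_hom K GA B; h' g = h gS\<rbrakk> \<Longrightarrow>
      h (scalars_in_S f) = h' f"
proof -
  have f': "f \<in> finsupp_funs K C" using f by (simp add: group_algebra_def)
  \<comment> \<open>One conjunction for the induction: additivity of \<open>h\<close> in the
    \<open>add\<close> case needs both summands to be closed.\<close>
  have "scalars_in_S f \<in> carrier S \<and> (kalgebra K B \<longrightarrow> h \<in> alg_hom K S B \<longrightarrow> h' \<in> alg_hom K GA B
      \<longrightarrow> h' g = h gS \<longrightarrow> h (scalars_in_S f) = h' f)"
    using K.ring_axioms C.monoid_axioms f'
  proof (induction rule: finsupp_induct)
    case (single s c)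
    have eq: "scalars_in_S (single K s c) = c \<odot>\<^bsub>S\<^esub> single F s \<one>\<^bsub>F\<^esub>"
      using single by (auto simp: S_eq single_def)
    have eq': "single K s c = c \<odot>\<^bsub>GA\<^esub> single K s \<one>\<^bsub>K\<^esub>"
      using single by (auto simp: group_algebra_def single_def)
    have "h (c \<odot>\<^bsub>S\<^esub> single F s \<one>\<^bsub>F\<^esub>) = h' (c \<odot>\<^bsub>GA\<^esub> single K s \<one>\<^bsub>K\<^esub>)"
      if "kalgebra K B" "h \<in> alg_hom K S B" "h' \<in> alg_hom K GA B" "h' g = h gS"
      using that single
      by (simp add: S_single_eq_pow[OF single(1)] group_algebra_single[OF p K.is_cring single(1)] alg_hom_smult
          alg_hom_pow[OF S.kalgebra_axioms] alg_hom_pow[OF GA.kalgebra_axioms])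
    then show ?case
      unfolding eq unfolding eq' using single by (auto simp: S_single_closed)
  next
    case (add f f')
    have eq: "scalars_in_S (\<lambda>m. f m \<oplus>\<^bsub>K\<^esub> f' m) = scalars_in_S f \<oplus>\<^bsub>S\<^esub> scalars_in_S f'"
      using add by (auto simp: S_eq F.smult_l_distr finsupp_funs_iff)
    have eq': "(\<lambda>m. f m \<oplus>\<^bsub>K\<^esub> f' m) = f \<oplus>\<^bsub>GA\<^esub> f'" by (simp add: group_algebra_def)
    have "f \<in> carrier GA" "f' \<in> carrier GA" using add by (simp_all add: group_algebra_def)
    then show ?case
      unfolding eq unfolding eq' using add by (auto simp: alg_hom_add)
  qed
  then show "scalars_in_S f \<in> carrier S"
    and "\<lbrakk>kalgebra K B; h \<in> alg_hom K S B; h' \<in> alg_hom K GA B; h' g = h gS\<rbrakk> \<Longrightarrow>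
      h (scalars_in_S f) = h' f"
    by auto
qed

section \<open>The ring R by generators and relations\<close>

sublocale U: kalgebra K "UP K"
  by (rule UP_kalgebra(1)) (rule K.is_cring)

lemma tensor_UP_GA: "tensor K (UP K) GA"
  by (intro tensor.intro U.kalgebra_axioms GA.kalgebra_axioms)

lemma R_eq: "R = tensor_algebra K (UP K) GA"
  by (simp add: R_algebra_def)

sublocale R: kalgebra K R
  unfolding R_eq by (rule tensor.tensor_kalgebra[OF tensor_UP_GA])

lemma R_cring: "cring R"
  unfolding R_eq
  by (rule tensor.tensor_comm[OF tensor_UP_GA]) (rule UP_kalgebra(2) group_algebra_kalgebra(2)[OF p] K.is_cring)+

lemma xR_eq: "xR = R_of_poly K p (up_var K)"
  unfolding R_x_def monom_one_eq_up_var[OF K.is_cring] ..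

lemma R_of_poly_hom: "R_of_poly K p \<in> alg_hom K (UP K) R"
  using tensor.pure_left_hom[OF tensor_UP_GA] by (simp add: R_of_poly_def[abs_def] R_eq)

lemma R_of_group_algebra_hom: "R_of_group_algebra K p \<in> alg_hom K GA R"
  using tensor.pure_right_hom[OF tensor_UP_GA] by (simp add: R_of_group_algebra_def[abs_def] R_eq)

lemma xR_closed [simp]: "xR \<in> carrier R"
  unfolding xR_eq by (rule alg_hom_closed[OF R_of_poly_hom up_var_closed[OF K.is_cring]])

lemma gR_closed [simp]: "gR \<in> carrier R"
  unfolding R_g_def by (rule alg_hom_closed[OF R_of_group_algebra_hom g_closed])

lemma gR_pow: "gR [^]\<^bsub>R\<^esub> p = \<one>\<^bsub>R\<^esub>"
  unfolding R_g_def
  using alg_hom_pow[OF GA.kalgebra_axioms R.kalgebra_axioms R_of_group_algebra_hom g_closed, of p]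
  by (simp add: group_algebra_g_pow[OF p K.is_cring] alg_hom_one[OF R_of_group_algebra_hom])

lemma R_span: "carrier R \<subseteq> alg_span K R {xR, gR}"
  unfolding R_eq
proof (rule tensor.tensor_span[OF tensor_UP_GA UP_span[OF K.is_cring] _ group_algebra_span[OF p K.is_cring]])
  show "{up_var K} \<subseteq> carrier (UP K)" "{g} \<subseteq> carrier GA"
    using up_var_closed[OF K.is_cring] by simp_all
qed (auto intro!: span_incl simp: xR_eq R_of_poly_def R_g_def R_of_group_algebra_def)

text \<open>Only the images of x and g are assumed to commute. The centralizer argument is applied
  twice: it spreads this over the group algebra for the fixed image of x, and then over K[x] for
  each fixed image from the group algebra.\<close>

lemma R_lift_exists:
  assumes B: "kalgebra K B" and x: "x \<in> carrier B" and u: "u \<in> carrier B"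
    and up: "u [^]\<^bsub>B\<^esub> p = \<one>\<^bsub>B\<^esub>" and ux: "u \<otimes>\<^bsub>B\<^esub> x = x \<otimes>\<^bsub>B\<^esub> u"
  obtains \<psi> where "\<psi> \<in> alg_hom K R B" "\<psi> xR = x" "\<psi> gR = u"
proof -
  interpret B: kalgebra K B by fact
  obtain \<alpha> where \<alpha>: "\<alpha> \<in> alg_hom K (UP K) B" "\<alpha> (up_var K) = x"
    by (rule UP_lift_exists[OF B x])
  obtain \<beta> where \<beta>: "\<beta> \<in> alg_hom K GA B" "\<beta> g = u"
    by (rule group_algebra_lift_exists[OF p B u up])
  have \<beta>x: "\<beta> b \<otimes>\<^bsub>B\<^esub> x = x \<otimes>\<^bsub>B\<^esub> \<beta> b" if "b \<in> carrier GA" for b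
    by (rule commute_with_image[OF GA.kalgebra_axioms B \<beta>(1) group_algebra_span[OF p K.is_cring]])
      (use x ux \<beta>(2) that in auto)
  have comm: "\<beta> b \<otimes>\<^bsub>B\<^esub> \<alpha> a = \<alpha> a \<otimes>\<^bsub>B\<^esub> \<beta> b" if a: "a \<in> carrier (UP K)" and b: "b \<in> carrier GA" for a b
    by (rule commute_with_image[symmetric, OF U.kalgebra_axioms B \<alpha>(1) UP_span[OF K.is_cring] _ _ _ a])
      (use up_var_closed[OF K.is_cring] \<alpha>(2) \<beta>x[OF b] alg_hom_closed[OF \<beta>(1) b] in auto)
  obtain \<psi> where \<psi>: "\<psi> \<in> alg_hom K R B"
    and pure: "\<And>a b. \<lbrakk>a \<in> carrier (UP K); b \<in> carrier GA\<rbrakk> \<Longrightarrow> \<psi> (pure_tensor K (UP K) GA a b) = \<alpha> a \<otimes>\<^bsub>B\<^esub> \<beta> b"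
    using tensor.tensor_lift_exists[OF tensor_UP_GA B \<alpha>(1) \<beta>(1) comm] unfolding R_eq by metis
  show ?thesis
  proof (rule that[OF \<psi>])
    show "\<psi> xR = x"
      using pure[OF up_var_closed[OF K.is_cring] GA.A.one_closed] x
      by (simp add: xR_eq R_of_poly_def alg_hom_one[OF \<beta>(1)] \<alpha>(2))
    show "\<psi> gR = u"
      using pure[OF U.A.one_closed g_closed] u
      by (simp add: R_g_def R_of_group_algebra_def alg_hom_one[OF \<alpha>(1)] \<beta>(2))
  qed
qed

text \<open>Linearity and the Leibniz rule determine a derivation on the subalgebra generated by x
  and g, which is all of R; off the carrier extensionality makes both functions
  \<open>undefined\<close>.\<close>

lemma derivation_unique:
  assumes "\<delta> \<in> derivations K R" and "\<delta>' \<in> derivations K R"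
    and "\<delta> xR = \<delta>' xR" and "\<delta> gR = \<delta>' gR"
  shows "\<delta> = \<delta>'"
proof
  interpret o1: ore K R \<delta> by (intro ore.intro ore_axioms.intro R.kalgebra_axioms R_cring assms)
  interpret o2: ore K R \<delta>' by (intro ore.intro ore_axioms.intro R.kalgebra_axioms R_cring assms)
  fix a
  show "\<delta> a = \<delta>' a"
  proof (cases "a \<in> carrier R")
    case True
    have gens: "{xR, gR} \<subseteq> carrier R" by simp
    show ?thesis
      using R_span gens True
      by (induction rule: R.alg_span_induct)
        (auto simp: assms(3,4) o1.\<delta>_add o2.\<delta>_add o1.\<delta>_mult o2.\<delta>_mult o1.\<delta>_smult o2.\<delta>_smult)
  next
    case False
    then show ?thesis using assms(1,2) by (auto simp: derivations_def PiE_def extensional_def)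
  qed
qed

context
  fixes lam :: "mat2 \<Rightarrow> 'k"
  assumes lam: "lam \<in> carrier GA"
begin

abbreviation lamR where "lamR \<equiv> R_of_group_algebra K p lam"

lemma lamR_closed [simp]: "lamR \<in> carrier R"
  by (rule alg_hom_closed[OF R_of_group_algebra_hom lam])

text \<open>In the dual numbers, \<open>(g + x g \<epsilon>) ^ n = g ^ n + n x g ^ n \<epsilon>\<close>.\<close>

lemma derivation_exists:
  obtains \<delta> where "\<delta> \<in> derivations K R" and "\<delta> xR = lamR" and "\<delta> gR = xR \<otimes>\<^bsub>R\<^esub> gR"
proof -
  interpret Rc: cring R by (rule R_cring)
  let ?D = "dual_numbers R"
  interpret D: kalgebra K ?D by (rule dual_numbers_kalgebra[OF R.kalgebra_axioms])
  \<comment> \<open>The \<epsilon>-parts are the values prescribed for \<delta> on x and g.\<close>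
  let ?x = "(xR, lamR)" and ?u = "(gR, xR \<otimes>\<^bsub>R\<^esub> gR)"
  have u_pow: "?u [^]\<^bsub>?D\<^esub> n = (gR [^]\<^bsub>R\<^esub> n, R.nat_scalar n \<odot>\<^bsub>R\<^esub> (xR \<otimes>\<^bsub>R\<^esub> gR [^]\<^bsub>R\<^esub> n))" for n :: nat
  proof (induction n)
    case (Suc n)
    have "gR [^]\<^bsub>R\<^esub> n \<otimes>\<^bsub>R\<^esub> (xR \<otimes>\<^bsub>R\<^esub> gR) = xR \<otimes>\<^bsub>R\<^esub> (gR [^]\<^bsub>R\<^esub> n \<otimes>\<^bsub>R\<^esub> gR)"
      by (simp add: Rc.m_lcomm)
    then show ?case
      using Suc
      by (simp add: R.smult_l_distr R.smult_mult_left R.A.m_assoc R.A.a_comm)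
  qed simp
  \<comment> \<open>The \<epsilon>-part of the p-th power carries the factor p, so the relation
    required by \<open>R_lift_exists\<close> holds.\<close>
  have "R.nat_scalar p = \<zero>\<^bsub>K\<^esub>"
    using char by (simp add: has_characteristic_def)
  then have up: "?u [^]\<^bsub>?D\<^esub> p = \<one>\<^bsub>?D\<^esub>"
    by (simp add: u_pow gR_pow)
  have ux: "?u \<otimes>\<^bsub>?D\<^esub> ?x = ?x \<otimes>\<^bsub>?D\<^esub> ?u"
    by (simp add: Rc.m_ac Rc.m_comm R.A.a_comm)
  obtain h where h: "h \<in> alg_hom K R ?D" and hx: "h xR = ?x" and hg: "h gR = ?u"
    by (rule R_lift_exists[OF D.kalgebra_axioms _ _ up ux]) auto
  have fst_hom: "fst \<in> alg_hom K ?D R" by (rule alg_homI) auto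
  \<comment> \<open>Dropping the \<epsilon>-part is a homomorphism, so \<open>fst\<close> after
    \<open>h\<close> is an endomorphism of R fixing x and g, hence the identity.\<close>
  have fst: "fst (h a) = a" if "a \<in> carrier R" for a
    by (rule alg_hom_agree[OF R.kalgebra_axioms alg_hom_comp[OF h fst_hom] alg_hom_id R_span _ _ that])
      (auto simp: hx hg)
  show ?thesis
    by (rule that[OF dual_numbers_derivation[OF R.kalgebra_axioms h fst]]) (simp_all add: hx hg)
qed

section \<open>The algebra H by generators and relations\<close>

abbreviation relator where
  "relator \<equiv> xS \<otimes>\<^bsub>S\<^esub> yS \<ominus>\<^bsub>S\<^esub> yS \<otimes>\<^bsub>S\<^esub> xS \<ominus>\<^bsub>S\<^esub> scalars_in_S lam"
abbreviation H where "H \<equiv> H_algebra K p lam"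
abbreviation proj where "proj a \<equiv> Idl\<^bsub>S\<^esub> {relator} +>\<^bsub>S\<^esub> a"

lemma relator_closed: "{relator} \<subseteq> carrier S"
  using scalars_in_S(1)[OF lam] by simp

lemma relator_ideal: "alg_ideal K S (Idl\<^bsub>S\<^esub> {relator})"
  by (rule genideal_alg_ideal[OF S.kalgebra_axioms relator_closed])

lemma H_eq: "H = quotient_algebra S (Idl\<^bsub>S\<^esub> {relator})"
  by (simp add: H_algebra_def Let_def)

lemma H_kalgebra: "kalgebra K H"
  unfolding H_eq by (rule alg_ideal.quotient_kalgebra[OF relator_ideal])

lemma proj_hom: "(\<lambda>a. proj a) \<in> alg_hom K S H"
  unfolding H_eq by (rule alg_ideal.coset_hom[OF relator_ideal])

lemma H_span: "carrier H \<subseteq> alg_span K H {proj xS, proj yS, proj gS}"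
  unfolding H_eq by (rule alg_ideal.quotient_span[OF relator_ideal S_span]) (auto intro: span_incl)

text \<open>The value of \<lambda> at u is passed as \<beta>(\<lambda>) for a homomorphism \<beta>
  with \<beta>(g) = u, so no sum over the group is formed. With it, \<open>xy\<close> says that the
  lift from S kills the relator.\<close>

lemma H_lift_exists:
  assumes B: "kalgebra K B" and x: "x \<in> carrier B" and y: "y \<in> carrier B" and u: "u \<in> carrier B"
    and up: "u [^]\<^bsub>B\<^esub> p = \<one>\<^bsub>B\<^esub>" and ux: "u \<otimes>\<^bsub>B\<^esub> x = x \<otimes>\<^bsub>B\<^esub> u"
    and uy: "u \<otimes>\<^bsub>B\<^esub> y = (x \<oplus>\<^bsub>B\<^esub> y) \<otimes>\<^bsub>B\<^esub> u"
    and \<beta>: "\<beta> \<in> alg_hom K GA B" "\<beta> g = u" and xy: "x \<otimes>\<^bsub>B\<^esub> y = y \<otimes>\<^bsub>B\<^esub> x \<oplus>\<^bsub>B\<^esub> \<beta> lam"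
  obtains \<psi> where "\<psi> \<in> alg_hom K H B" "\<psi> (proj xS) = x" "\<psi> (proj yS) = y" "\<psi> (proj gS) = u"
proof -
  interpret B: kalgebra K B by fact
  obtain \<phi> where \<phi>: "\<phi> \<in> alg_hom K S B" "\<phi> xS = x" "\<phi> yS = y" "\<phi> gS = u"
    by (rule S_lift_exists[OF B x y u up ux uy])
  have "\<phi> (scalars_in_S lam) = \<beta> lam"
    by (rule scalars_in_S(2)[OF lam B \<phi>(1) \<beta>(1)]) (simp add: \<beta>(2) \<phi>(4))
  then have "\<phi> relator = x \<otimes>\<^bsub>B\<^esub> y \<ominus>\<^bsub>B\<^esub> y \<otimes>\<^bsub>B\<^esub> x \<ominus>\<^bsub>B\<^esub> \<beta> lam"
    using scalars_in_S(1)[OF lam] \<phi>(2,3)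
    by (simp add: alg_hom_minus[OF S.kalgebra_axioms B \<phi>(1)] alg_hom_mult[OF \<phi>(1)])
  also have "\<dots> = \<zero>\<^bsub>B\<^esub>"
    unfolding xy using x y alg_hom_closed[OF \<beta>(1) lam]
    by (simp add: a_minus_def B.A.a_ac B.A.r_neg B.A.r_neg1)
  finally have "\<phi> r = \<zero>\<^bsub>B\<^esub>" if "r \<in> {relator}" for r using that by simp
  then obtain \<psi> where "\<psi> \<in> alg_hom K H B" "\<And>a. a \<in> carrier S \<Longrightarrow> \<psi> (proj a) = \<phi> a"
    using quotient_lift_exists[OF S.kalgebra_axioms B relator_closed \<phi>(1)] unfolding H_eq by metis
  then show ?thesis using that[of \<psi>] \<phi> by simp
qed

text \<open>The first three are identities of S pushed to the quotient; the last holds because the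
  relator lies in the ideal. For a map out of the Ore extension the first and third give the part on
  R, the other two the commutation with y.\<close>

lemma H_relations:
  "proj gS \<otimes>\<^bsub>H\<^esub> proj xS = proj xS \<otimes>\<^bsub>H\<^esub> proj gS"
  "proj gS \<otimes>\<^bsub>H\<^esub> proj yS = (proj xS \<oplus>\<^bsub>H\<^esub> proj yS) \<otimes>\<^bsub>H\<^esub> proj gS"
  "proj gS [^]\<^bsub>H\<^esub> p = \<one>\<^bsub>H\<^esub>"
  "proj xS \<otimes>\<^bsub>H\<^esub> proj yS = proj yS \<otimes>\<^bsub>H\<^esub> proj xS \<oplus>\<^bsub>H\<^esub> proj (scalars_in_S lam)"
proof -
  interpret H: kalgebra K H by (rule H_kalgebra)
  note hom = alg_homD[OF proj_hom]
  have lS: "scalars_in_S lam \<in> carrier S" by (rule scalars_in_S(1)[OF lam])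
  show "proj gS \<otimes>\<^bsub>H\<^esub> proj xS = proj xS \<otimes>\<^bsub>H\<^esub> proj gS"
    unfolding hom(3)[OF xyg_closed(3,1), symmetric] hom(3)[OF xyg_closed(1,3), symmetric] S_gx ..
  have "proj gS \<otimes>\<^bsub>H\<^esub> proj yS = proj ((xS \<oplus>\<^bsub>S\<^esub> yS) \<otimes>\<^bsub>S\<^esub> gS)"
    unfolding hom(3)[OF xyg_closed(3,2), symmetric] S_gy ..
  then show "proj gS \<otimes>\<^bsub>H\<^esub> proj yS = (proj xS \<oplus>\<^bsub>H\<^esub> proj yS) \<otimes>\<^bsub>H\<^esub> proj gS"
    using hom(2)[OF xyg_closed(1,2)] hom(3)[OF S.A.a_closed[OF xyg_closed(1,2)] xyg_closed(3)]
    by (simp only:)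
  show "proj gS [^]\<^bsub>H\<^esub> p = \<one>\<^bsub>H\<^esub>"
    using alg_hom_pow[OF S.kalgebra_axioms H.kalgebra_axioms proj_hom xyg_closed(3), of p] S_g_pow_p
    by (simp add: hom(4))
  have "proj relator = \<zero>\<^bsub>H\<^esub>"
    unfolding H_eq using relator_closed S.A.genideal_self[OF relator_closed]
    by (subst alg_ideal.coset_eq_zero_iff[OF relator_ideal]) auto
  then have "proj xS \<otimes>\<^bsub>H\<^esub> proj yS \<ominus>\<^bsub>H\<^esub> proj yS \<otimes>\<^bsub>H\<^esub> proj xS \<ominus>\<^bsub>H\<^esub> proj (scalars_in_S lam) = \<zero>\<^bsub>H\<^esub>"
    using lS by (simp add: alg_hom_minus[OF S.kalgebra_axioms H.kalgebra_axioms proj_hom] hom(3))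
  then show "proj xS \<otimes>\<^bsub>H\<^esub> proj yS
      = proj yS \<otimes>\<^bsub>H\<^esub> proj xS \<oplus>\<^bsub>H\<^esub> proj (scalars_in_S lam)"
    by (intro H.A.eq_add_of_minus_minus_eq_zero H.A.m_closed hom(1) xyg_closed lS)
qed

lemma H_isomorphic_ore:
  assumes \<delta>: "\<delta> \<in> derivations K R" and \<delta>x: "\<delta> xR = lamR" and \<delta>g: "\<delta> gR = xR \<otimes>\<^bsub>R\<^esub> gR"
  shows "isomorphic_algebras K H (ore_extension R \<delta>)"
proof -
  interpret Rc: cring R by (rule R_cring)
  interpret H: kalgebra K H by (rule H_kalgebra)
  interpret ore K R \<delta> by (intro ore.intro ore_axioms.intro R.kalgebra_axioms R_cring \<delta>)
  note emb = alg_homD[OF emb_hom]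
  have gu: "emb gR [^]\<^bsub>Ore\<^esub> p = \<one>\<^bsub>Ore\<^esub>"
    using alg_hom_pow[OF R.kalgebra_axioms Ore.kalgebra_axioms emb_hom gR_closed, of p]
    by (simp add: gR_pow emb(4))
  have gx: "emb gR \<otimes>\<^bsub>Ore\<^esub> emb xR = emb xR \<otimes>\<^bsub>Ore\<^esub> emb gR"
    by (simp flip: emb(3) add: Rc.m_comm)
  \<comment> \<open>With \<delta>(g) = x g the Ore rule reads g y = y g + x g, which is the action
    relation.\<close>
  have gy: "emb gR \<otimes>\<^bsub>Ore\<^esub> Y = (emb xR \<oplus>\<^bsub>Ore\<^esub> Y) \<otimes>\<^bsub>Ore\<^esub> emb gR"
    using Y_closed emb(1)
    by (simp add: emb_Y \<delta>g emb(3) Ore.A.l_distr Ore.A.a_comm)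
  have xy: "emb xR \<otimes>\<^bsub>Ore\<^esub> Y = Y \<otimes>\<^bsub>Ore\<^esub> emb xR \<oplus>\<^bsub>Ore\<^esub> emb lamR"
    by (simp add: emb_Y \<delta>x)
  obtain \<Phi> where \<Phi>: "\<Phi> \<in> alg_hom K H Ore"
    "\<Phi> (proj xS) = emb xR" "\<Phi> (proj yS) = Y" "\<Phi> (proj gS) = emb gR"
    by (rule H_lift_exists[OF Ore.kalgebra_axioms emb(1)[OF xR_closed] Y_closed
          emb(1)[OF gR_closed] gu gx gy alg_hom_comp[OF R_of_group_algebra_hom emb_hom] _ xy])
      (auto simp: R_g_def)
  have cl [simp]: "proj xS \<in> carrier H" "proj yS \<in> carrier H" "proj gS \<in> carrier H"
    by (simp_all add: alg_hom_closed[OF proj_hom])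
  obtain \<rho> where \<rho>: "\<rho> \<in> alg_hom K R H" "\<rho> xR = proj xS" "\<rho> gR = proj gS"
    by (rule R_lift_exists[OF H.kalgebra_axioms cl(1,3) H_relations(3,1)])
  note \<rho>_hom [simp] = alg_homD[OF \<rho>(1)]
  \<comment> \<open>\<open>proj\<close> on S and \<rho> after the embedding of the group algebra
    into R agree at g, which identifies the two images of \<lambda>.\<close>
  have \<rho>lam: "\<rho> lamR = proj (scalars_in_S lam)"
    using scalars_in_S(2)[OF lam H.kalgebra_axioms proj_hom
        alg_hom_comp[OF R_of_group_algebra_hom \<rho>(1)]] \<rho>(3) by (simp add: R_g_def)
  \<comment> \<open>For x this is the defining relation with \<lambda>, for g the action relation;
    the other cases extend it to all of R.\<close>
  have comm: "\<rho> a \<otimes>\<^bsub>H\<^esub> proj yS = proj yS \<otimes>\<^bsub>H\<^esub> \<rho> a \<oplus>\<^bsub>H\<^esub> \<rho> (\<delta> a)" if a: "a \<in> carrier R" for a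
  proof -
    have gens: "{xR, gR} \<subseteq> carrier R" by simp
    show ?thesis
      using R_span gens a
    proof (induction rule: R.alg_span_induct)
      case (incl a)
      then consider "a = xR" | "a = gR" by blast
      then show ?case
      proof cases
        case 1
        then show ?thesis by (simp add: \<rho>(2) \<delta>x \<rho>lam H_relations(4))
      next
        case 2
        then show ?thesis
          by (simp add: \<rho>(2,3) \<delta>g H_relations(2) H.A.l_distr H.A.a_comm)
      qed
    next
      case one
      then show ?case by (simp add: alg_hom_zero[OF R.kalgebra_axioms H.kalgebra_axioms \<rho>(1)])
    next
      case (add a b)
      then show ?case by (simp add: \<delta>_add H.A.l_distr H.A.r_distr H.A.a_ac)
    next
      case (mult a b)
      \<comment> \<open>Here y moves left past b and then past a; the two correction terms are the
        Leibniz expansion of \<delta>(a b).\<close>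
      have "\<rho> a \<otimes>\<^bsub>H\<^esub> \<rho> b \<otimes>\<^bsub>H\<^esub> proj yS = \<rho> a \<otimes>\<^bsub>H\<^esub> (\<rho> b \<otimes>\<^bsub>H\<^esub> proj yS)"
        using mult(1,2) by (simp add: H.A.m_assoc)
      also have "\<dots> = \<rho> a \<otimes>\<^bsub>H\<^esub> proj yS \<otimes>\<^bsub>H\<^esub> \<rho> b \<oplus>\<^bsub>H\<^esub> \<rho> a \<otimes>\<^bsub>H\<^esub> \<rho> (\<delta> b)"
        unfolding mult(4) using mult(1,2) by (simp add: H.A.m_assoc H.A.r_distr)
      also have "\<dots> = proj yS \<otimes>\<^bsub>H\<^esub> (\<rho> a \<otimes>\<^bsub>H\<^esub> \<rho> b)
          \<oplus>\<^bsub>H\<^esub> (\<rho> a \<otimes>\<^bsub>H\<^esub> \<rho> (\<delta> b) \<oplus>\<^bsub>H\<^esub> \<rho> (\<delta> a) \<otimes>\<^bsub>H\<^esub> \<rho> b)"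
        unfolding mult(3) using mult(1,2) by (simp add: H.A.m_assoc H.A.l_distr H.A.a_ac)
      finally show ?case using mult(1,2) by (simp add: \<delta>_mult)
    next
      case (smult c a)
      then show ?case
        by (simp add: \<delta>_smult H.smult_mult_left H.smult_mult_right H.smult_r_distr)
    qed
  qed
  obtain \<Psi> where \<Psi>: "\<Psi> \<in> alg_hom K Ore H" "\<And>a. a \<in> carrier R \<Longrightarrow> \<Psi> (emb a) = \<rho> a" "\<Psi> Y = proj yS"
    by (rule ore_lift_exists[OF H.kalgebra_axioms \<rho>(1) cl(2)]) (erule comm, rule that)
  have Ore_span: "carrier Ore \<subseteq> alg_span K Ore {emb xR, emb gR, Y}"
    by (rule ore_span[OF R_span]) (auto intro: span_incl)
  show ?thesis
  proof (rule isomorphic_algebrasI[OF \<Phi>(1) \<Psi>(1)])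
    show "\<Psi> (\<Phi> a) = a" if "a \<in> carrier H" for a
      by (rule alg_hom_agree[OF H.kalgebra_axioms alg_hom_comp[OF \<Phi>(1) \<Psi>(1)] alg_hom_id H_span _ _ that])
        (auto simp: \<Phi> \<Psi> \<rho>)
    show "\<Phi> (\<Psi> b) = b" if "b \<in> carrier Ore" for b
      by (rule alg_hom_agree[OF Ore.kalgebra_axioms alg_hom_comp[OF \<Psi>(1) \<Phi>(1)] alg_hom_id Ore_span _ _ that])
        (auto simp: \<Phi> \<Psi> \<rho> emb Y_closed)
  qed
qed

end

end

text \<open>Uniqueness belongs to the claim because \<delta> is described by its values on x and g
  only; it makes the Ore extension in the statement well determined.\<close>

theorem proposition3p1:
  fixes K :: "('k, 'c) ring_scheme" and p :: nat and lam :: "mat2 \<Rightarrow> 'k"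
  assumes "algebraically_closed K"
    and "Factorial_Ring.prime p" and "odd p"
    and "has_characteristic K p"
    and "lam \<in> carrier (group_algebra K p)"
  shows "\<exists>\<delta>. \<delta> \<in> derivations K (R_algebra K p) \<and>
      \<delta> (R_x K p) = R_of_group_algebra K p lam \<and>
      \<delta> (R_g K p) = R_x K p \<otimes>\<^bsub>R_algebra K p\<^esub> R_g K p \<and>
      (\<forall>\<delta>' \<in> derivations K (R_algebra K p).
        \<delta>' (R_x K p) = R_of_group_algebra K p lam \<and>
        \<delta>' (R_g K p) = R_x K p \<otimes>\<^bsub>R_algebra K p\<^esub> R_g K p \<longrightarrow> \<delta>' = \<delta>) \<and>
      isomorphic_algebras K (H_algebra K p lam) (ore_extension (R_algebra K p) \<delta>)"
proof -
  interpret K: algebraically_closed K by fact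
  interpret char_p_setup K p
    by (intro char_p_setup.intro char_p_setup_axioms.intro K.is_cring prime_gt_1_nat assms(2,4))
  obtain \<delta> where "\<delta> \<in> derivations K (R_algebra K p)" "\<delta> (R_x K p) = R_of_group_algebra K p lam"
    "\<delta> (R_g K p) = R_x K p \<otimes>\<^bsub>R_algebra K p\<^esub> R_g K p"
    by (rule derivation_exists[OF assms(5)])
  then show ?thesis
    using derivation_unique H_isomorphic_ore[OF assms(5)] by (intro exI[of _ \<delta>]) metis
qed

end
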